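(* Let $M$ be an $m$-dimensional globally hyperbolic spacetime admitting a compact spacelike Cauchy surface and let $0\le k\le m$. Let $\omega_{\rm tor}:\mathcal W(\mathsf{Top}^k_{\rm tor}(M))\to\mathbb C$ be the linear functional specified by $$\omega_{\rm tor}(W(t,\tilde t))=\begin{cases}1&\text{if }t=0,\ \tilde t=0,\\0&\text{otherwise.}\end{cases}$$ Then $\omega_{\rm tor}$ is a faithful state on the $C^*$-algebra $\mathcal W(\mathsf{Top}^k_{\rm tor}(M))$. Furthermore, for this state and its analogue on $\mathcal W(\mathsf{Top}^{m-k}_{\rm tor}(M))$ one has $$\omega_{\rm tor}\circ\mathcal W(\zeta_{\rm tor})=\omega_{\rm tor},$$ where $\mathcal W(\zeta_{\rm tor}):\mathcal W(\mathsf{Top}^k_{\rm tor}(M))\to\mathcal W(\mathsf{Top}^{m-k}_{\rm tor}(M))$ is the $C^*$-isomorphism with $W(t,\tilde t)\mapsto W(\zeta_{\rm tor}(t,\tilde t))$.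
   Context: A spacetime is an oriented and time-oriented Lorentzian manifold; manifolds are connected and of finite type (finite good cover). $\mathbb T=\mathbb R/\mathbb Z$; $A^{p,q}=A^p\times A^q$ for a graded group $A$. $i_\Sigma:\Sigma\to M$ is the embedding of a compact spacelike Cauchy surface, oriented by the orientation and time-orientation of $M$. $H^p_{\rm tor}(\cdot;\mathbb Z)$ is the torsion subgroup of $H^p(\cdot;\mathbb Z)$, $j$ its inclusion; $\beta:H^{p-1}(\cdot;\mathbb T)\to H^p_{\rm tor}(\cdot;\mathbb Z)$ is the surjective natural homomorphism given by the connecting (Bockstein) homomorphism of $0\to\mathbb Z\to\mathbb R\to\mathbb T\to0$, with the sign convention for which $\mathrm{char}\circ\kappa=j\circ\beta$ in differential cohomology $\hat H^p(\cdot;\mathbb Z)$, where $\kappa:H^{p-1}(\cdot;\mathbb T)\to\hat H^p(\cdot;\mathbb Z)$ is the inclusion of flat classes and $\mathrm{char}:\hat H^p(\cdot;\mathbb Z)\to H^p(\cdot;\mathbb Z)$ the characteristic class. $\mathsf{Top}^k_{\rm tor}(M)=H^{k,m-k}_{\rm tor}(M;\mathbb Z)$, with symplectic form $\sigma_{\rm tor}((t,\tilde t),(t',\tilde t'))=\langle\tilde t,t'\rangle_{\rm tor}-\langle\tilde t',t\rangle_{\rm tor}\in\mathbb T$, where $\langle s,s'\rangle_{\rm tor}=(v\smile j\,i_\Sigma^*s')[\Sigma]\in\mathbb T$ for any $\mathbb T$-valued class $v$ on $\Sigma$ with $\beta v=i_\Sigma^*s$ (the torsion linking pairing). Duality: $\zeta_{\rm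 tor}:\mathsf{Top}^k_{\rm tor}(M)\to\mathsf{Top}^{m-k}_{\rm tor}(M)$, $(t,\tilde t)\mapsto(\tilde t,(-1)^{k(m-k)+1}t)$; it preserves $\sigma_{\rm tor}$. Weyl algebra: for an abelian group $G$ with antisymmetric bihomomorphism $\sigma:G\times G\to\mathbb T$, $\mathcal W(G)$ is the enveloping $C^*$-algebra of the Banach $*$-algebra obtained by completing, in the norm $\|\sum_j\alpha_jW(g_j)\|_1=\sum_j|\alpha_j|$ (distinct $g_j$), the unital $*$-algebra spanned by linearly independent symbols $W(g)$, $g\in G$, with $W(g)^*=W(-g)$, $W(g)W(g')=e^{2\pi i\sigma(g,g')}W(g+g')$. A functional given on generators is extended by linearity and continuity. A state $\omega$ is faithful if $\omega(a^*a)=0$ implies $a=0$. *)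

theory Defs
  imports "HOL-Analysis.Analysis" "HOL-Homology.Homology"
begin

section \<open>Spacetimes\<close>

subsection \<open>Smooth maps\<close>

text \<open>Only used for open sets \<open>S\<close>: all iterated directional derivatives exist and are continuous.\<close>

primrec Ck_on :: "nat \<Rightarrow> ('a::real_normed_vector \<Rightarrow> 'b::real_normed_vector) \<Rightarrow> 'a set \<Rightarrow> bool" where
  "Ck_on 0 f S \<longleftrightarrow> continuous_on S f"
| "Ck_on (Suc r) f S \<longleftrightarrow> f differentiable_on S \<and>
     (\<forall>v. Ck_on r (\<lambda>x. frechet_derivative f (at x) v) S)"

definition smooth_on :: "'a set \<Rightarrow> ('a::real_normed_vector \<Rightarrow> 'b::real_normed_vector) \<Rightarrow> bool" where
  "smooth_on S f \<longleftrightarrow> (\<forall>r. Ck_on r f S)"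

definition jacobian :: "(real^'m \<Rightarrow> real^'m) \<Rightarrow> real^'m \<Rightarrow> real^'m^'m" where
  "jacobian f x = matrix (frechet_derivative f (at x))"

subsection \<open>Oriented and time-oriented Lorentzian manifolds\<close>

type_synonym ('a, 'm) chart = "'a set \<times> ('a \<Rightarrow> real^'m)"

text \<open>
  The dimension is \<open>CARD('m)\<close>. Tensor fields are given by their components in every chart of the
  atlas. The orientation is the (maximal oriented) atlas itself, the time-orientation is
  represented by the timelike vector field \<open>tvec\<close>, which is future-directed by definition.
\<close>

record ('a, 'm) spacetime_data =
  mtop :: "'a topology"
  atlas :: "('a, 'm) chart set"
  gmat :: "('a, 'm) chart \<Rightarrow> 'a \<Rightarrow> real^'m^'m"
  tvec :: "('a, 'm) chart \<Rightarrow> 'a \<Rightarrow> real^'m"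

definition is_chart :: "'a topology \<Rightarrow> ('a, 'm::finite) chart \<Rightarrow> bool" where
  "is_chart X c \<longleftrightarrow> openin X (fst c) \<and> open (snd c ` fst c) \<and>
     homeomorphic_map (subtopology X (fst c)) (top_of_set (snd c ` fst c)) (snd c)"

definition transition :: "('a, 'm) chart \<Rightarrow> ('a, 'm) chart \<Rightarrow> real^'m \<Rightarrow> real^'m" where
  "transition c c' = snd c' \<circ> inv_into (fst c) (snd c)"

definition oriented_compatible :: "('a, 'm::finite) chart \<Rightarrow> ('a, 'm) chart \<Rightarrow> bool" where
  "oriented_compatible c c' \<longleftrightarrow>
     smooth_on (snd c ` (fst c \<inter> fst c')) (transition c c') \<and>
     (\<forall>x \<in> snd c ` (fst c \<inter> fst c'). det (jacobian (transition c c') x) > 0)"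

definition maximal_oriented_atlas :: "'a topology \<Rightarrow> ('a, 'm::finite) chart set \<Rightarrow> bool" where
  "maximal_oriented_atlas X A \<longleftrightarrow>
     (\<forall>c\<in>A. is_chart X c) \<and> (\<Union>c\<in>A. fst c) = topspace X \<and>
     (\<forall>c\<in>A. \<forall>c'\<in>A. oriented_compatible c c') \<and>
     (\<forall>c. is_chart X c \<and> (\<forall>c'\<in>A. oriented_compatible c c' \<and> oriented_compatible c' c) \<longrightarrow> c \<in> A)"

text \<open>Some basis diagonalises the Gram matrix to \<open>diag(-1, 1, \<dots>, 1)\<close>.\<close>

definition lorentz_signature :: "real^'m^'m \<Rightarrow> bool" where
  "lorentz_signature G \<longleftrightarrow> (\<exists>(P :: real^'m^'m) a. invertible P \<and>
     transpose P ** G ** P = (\<chi> i j. if i = j then (if i = a then -1 else 1) else 0))"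

definition lorentz_metric :: "('a, 'm::finite) spacetime_data \<Rightarrow> bool" where
  "lorentz_metric M \<longleftrightarrow>
     (\<forall>c\<in>atlas M. smooth_on (snd c ` fst c) (gmat M c \<circ> inv_into (fst c) (snd c)) \<and>
        (\<forall>p\<in>fst c. lorentz_signature (gmat M c p))) \<and>
     (\<forall>c\<in>atlas M. \<forall>c'\<in>atlas M. \<forall>p\<in>fst c \<inter> fst c'.
        let J = jacobian (transition c c') (snd c p)
        in gmat M c p = transpose J ** gmat M c' p ** J)"

definition gprod :: "('a, 'm::finite) spacetime_data \<Rightarrow> ('a, 'm) chart \<Rightarrow> 'a \<Rightarrow> real^'m \<Rightarrow> real^'m \<Rightarrow> real" where
  "gprod M c p v w = v \<bullet> (gmat M c p *v w)"

definition time_orientation :: "('a, 'm::finite) spacetime_data \<Rightarrow> bool" where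
  "time_orientation M \<longleftrightarrow>
     (\<forall>c\<in>atlas M. smooth_on (snd c ` fst c) (tvec M c \<circ> inv_into (fst c) (snd c)) \<and>
        (\<forall>p\<in>fst c. gprod M c p (tvec M c p) (tvec M c p) < 0)) \<and>
     (\<forall>c\<in>atlas M. \<forall>c'\<in>atlas M. \<forall>p\<in>fst c \<inter> fst c'.
        tvec M c' p = jacobian (transition c c') (snd c p) *v tvec M c p)"

text \<open>
  Good covers are only required to have contractible intersections; this includes the covers
  whose intersections are diffeomorphic to Euclidean space.
\<close>

definition finite_type :: "'a topology \<Rightarrow> bool" where
  "finite_type X \<longleftrightarrow> (\<exists>\<U>. finite \<U> \<and> (\<forall>U\<in>\<U>. openin X U) \<and> \<Union>\<U> = topspace X \<and>
     (\<forall>\<V>. \<V> \<subseteq> \<U> \<and> \<V> \<noteq> {} \<and> \<Inter>\<V> \<noteq> {} \<longrightarrow> contractible_space (subtopology X (\<Inter>\<V>))))"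

definition spacetime :: "('a, 'm::finite) spacetime_data \<Rightarrow> bool" where
  "spacetime M \<longleftrightarrow>
     Hausdorff_space (mtop M) \<and> second_countable (mtop M) \<and>
     connected_space (mtop M) \<and> finite_type (mtop M) \<and>
     maximal_oriented_atlas (mtop M) (atlas M) \<and> lorentz_metric M \<and> time_orientation M"

subsection \<open>Cauchy surfaces\<close>

definition timelike_curve :: "('a, 'm::finite) spacetime_data \<Rightarrow> real set \<Rightarrow> (real \<Rightarrow> 'a) \<Rightarrow> bool" where
  "timelike_curve M J \<gamma> \<longleftrightarrow>
     open J \<and> is_interval J \<and> J \<noteq> {} \<and> continuous_map (top_of_set J) (mtop M) \<gamma> \<and>
     (\<forall>c\<in>atlas M. smooth_on {t\<in>J. \<gamma> t \<in> fst c} (snd c \<circ> \<gamma>) \<and>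
        (\<forall>t\<in>J. \<gamma> t \<in> fst c \<longrightarrow>
           (let v = vector_derivative (snd c \<circ> \<gamma>) (at t) in gprod M c (\<gamma> t) v v < 0)))"

text \<open>The curve has no limit point at either end of the open interval \<open>J\<close>.\<close>

definition inextendible :: "'a topology \<Rightarrow> real set \<Rightarrow> (real \<Rightarrow> 'a) \<Rightarrow> bool" where
  "inextendible X J \<gamma> \<longleftrightarrow>
     (\<nexists>p. limitin X \<gamma> p (INF t\<in>J. principal {s\<in>J. t \<le> s})) \<and>
     (\<nexists>p. limitin X \<gamma> p (INF t\<in>J. principal {s\<in>J. s \<le> t}))"

definition cauchy_surface :: "('a, 'm::finite) spacetime_data \<Rightarrow> 'a set \<Rightarrow> bool" where
  "cauchy_surface M S \<longleftrightarrow> S \<subseteq> topspace (mtop M) \<and>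
     (\<forall>J \<gamma>. timelike_curve M J \<gamma> \<and> inextendible (mtop M) J \<gamma> \<longrightarrow> (\<exists>!t. t \<in> J \<and> \<gamma> t \<in> S))"

definition globally_hyperbolic :: "('a, 'm::finite) spacetime_data \<Rightarrow> bool" where
  "globally_hyperbolic M \<longleftrightarrow> (\<exists>S. cauchy_surface M S)"

definition slice_chart :: "('a, 'm::finite) spacetime_data \<Rightarrow> 'a set \<Rightarrow> ('a, 'm) chart \<Rightarrow> 'm \<Rightarrow> bool" where
  "slice_chart M S c a \<longleftrightarrow> c \<in> atlas M \<and>
     snd c ` (fst c \<inter> S) = snd c ` fst c \<inter> {x. x $ a = 0}"

definition spacelike_hypersurface :: "('a, 'm::finite) spacetime_data \<Rightarrow> 'a set \<Rightarrow> bool" where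
  "spacelike_hypersurface M S \<longleftrightarrow> S \<subseteq> topspace (mtop M) \<and>
     (\<forall>p\<in>S. \<exists>c a. slice_chart M S c a \<and> p \<in> fst c \<and>
        (\<forall>v. v $ a = 0 \<and> v \<noteq> 0 \<longrightarrow> gprod M c p v v > 0))"

definition compact_spacelike_cauchy_surface :: "('a, 'm::finite) spacetime_data \<Rightarrow> 'a set \<Rightarrow> bool" where
  "compact_spacelike_cauchy_surface M S \<longleftrightarrow>
     cauchy_surface M S \<and> spacelike_hypersurface M S \<and> compactin (mtop M) S"

section \<open>Singular cohomology\<close>

subsection \<open>The circle group\<close>

quotient_type circle = real / "\<lambda>x y. x - y \<in> \<int>"
proof (rule equivpI)
  show "reflp (\<lambda>x y::real. x - y \<in> \<int>)" by (simp add: reflp_def)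
  show "symp (\<lambda>x y::real. x - y \<in> \<int>)" 
  proof (rule sympI)
    fix x y :: real
    assume "x - y \<in> \<int>"
    then have "- (x - y) \<in> \<int>" by (rule Ints_minus)
    then show "y - x \<in> \<int>" by simp
  qed
  show "transp (\<lambda>x y::real. x - y \<in> \<int>)"
  proof (rule transpI)
    fix x y z :: real
    assume "x - y \<in> \<int>" "y - z \<in> \<int>"
    then have "(x - y) + (y - z) \<in> \<int>" by (rule Ints_add)
    then show "x - z \<in> \<int>" by simp
  qed
qed

instantiation circle :: ab_group_add
begin

lift_definition zero_circle :: circle is 0 .

lift_definition plus_circle :: "circle \<Rightarrow> circle \<Rightarrow> circle" is "(+)"
proof -
  fix x y z w :: real
  assume "x - y \<in> \<int>" "z - w \<in> \<int>"
  then have "(x - y) + (z - w) \<in> \<int>" by (rule Ints_add)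
  then show "x + z - (y + w) \<in> \<int>" by (simp add: algebra_simps)
qed

lift_definition uminus_circle :: "circle \<Rightarrow> circle" is uminus
proof -
  fix x y :: real
  assume "x - y \<in> \<int>"
  then have "- (x - y) \<in> \<int>" by (rule Ints_minus)
  then show "- x - - y \<in> \<int>" by simp
qed

lift_definition minus_circle :: "circle \<Rightarrow> circle \<Rightarrow> circle" is "(-)"
proof -
  fix x y z w :: real
  assume "x - y \<in> \<int>" "z - w \<in> \<int>"
  then have "(x - y) - (z - w) \<in> \<int>" by (rule Ints_diff)
  then show "x - z - (y - w) \<in> \<int>" by (simp add: algebra_simps)
qed

instance
proof
  fix a b c :: circle
  show "a + b + c = a + (b + c)" by transfer (simp add: algebra_simps)
  show "a + b = b + a" by transfer (simp add: algebra_simps)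
  show "0 + a = a" by transfer simp
  show "- a + a = 0" by transfer simp
  show "a - b = a + - b" by transfer simp
qed

end

lift_definition to_circle :: "real \<Rightarrow> circle" is "\<lambda>x. x" .

lift_definition circle_scale :: "int \<Rightarrow> circle \<Rightarrow> circle" is "\<lambda>n x. of_int n * x"
proof -
  fix n :: int and x y :: real
  assume "x - y \<in> \<int>"
  then have "of_int n * (x - y) \<in> \<int>" by (intro Ints_mult Ints_of_int)
  then show "of_int n * x - of_int n * y \<in> \<int>" by (simp add: right_diff_distrib)
qed

lift_definition circle_exp :: "circle \<Rightarrow> complex" is "\<lambda>x. cis (2 * pi * x)"
proof -
  fix x y :: real
  assume "x - y \<in> \<int>"
  then obtain n where "x - y = of_int n"
    by (rule Ints_cases)
  then have "x = y + of_int n"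
    by simp
  then have "cis (2 * pi * x) = cis (2 * pi * y) * cis (2 * pi * of_int n)"
    by (simp only: cis_mult distrib_left)
  then show "cis (2 * pi * x) = cis (2 * pi * y)"
    by simp
qed

subsection \<open>Cochains and cohomology groups\<close>

type_synonym 'a ssimplex = "(nat \<Rightarrow> real) \<Rightarrow> 'a"

text \<open>
  Cochains vanish outside the singular simplices of the given degree. As for the homology groups
  of the library, degrees are integers, and everything vanishes in negative degrees.
\<close>

definition cochains :: "int \<Rightarrow> 'a topology \<Rightarrow> ('a ssimplex \<Rightarrow> 'c::ab_group_add) set" where
  "cochains p X = {f. \<forall>s. f s \<noteq> 0 \<longrightarrow> 0 \<le> p \<and> singular_simplex (nat p) X s}"

text \<open>Sign convention: \<open>(\<delta> f)(s) = f (\<partial> s)\<close>.\<close>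

definition coboundary :: "int \<Rightarrow> 'a topology \<Rightarrow> ('a ssimplex \<Rightarrow> 'c::ab_group_add) \<Rightarrow> 'a ssimplex \<Rightarrow> 'c" where
  "coboundary p X f = (\<lambda>s. if 0 \<le> p \<and> singular_simplex (nat (p + 1)) X s
     then \<Sum>i\<le>nat (p + 1). if even i then f (singular_face (nat (p + 1)) i s)
                                    else - f (singular_face (nat (p + 1)) i s)
     else 0)"

definition cocycle_group :: "int \<Rightarrow> 'a topology \<Rightarrow> ('a ssimplex \<Rightarrow> 'c::ab_group_add) monoid" where
  "cocycle_group p X =
     \<lparr>carrier = {f \<in> cochains p X. coboundary p X f = (\<lambda>s. 0)},
      mult = (\<lambda>f g s. f s + g s), one = (\<lambda>s. 0)\<rparr>"

definition coboundaries :: "int \<Rightarrow> 'a topology \<Rightarrow> ('a ssimplex \<Rightarrow> 'c::ab_group_add) set" where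
  "coboundaries p X = coboundary (p - 1) X ` cochains (p - 1) X"

definition cohomology_group :: "int \<Rightarrow> 'a topology \<Rightarrow> ('a ssimplex \<Rightarrow> 'c::ab_group_add) set monoid" where
  "cohomology_group p X = cocycle_group p X Mod coboundaries p X"

text \<open>
  An operation on cohomology classes is the coset of the values of the cochain-level operation
  on all representatives. The next definition turns a nonempty set of cohomologous cocycles into
  the class it represents.
\<close>

definition cohom_class :: "int \<Rightarrow> 'a topology \<Rightarrow> ('a ssimplex \<Rightarrow> 'c::ab_group_add) set \<Rightarrow> ('a ssimplex \<Rightarrow> 'c) set" where
  "cohom_class p X F = coboundaries p X <#>\<^bsub>cocycle_group p X\<^esub> F"

definition cochain_pullback ::
  "int \<Rightarrow> 'b topology \<Rightarrow> ('b \<Rightarrow> 'a) \<Rightarrow> ('a ssimplex \<Rightarrow> 'c::ab_group_add) \<Rightarrow> 'b ssimplex \<Rightarrow> 'c" where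
  "cochain_pullback p Y h f =
     (\<lambda>s. if 0 \<le> p \<and> singular_simplex (nat p) Y s then f (simplex_map (nat p) h s) else 0)"

definition cohom_pullback ::
  "int \<Rightarrow> 'b topology \<Rightarrow> ('b \<Rightarrow> 'a) \<Rightarrow> ('a ssimplex \<Rightarrow> 'c::ab_group_add) set \<Rightarrow> ('b ssimplex \<Rightarrow> 'c) set" where
  "cohom_pullback p Y h u = cohom_class p Y (cochain_pullback p Y h ` u)"

definition front_face :: "nat \<Rightarrow> 'a ssimplex \<Rightarrow> 'a ssimplex" where
  "front_face p s = restrict s (standard_simplex p)"

definition back_face :: "nat \<Rightarrow> nat \<Rightarrow> 'a ssimplex \<Rightarrow> 'a ssimplex" where
  "back_face p q s = restrict (\<lambda>t. s (\<lambda>i. if i < p then 0 else t (i - p))) (standard_simplex q)"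

definition cochain_cup ::
  "int \<Rightarrow> int \<Rightarrow> 'a topology \<Rightarrow> ('a ssimplex \<Rightarrow> circle) \<Rightarrow> ('a ssimplex \<Rightarrow> int) \<Rightarrow> 'a ssimplex \<Rightarrow> circle" where
  "cochain_cup p q X f g =
     (\<lambda>s. if 0 \<le> p \<and> 0 \<le> q \<and> singular_simplex (nat (p + q)) X s
       then circle_scale (g (back_face (nat p) (nat q) s)) (f (front_face (nat p) s)) else 0)"

definition cohom_cup ::
  "int \<Rightarrow> int \<Rightarrow> 'a topology \<Rightarrow> ('a ssimplex \<Rightarrow> circle) set \<Rightarrow> ('a ssimplex \<Rightarrow> int) set \<Rightarrow> ('a ssimplex \<Rightarrow> circle) set" where
  "cohom_cup p q X u w = cohom_class (p + q) X {cochain_cup p q X f g | f g. f \<in> u \<and> g \<in> w}"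

text \<open>
  The map \<open>\<beta>\<close> from degree \<open>p - 1\<close> to degree \<open>p\<close>: lift a representative to a real cochain \<open>r\<close> and
  take \<open>- \<delta> r\<close>. The sign comes from \<open>char \<circ> \<kappa> = j \<circ> \<beta>\<close>: with \<open>\<delta> f = f \<circ> \<partial>\<close>, the characteristic
  class of a Cheeger-Simons character with real lift \<open>r\<close> is represented by its curvature minus
  \<open>\<delta> r\<close>, and flat classes have zero curvature. All integral cocycles obtained from all choices
  make up precisely one cohomology class.
\<close>

definition bockstein ::
  "int \<Rightarrow> 'a topology \<Rightarrow> ('a ssimplex \<Rightarrow> circle) set \<Rightarrow> ('a ssimplex \<Rightarrow> int) set" where
  "bockstein p X u =
     {b \<in> carrier (cocycle_group p X).
        \<exists>r \<in> cochains (p - 1) X. to_circle \<circ> r \<in> u \<and>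
          (\<forall>s. real_of_int (b s) = - coboundary (p - 1) X r s)}"

text \<open>Evaluation of a cohomology class on a homology class of the same degree.\<close>

definition kronecker ::
  "int \<Rightarrow> 'a topology \<Rightarrow> ('a ssimplex \<Rightarrow> circle) set \<Rightarrow> 'a chain set \<Rightarrow> circle" where
  "kronecker p X u \<xi> = (THE r. u \<in> carrier (cohomology_group p X) \<and> \<xi> \<in> carrier (homology_group p X) \<and>
     (\<exists>f\<in>u. \<exists>z\<in>\<xi>. r = (\<Sum>s\<in>Poly_Mapping.keys z. circle_scale (Poly_Mapping.lookup z s) (f s))))"

definition torsion_cohomology :: "int \<Rightarrow> 'a topology \<Rightarrow> ('a ssimplex \<Rightarrow> int) set monoid" where
  "torsion_cohomology p X = (cohomology_group p X)
     \<lparr>carrier := {u \<in> carrier (cohomology_group p X).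
        \<exists>n::nat. n > 0 \<and> u [^]\<^bsub>cohomology_group p X\<^esub> n = \<one>\<^bsub>cohomology_group p X\<^esub>}\<rparr>"

subsection \<open>The fundamental class of a spacelike hypersurface\<close>

text \<open>
  The frame whose first vector is \<open>N\<close>, followed by \<open>w 1 - w 0, w 2 - w 0, \<dots>\<close>; coordinates are
  enumerated in increasing order.
\<close>

definition frame_det :: "real^'m::{finite,linorder} \<Rightarrow> (nat \<Rightarrow> real^'m::{finite,linorder}) \<Rightarrow> real" where
  "frame_det N w = det (\<chi> i (j::'m).
     (if card {l. l < j} = 0 then N else w (card {l. l < j}) - w 0) $ i)"

text \<open>
  \<open>s\<close> is a nondegenerate affine simplex of \<open>S\<close>, with respect to some slice chart, that has the
  point \<open>x\<close> in its interior; \<open>e = 1\<close> or \<open>e = -1\<close> according to whether it is positively or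
  negatively oriented. The tangent frame of \<open>S\<close> is positive iff it becomes a positive frame of
  the spacetime when preceded by a future-directed timelike vector.
\<close>

definition local_simplex ::
  "('a, 'm::{finite,linorder}) spacetime_data \<Rightarrow> 'a set \<Rightarrow> 'a \<Rightarrow> 'a ssimplex \<Rightarrow> int \<Rightarrow> bool" where
  "local_simplex M S x s e \<longleftrightarrow>
     (\<exists>c a w. slice_chart M S c a \<and> (\<forall>i<CARD('m). w i $ a = 0) \<and>
        convex hull (w ` {..<CARD('m)}) \<subseteq> snd c ` fst c \<and>
        s = restrict (\<lambda>t. inv_into (fst c) (snd c) (\<Sum>i<CARD('m). t i *\<^sub>R w i))
              (standard_simplex (CARD('m) - 1)) \<and>
        (\<exists>t\<in>standard_simplex (CARD('m) - 1). (\<forall>i<CARD('m). t i > 0) \<and> s t = x) \<and>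
        frame_det (tvec M c x) w \<noteq> 0 \<and>
        e = (if frame_det (tvec M c x) w > 0 then 1 else -1))"

definition is_fundamental_class ::
  "('a, 'm::{finite,linorder}) spacetime_data \<Rightarrow> 'a set \<Rightarrow> 'a chain set \<Rightarrow> bool" where
  "is_fundamental_class M S \<xi> \<longleftrightarrow>
     \<xi> \<in> carrier (homology_group (int CARD('m) - 1) (subtopology (mtop M) S)) \<and>
     (\<forall>z\<in>\<xi>. \<forall>x\<in>S. \<forall>s e. local_simplex M S x s e \<longrightarrow>
        homologous_rel (CARD('m) - 1) (subtopology (mtop M) S) (S - {x}) z (frag_cmul e (frag_of s)))"

definition fundamental_class ::
  "('a, 'm::{finite,linorder}) spacetime_data \<Rightarrow> 'a set \<Rightarrow> 'a chain set" where
  "fundamental_class M S = (SOME \<xi>. is_fundamental_class M S \<xi>)"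

subsection \<open>The symplectic groups of torsion classes\<close>

text \<open>
  The linking pairing of classes on the spacetime of degrees \<open>p\<close> and \<open>m - p\<close>. The inclusion \<open>j\<close>
  of the torsion subgroup is the identity on the underlying sets.
\<close>

definition linking ::
  "('a, 'm::{finite,linorder}) spacetime_data \<Rightarrow> 'a set \<Rightarrow> int \<Rightarrow>
     ('a ssimplex \<Rightarrow> int) set \<Rightarrow> ('a ssimplex \<Rightarrow> int) set \<Rightarrow> circle" where
  "linking M S p u u' =
     (let m = int CARD('m); Y = subtopology (mtop M) S in
      THE r. \<exists>v \<in> carrier (cohomology_group (p - 1) Y).
        bockstein p Y v = cohom_pullback p Y id u \<and>
        r = kronecker (m - 1) Y (cohom_cup (p - 1) (m - p) Y v (cohom_pullback (m - p) Y id u'))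
              (fundamental_class M S))"

type_synonym 'a top_class = "('a ssimplex \<Rightarrow> int) set \<times> ('a ssimplex \<Rightarrow> int) set"

definition Top_tor :: "('a, 'm::{finite,linorder}) spacetime_data \<Rightarrow> nat \<Rightarrow> 'a top_class monoid" where
  "Top_tor M k = torsion_cohomology (int k) (mtop M) \<times>\<times>
     torsion_cohomology (int CARD('m) - int k) (mtop M)"

definition sigma_tor ::
  "('a, 'm::{finite,linorder}) spacetime_data \<Rightarrow> 'a set \<Rightarrow> nat \<Rightarrow> 'a top_class \<Rightarrow> 'a top_class \<Rightarrow> circle" where
  "sigma_tor M S k = (\<lambda>(t, t1) (t', t1').
     linking M S (int CARD('m) - int k) t1 t' - linking M S (int CARD('m) - int k) t1' t)"

definition zeta_tor ::
  "('a, 'm::{finite,linorder}) spacetime_data \<Rightarrow> nat \<Rightarrow> 'a top_class \<Rightarrow> 'a top_class" where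
  "zeta_tor M k = (\<lambda>(t, t1).
     (t1, t [^]\<^bsub>torsion_cohomology (int k) (mtop M)\<^esub> ((-1) ^ (k * (CARD('m) - k) + 1) :: int)))"

section \<open>Weyl algebras\<close>

record 'b star_algebra = "(complex, 'b) module" +
  star :: "'b \<Rightarrow> 'b"
  nrm :: "'b \<Rightarrow> real"

subsection \<open>Enveloping C*-algebras\<close>

text \<open>
  C*-seminorms are the seminorms \<open>x \<mapsto> \<parallel>\<pi> x\<parallel>\<close> of *-representations \<open>\<pi>\<close> on Hilbert spaces. On a
  Banach *-algebra the bound by the given norm is automatic.
\<close>

definition cstar_seminorm :: "'b star_algebra \<Rightarrow> ('b \<Rightarrow> real) \<Rightarrow> bool" where
  "cstar_seminorm A \<rho> \<longleftrightarrow>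
     (\<forall>x\<in>carrier A. 0 \<le> \<rho> x \<and> \<rho> x \<le> nrm A x \<and> \<rho> (star A x \<otimes>\<^bsub>A\<^esub> x) = (\<rho> x)\<^sup>2 \<and>
        (\<forall>c. \<rho> (c \<odot>\<^bsub>A\<^esub> x) = cmod c * \<rho> x) \<and>
        (\<forall>y\<in>carrier A. \<rho> (x \<oplus>\<^bsub>A\<^esub> y) \<le> \<rho> x + \<rho> y \<and> \<rho> (x \<otimes>\<^bsub>A\<^esub> y) \<le> \<rho> x * \<rho> y))"

definition max_seminorm :: "'b star_algebra \<Rightarrow> 'b \<Rightarrow> real" where
  "max_seminorm A x = (SUP \<rho>\<in>Collect (cstar_seminorm A). \<rho> x)"

definition max_dist :: "'b star_algebra \<Rightarrow> 'b \<Rightarrow> 'b \<Rightarrow> real" where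
  "max_dist A x y = max_seminorm A (x \<ominus>\<^bsub>A\<^esub> y)"

definition cauchy_seqs :: "'b star_algebra \<Rightarrow> (nat \<Rightarrow> 'b) set" where
  "cauchy_seqs A = {a. range a \<subseteq> carrier A \<and>
     (\<forall>\<epsilon>>0. \<exists>N. \<forall>i\<ge>N. \<forall>j\<ge>N. max_dist A (a i) (a j) < \<epsilon>)}"

definition seq_class :: "'b star_algebra \<Rightarrow> (nat \<Rightarrow> 'b) \<Rightarrow> (nat \<Rightarrow> 'b) set" where
  "seq_class A a = {b \<in> cauchy_seqs A. (\<lambda>i. max_dist A (b i) (a i)) \<longlonglongrightarrow> 0}"

text \<open>
  The Hausdorff completion with respect to the largest C*-seminorm: Cauchy sequences modulo null
  sequences. As for cosets, operations are unions over all representatives.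
\<close>

definition enveloping :: "'b star_algebra \<Rightarrow> (nat \<Rightarrow> 'b) set star_algebra" where
  "enveloping A =
     \<lparr>carrier = seq_class A ` cauchy_seqs A,
      mult = (\<lambda>x y. \<Union>a\<in>x. \<Union>b\<in>y. seq_class A (\<lambda>i. a i \<otimes>\<^bsub>A\<^esub> b i)),
      one = seq_class A (\<lambda>i. \<one>\<^bsub>A\<^esub>),
      zero = seq_class A (\<lambda>i. \<zero>\<^bsub>A\<^esub>),
      add = (\<lambda>x y. \<Union>a\<in>x. \<Union>b\<in>y. seq_class A (\<lambda>i. a i \<oplus>\<^bsub>A\<^esub> b i)),
      smult = (\<lambda>c x. \<Union>a\<in>x. seq_class A (\<lambda>i. c \<odot>\<^bsub>A\<^esub> a i)),
      star = (\<lambda>x. \<Union>a\<in>x. seq_class A (\<lambda>i. star A (a i))),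
      nrm = (\<lambda>x. THE r. \<exists>a\<in>x. (\<lambda>i. max_seminorm A (a i)) \<longlonglongrightarrow> r)\<rparr>"

definition enveloping_map :: "'b star_algebra \<Rightarrow> 'b \<Rightarrow> (nat \<Rightarrow> 'b) set" where
  "enveloping_map A x = seq_class A (\<lambda>i. x)"

subsection \<open>The Weyl algebra of an abelian group (written multiplicatively)\<close>

definition delta_fun :: "'g \<Rightarrow> 'g \<Rightarrow> complex" where
  "delta_fun g = (\<lambda>x. if x = g then 1 else 0)"

text \<open>
  The completion of the span of the symbols in the 1-norm consists of the absolutely summable
  functions on the group, the symbol \<open>W(g)\<close> being \<open>delta_fun g\<close>; the product is determined by
  \<open>W(g) W(h) = circle_exp (\<sigma> g h) W(g h)\<close>.
\<close>

definition weyl_l1 :: "'g monoid \<Rightarrow> ('g \<Rightarrow> 'g \<Rightarrow> circle) \<Rightarrow> ('g \<Rightarrow> complex) star_algebra" where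
  "weyl_l1 G \<sigma> =
     \<lparr>carrier = {f. (\<forall>g. g \<notin> carrier G \<longrightarrow> f g = 0) \<and> (\<lambda>g. cmod (f g)) summable_on carrier G},
      mult = (\<lambda>f h x. if x \<in> carrier G
        then \<Sum>\<^sub>\<infinity>g\<in>carrier G. circle_exp (\<sigma> g (inv\<^bsub>G\<^esub> g \<otimes>\<^bsub>G\<^esub> x)) * f g * h (inv\<^bsub>G\<^esub> g \<otimes>\<^bsub>G\<^esub> x)
        else 0),
      one = delta_fun \<one>\<^bsub>G\<^esub>,
      zero = (\<lambda>x. 0),
      add = (\<lambda>f h x. f x + h x),
      smult = (\<lambda>c f x. c * f x),
      star = (\<lambda>f x. if x \<in> carrier G then cnj (f (inv\<^bsub>G\<^esub> x)) else 0),
      nrm = (\<lambda>f. \<Sum>\<^sub>\<infinity>g\<in>carrier G. cmod (f g))\<rparr>"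

type_synonym 'g weyl_elt = "(nat \<Rightarrow> 'g \<Rightarrow> complex) set"

definition weyl :: "'g monoid \<Rightarrow> ('g \<Rightarrow> 'g \<Rightarrow> circle) \<Rightarrow> 'g weyl_elt star_algebra" where
  "weyl G \<sigma> = enveloping (weyl_l1 G \<sigma>)"

definition weyl_gen :: "'g monoid \<Rightarrow> ('g \<Rightarrow> 'g \<Rightarrow> circle) \<Rightarrow> 'g \<Rightarrow> 'g weyl_elt" where
  "weyl_gen G \<sigma> g = enveloping_map (weyl_l1 G \<sigma>) (delta_fun g)"

subsection \<open>States and isomorphisms\<close>

definition linear_functional :: "'b star_algebra \<Rightarrow> ('b \<Rightarrow> complex) \<Rightarrow> bool" where
  "linear_functional A \<omega> \<longleftrightarrow>
     (\<forall>x\<in>carrier A. (\<forall>y\<in>carrier A. \<omega> (x \<oplus>\<^bsub>A\<^esub> y) = \<omega> x + \<omega> y) \<and> (\<forall>c. \<omega> (c \<odot>\<^bsub>A\<^esub> x) = c * \<omega> x))"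

definition continuous_functional :: "'b star_algebra \<Rightarrow> ('b \<Rightarrow> complex) \<Rightarrow> bool" where
  "continuous_functional A \<omega> \<longleftrightarrow> (\<exists>K. \<forall>x\<in>carrier A. cmod (\<omega> x) \<le> K * nrm A x)"

definition state :: "'b star_algebra \<Rightarrow> ('b \<Rightarrow> complex) \<Rightarrow> bool" where
  "state A \<omega> \<longleftrightarrow> linear_functional A \<omega> \<and> \<omega> \<one>\<^bsub>A\<^esub> = 1 \<and>
     (\<forall>x\<in>carrier A. \<omega> (star A x \<otimes>\<^bsub>A\<^esub> x) \<in> \<real>\<^sub>\<ge>\<^sub>0)"

definition faithful_state :: "'b star_algebra \<Rightarrow> ('b \<Rightarrow> complex) \<Rightarrow> bool" where
  "faithful_state A \<omega> \<longleftrightarrow> state A \<omega> \<and>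
     (\<forall>x\<in>carrier A. \<omega> (star A x \<otimes>\<^bsub>A\<^esub> x) = 0 \<longrightarrow> x = \<zero>\<^bsub>A\<^esub>)"

definition cstar_iso :: "'b star_algebra \<Rightarrow> 'd star_algebra \<Rightarrow> ('b \<Rightarrow> 'd) \<Rightarrow> bool" where
  "cstar_iso A B \<Phi> \<longleftrightarrow> bij_betw \<Phi> (carrier A) (carrier B) \<and> \<Phi> \<one>\<^bsub>A\<^esub> = \<one>\<^bsub>B\<^esub> \<and>
     (\<forall>x\<in>carrier A. \<Phi> (star A x) = star B (\<Phi> x) \<and> nrm B (\<Phi> x) = nrm A x \<and>
        (\<forall>c. \<Phi> (c \<odot>\<^bsub>A\<^esub> x) = c \<odot>\<^bsub>B\<^esub> \<Phi> x) \<and>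
        (\<forall>y\<in>carrier A. \<Phi> (x \<oplus>\<^bsub>A\<^esub> y) = \<Phi> x \<oplus>\<^bsub>B\<^esub> \<Phi> y \<and> \<Phi> (x \<otimes>\<^bsub>A\<^esub> y) = \<Phi> x \<otimes>\<^bsub>B\<^esub> \<Phi> y))"

subsection \<open>The state and the duality isomorphism\<close>

text \<open>Maps on a carrier are made unique as HOL functions by requiring them to be extensional.\<close>

definition is_omega ::
  "('a, 'm::{finite,linorder}) spacetime_data \<Rightarrow> 'a set \<Rightarrow> nat \<Rightarrow> ('a top_class weyl_elt \<Rightarrow> complex) \<Rightarrow> bool" where
  "is_omega M S k \<omega> \<longleftrightarrow>
     (let G = Top_tor M k; \<sigma> = sigma_tor M S k; A = weyl G \<sigma> in
      \<omega> \<in> extensional (carrier A) \<and> linear_functional A \<omega> \<and> continuous_functional A \<omega> \<and>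
      (\<forall>g\<in>carrier G. \<omega> (weyl_gen G \<sigma> g) = (if g = \<one>\<^bsub>G\<^esub> then 1 else 0)))"

definition omega_tor ::
  "('a, 'm::{finite,linorder}) spacetime_data \<Rightarrow> 'a set \<Rightarrow> nat \<Rightarrow> 'a top_class weyl_elt \<Rightarrow> complex" where
  "omega_tor M S k = (THE \<omega>. is_omega M S k \<omega>)"

definition is_weyl_zeta ::
  "('a, 'm::{finite,linorder}) spacetime_data \<Rightarrow> 'a set \<Rightarrow> nat \<Rightarrow>
     ('a top_class weyl_elt \<Rightarrow> 'a top_class weyl_elt) \<Rightarrow> bool" where
  "is_weyl_zeta M S k \<Phi> \<longleftrightarrow>
     (let G = Top_tor M k; \<sigma> = sigma_tor M S k;
          G' = Top_tor M (CARD('m) - k); \<sigma>' = sigma_tor M S (CARD('m) - k) in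
      \<Phi> \<in> extensional (carrier (weyl G \<sigma>)) \<and> cstar_iso (weyl G \<sigma>) (weyl G' \<sigma>') \<Phi> \<and>
      (\<forall>g\<in>carrier G. \<Phi> (weyl_gen G \<sigma> g) = weyl_gen G' \<sigma>' (zeta_tor M k g)))"

definition weyl_zeta ::
  "('a, 'm::{finite,linorder}) spacetime_data \<Rightarrow> 'a set \<Rightarrow> nat \<Rightarrow>
     'a top_class weyl_elt \<Rightarrow> 'a top_class weyl_elt" where
  "weyl_zeta M S k = (THE \<Phi>. is_weyl_zeta M S k \<Phi>)"

end

theory Submission
  imports Defs
begin

text \<open>
  On torsion classes the linking pairing is computed by real cochains: over \<open>\<real>\<close> an integral
  representative \<open>b\<close> of a torsion class is \<open>- \<delta> r\<close>, and the pairing is the class modulo \<open>\<int>\<close> of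
  \<open>r \<union> b'\<close> evaluated on a fundamental cycle. The Leibniz rule gives independence of choices and
  biadditivity, and together with Steenrod's \<open>\<union>\<^sub>1\<close>-product the graded symmetry, which says exactly that
  \<open>\<zeta>\<^sub>t\<^sub>o\<^sub>r\<close> preserves \<open>\<sigma>\<^sub>t\<^sub>o\<^sub>r\<close>. If no class satisfies the definition of the fundamental class, the
  pairing is a constant and \<open>\<sigma>\<^sub>t\<^sub>o\<^sub>r = 0\<close>.

  For the twisted group algebra of any abelian group, evaluation at the unit is a trace that is
  faithful on the completion in the norm of the left regular representation. That norm is the largest
  \<open>C\<^sup>*\<close>-seminorm because finite subsets of abelian groups have polynomial growth. Functionals and
  isomorphisms are determined by their values on the generators, and the canonical traces correspond
  under any isomorphism of groups that preserves the bicharacters.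
\<close>

section \<open>Faces of singular simplices\<close>

text \<open>Graded symmetry cannot be quoted from real cohomology: a real cochain \<open>r\<close>
  with \<open>b = - \<delta> r\<close> is a cocycle only modulo the integers, so products are
  interchanged on cochains. The defect is a \<open>cup_1\<close> product of two integral cochains,
  which the circle does not see. Faithfulness does not pass by itself from a dense subalgebra to a
  completion: a Cauchy sequence might tend to zero in the 2-norm of the trace but not in the
  C*-norm. Right multiplication by a fixed element is bounded in the 2-norm, so the limit of such a
  sequence acts as zero in the left regular representation; that the norm of this representation is
  the largest C*-seminorm then makes the limit zero. The same equality of norms makes the
  functionals \<open>\<tau> (h \<otimes> -)\<close> separate points. Two isomorphisms with the same
  values on generators are compared through these functionals, and a continuous functional is
  determined by its values on generators through two density steps: summable functions in the
  completion, finitely supported functions among the summable ones.\<close>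

definition skip :: "nat \<Rightarrow> nat \<Rightarrow> nat" where
  "skip k j = (if j < k then j else Suc j)"

text \<open>Signs are iterated negation in an abelian group, because one of the coefficient groups
  is the circle, which carries no ring structure.\<close>

definition alt :: "nat \<Rightarrow> 'c::ab_group_add \<Rightarrow> 'c" where
  "alt k x = (if even k then x else - x)"

lemma alt_Suc: "alt (Suc k) x = - alt k x"
  by (simp add: alt_def)

lemma alt_add: "alt k (x + y) = alt k x + alt k y"
  by (simp add: alt_def)

lemma alt_plus_exponent: "alt (k + l) x = alt k (alt l x)"
  by (simp add: alt_def)

lemma alt_sum: "alt k (sum f A) = (\<Sum>a\<in>A. alt k (f a))"
  by (simp add: alt_def sum_negf)

lemma alt_eq_mult: "alt k x = (- 1) ^ k * (x :: 'c::comm_ring_1)"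
  by (simp add: alt_def)

text \<open>The pullback of \<open>s\<close> along the affine map that sends vertex \<open>j\<close>
  to vertex \<open>\<alpha> j\<close>. Boundary faces, front faces and back faces all have this
  form, so identities between iterated faces become identities between vertex maps.\<close>

definition vface :: "nat \<Rightarrow> (nat \<Rightarrow> nat) \<Rightarrow> 'a ssimplex \<Rightarrow> 'a ssimplex" where
  "vface p \<alpha> s = simplex_map p s (oriented_simplex p (\<lambda>j i. if i = \<alpha> j then 1 else 0))"

lemma vface_cong: "(\<And>j. j \<le> p \<Longrightarrow> \<alpha> j = \<beta> j) \<Longrightarrow> vface p \<alpha> s = vface p \<beta> s"
proof -
  assume a: "\<And>j. j \<le> p \<Longrightarrow> \<alpha> j = \<beta> j"
  have "oriented_simplex p (\<lambda>j i. if i = \<alpha> j then 1 else 0) = oriented_simplex p (\<lambda>j i. if i = \<beta> j then 1 else 0)"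
    unfolding oriented_simplex_eq using a by auto
  then show ?thesis unfolding vface_def by simp
qed

lemma vertex_sum_in_standard_simplex:
  assumes x: "x \<in> standard_simplex p" and \<alpha>: "\<And>j. j \<le> p \<Longrightarrow> \<alpha> j \<le> n"
  shows "(\<lambda>i. \<Sum>j\<le>p. (if i = \<alpha> j then 1 else 0) * x j) \<in> standard_simplex n"
proof -
  have x0: "0 \<le> x j" "x j \<le> 1" and s1: "(\<Sum>j\<le>p. x j) = 1" for j
    using x by (auto simp: standard_simplex_def)
  have tot: "(\<Sum>i\<le>n. \<Sum>j\<le>p. (if i = \<alpha> j then 1 else 0) * x j) = 1"
  proof -
    have "(\<Sum>i\<le>n. \<Sum>j\<le>p. (if i = \<alpha> j then 1 else 0) * x j)
        = (\<Sum>j\<le>p. \<Sum>i\<le>n. (if i = \<alpha> j then 1 else 0) * x j)"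
      by (rule sum.swap)
    also have "\<dots> = (\<Sum>j\<le>p. x j)"
    proof (rule sum.cong[OF refl])
      fix j assume "j \<in> {..p}"
      then have "\<alpha> j \<in> {..n}" using \<alpha> by simp
      have "(\<Sum>i\<le>n. (if i = \<alpha> j then 1 else 0) * x j) = (\<Sum>i\<le>n. if i = \<alpha> j then x j else 0)"
        by (rule sum.cong) auto
      also have "\<dots> = x j" using \<open>\<alpha> j \<in> {..n}\<close> by (simp add: sum.delta')
      finally show "(\<Sum>i\<le>n. (if i = \<alpha> j then 1 else 0) * x j) = x j" .
    qed
    finally show ?thesis using s1 by simp
  qed
  have le1: "(\<Sum>j\<le>p. (if i = \<alpha> j then 1 else 0) * x j) \<le> 1" for i
  proof -
    have "(\<Sum>j\<le>p. (if i = \<alpha> j then 1 else 0) * x j) \<le> (\<Sum>j\<le>p. x j)"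
      by (rule sum_mono) (use x0 in auto)
    then show ?thesis using s1 by simp
  qed
  have ge0: "0 \<le> (\<Sum>j\<le>p. (if i = \<alpha> j then 1 else 0) * x j)" for i
    by (rule sum_nonneg) (use x0 in auto)
  have z: "(\<Sum>j\<le>p. (if i = \<alpha> j then 1 else 0) * x j) = 0" if "i > n" for i
    by (rule sum.neutral) (use \<alpha> that in force)
  show ?thesis unfolding standard_simplex_def using tot le1 ge0 z by blast
qed

lemma singular_simplex_vface:
  assumes "singular_simplex n X s" and \<alpha>: "\<And>j. j \<le> p \<Longrightarrow> \<alpha> j \<le> n"
  shows "singular_simplex p X (vface p \<alpha> s)"
proof -
  have "simplicial_simplex p (standard_simplex n) (oriented_simplex p (\<lambda>j i. if i = \<alpha> j then 1 else 0))"
    unfolding simplicial_simplex_oriented_simplex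
  proof (clarify)
    fix x assume "x \<in> standard_simplex p"
    then show "(\<lambda>i. \<Sum>j\<le>p. (if i = \<alpha> j then 1 else 0) * x j) \<in> standard_simplex n"
      by (rule vertex_sum_in_standard_simplex) (rule \<alpha>)
  qed
  then have "singular_simplex p (subtopology (powertop_real UNIV) (standard_simplex n))
     (oriented_simplex p (\<lambda>j i. if i = \<alpha> j then 1 else 0))"
    by (rule simplicial_imp_singular_simplex)
  then show ?thesis unfolding vface_def
    using assms(1) by (intro singular_simplex_simplex_map) (auto simp: singular_simplex_def)
qed

text \<open>Contravariant functoriality. Both sides are \<open>s\<close> at a barycentric
  combination of vertices, and the double sum of coefficients collapses at
  \<open>l = \<alpha> j\<close>.\<close>

lemma vface_vface:
  assumes \<alpha>: "\<And>j. j \<le> p \<Longrightarrow> \<alpha> j \<le> n"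
  shows "vface p \<alpha> (vface n \<beta> s) = vface p (\<beta> \<circ> \<alpha>) s"
proof
  fix x
  show "vface p \<alpha> (vface n \<beta> s) x = vface p (\<beta> \<circ> \<alpha>) s x"
  proof (cases "x \<in> standard_simplex p")
    case True
    have inn: "(\<lambda>i. \<Sum>j\<le>p. (if i = \<alpha> j then 1 else 0) * x j) \<in> standard_simplex n"
      using vertex_sum_in_standard_simplex[OF True \<alpha>] .
    have "(\<Sum>l\<le>n. (if i = \<beta> l then 1 else 0) * (\<Sum>j\<le>p. (if l = \<alpha> j then 1 else 0) * x j))
       = (\<Sum>j\<le>p. (if i = \<beta> (\<alpha> j) then 1 else 0) * x j)" for i
    proof -
      have "(\<Sum>l\<le>n. (if i = \<beta> l then 1 else 0) * (\<Sum>j\<le>p. (if l = \<alpha> j then 1 else 0) * x j))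
        = (\<Sum>l\<le>n. \<Sum>j\<le>p. (if i = \<beta> l then 1 else 0) * ((if l = \<alpha> j then 1 else 0) * x j))"
        by (simp only: sum_distrib_left)
      also have "\<dots> = (\<Sum>j\<le>p. \<Sum>l\<le>n. (if i = \<beta> l then 1 else 0) * ((if l = \<alpha> j then 1 else 0) * x j))"
        by (rule sum.swap)
      also have "\<dots> = (\<Sum>j\<le>p. (if i = \<beta> (\<alpha> j) then 1 else 0) * x j)"
      proof (rule sum.cong[OF refl])
        fix j assume "j \<in> {..p}"
        then have "\<alpha> j \<in> {..n}" using \<alpha> by simp
        have "(\<Sum>l\<le>n. (if i = \<beta> l then 1 else 0) * ((if l = \<alpha> j then 1 else 0) * x j))
          = (\<Sum>l\<le>n. if l = \<alpha> j then (if i = \<beta> (\<alpha> j) then 1 else 0) * x j else 0)"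
          by (rule sum.cong) auto
        also have "\<dots> = (if i = \<beta> (\<alpha> j) then 1 else 0) * x j"
          using \<open>\<alpha> j \<in> {..n}\<close> by (simp add: sum.delta')
        finally show "(\<Sum>l\<le>n. (if i = \<beta> l then 1 else 0) * ((if l = \<alpha> j then 1 else 0) * x j))
           = (if i = \<beta> (\<alpha> j) then 1 else 0) * x j" .
      qed
      finally show ?thesis .
    qed
    then show ?thesis
      using True inn by (simp add: vface_def simplex_map_def oriented_simplex_def)
  qed (simp add: vface_def simplex_map_def)
qed

lemma front_face_eq_vface: "front_face p s = vface p (\<lambda>j. j) s"
proof
  fix x
  have "(\<Sum>j\<le>p. (if i = j then 1 else 0) * x j) = x i" if "x \<in> standard_simplex p" for i
  proof -
    have "(\<Sum>j\<le>p. (if i = j then 1 else 0) * x j) = (\<Sum>j\<le>p. if j = i then x j else 0)"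
      by (rule sum.cong) auto
    also have "\<dots> = (if i \<le> p then x i else 0)" by (simp add: sum.delta')
    also have "\<dots> = x i" using that by (auto simp: standard_simplex_def)
    finally show ?thesis .
  qed
  then show "front_face p s x = vface p (\<lambda>j. j) s x"
    by (auto simp: front_face_def vface_def simplex_map_def oriented_simplex_def)
qed

lemma back_face_eq_vface: "back_face p q s = vface q (\<lambda>j. j + p) s"
proof
  fix x
  have "(\<Sum>j\<le>q. (if i = j + p then 1 else 0) * x j) = (if i < p then 0 else x (i - p))"
    if "x \<in> standard_simplex q" for i
  proof -
    \<comment> \<open>For \<open>i < p\<close> the truncated difference \<open>i - p\<close> is 0, a
      legitimate index, so the inner conditional has to suppress that term.\<close>
    have "(\<Sum>j\<le>q. (if i = j + p then 1 else 0) * x j) = (\<Sum>j\<le>q. if j = i - p then (if i < p then 0 else x j) else 0)"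
      by (rule sum.cong) auto
    also have "\<dots> = (if i - p \<le> q then (if i < p then 0 else x (i - p)) else 0)" by (simp add: sum.delta')
    also have "\<dots> = (if i < p then 0 else x (i - p))" using that by (auto simp: standard_simplex_def)
    finally show ?thesis .
  qed
  then show "back_face p q s x = vface q (\<lambda>j. j + p) s x"
    by (auto simp: back_face_def vface_def simplex_map_def oriented_simplex_def)
qed

lemma singular_face_eq_vface:
  assumes "k \<le> Suc n"
  shows "singular_face (Suc n) k s = vface n (skip k) s"
proof
  fix x
  have "(\<Sum>j\<le>n. (if i = skip k j then 1 else 0) * x j) = simplical_face k x i"
    if "x \<in> standard_simplex n" for i
  proof -
    \<comment> \<open>The preimage of \<open>i\<close> under \<open>skip k\<close> is
      \<open>i\<close> below \<open>k\<close> and \<open>i - 1\<close> above it. The vertex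
      \<open>i = k\<close> has no preimage, and the index computed for it is masked by 0.\<close>
    have "(\<Sum>j\<le>n. (if i = skip k j then 1 else 0) * x j) =
       (\<Sum>j\<le>n. if j = (if i < k then i else i - 1) then (if i = k then 0 else x j) else 0)"
      by (rule sum.cong) (auto simp: skip_def split: if_splits)
    also have "\<dots> = (if (if i < k then i else i - 1) \<le> n then (if i = k then 0 else x (if i < k then i else i - 1)) else 0)"
      by (simp add: sum.delta')
    also have "\<dots> = simplical_face k x i"
      using that assms by (auto simp: standard_simplex_def simplical_face_def)
    finally show ?thesis .
  qed
  then show "singular_face (Suc n) k s x = vface n (skip k) s x"
    by (auto simp: singular_face_def vface_def simplex_map_def oriented_simplex_def)
qed

section \<open>The Leibniz rule on vertex maps\<close>

lemma sum_atMost_split: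
  fixes f :: "nat \<Rightarrow> 'c::ab_group_add"
  shows "(\<Sum>k\<le>p + q + 1. f k) = (\<Sum>k\<le>p. f k) + (\<Sum>k=p+1..p+q+1. f k)"
proof -
  have "{..p+q+1} = {..p} \<union> {p+1..p+q+1}" by auto
  then show ?thesis by (simp add: sum.union_disjoint del: sum.cl_ivl_Suc)
qed

text \<open>A face with \<open>k \<le> p\<close> removes a vertex seen by \<open>F\<close>, a later
  one a vertex seen by \<open>G\<close>. The right-hand side has two more terms, the last face of
  the front part and the zeroth face of the back part; they are the same product with the opposite
  signs of \<open>p + 1\<close> and \<open>p\<close>, and cancel.\<close>

lemma leibniz_faces:
  fixes m :: "'x::ab_group_add \<Rightarrow> 'y::ab_group_add \<Rightarrow> 'z::ab_group_add"
  assumes ml: "\<And>a b c. m (a + b) c = m a c + m b c" and mr: "\<And>a b c. m a (b + c) = m a b + m a c"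
    and F: "\<And>\<alpha> \<beta>. (\<And>j. j \<le> p \<Longrightarrow> \<alpha> j = \<beta> j) \<Longrightarrow> F \<alpha> = F \<beta>"
    and G: "\<And>\<alpha> \<beta>. (\<And>j. j \<le> q \<Longrightarrow> \<alpha> j = \<beta> j) \<Longrightarrow> G \<alpha> = G \<beta>"
  shows "(\<Sum>k\<le>p + q + 1. alt k (m (F (skip k)) (G (\<lambda>j. skip k (j + p))))) =
    m (\<Sum>k\<le>p + 1. alt k (F (skip k))) (G (\<lambda>j. j + p + 1)) +
    alt p (m (F (\<lambda>j. j)) (\<Sum>k\<le>q + 1. alt k (G (\<lambda>j. skip k j + p))))"
proof -
  have m0l: "m 0 c = 0" for c using ml[of 0 0 c] by simp
  have m0r: "m c 0 = 0" for c using mr[of c 0 0] by simp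
  have mnl: "m (- a) c = - m a c" for a c using ml[of "-a" a c] m0l by (simp add: eq_neg_iff_add_eq_0)
  have mnr: "m c (- a) = - m c a" for a c using mr[of c "-a" a] m0r by (simp add: eq_neg_iff_add_eq_0)
  have altl: "m (alt k a) c = alt k (m a c)" for k a c by (simp add: alt_def mnl)
  have altr: "m c (alt k a) = alt k (m c a)" for k a c by (simp add: alt_def mnr)
  have suml: "m (sum f A) c = (\<Sum>a\<in>A. m (f a) c)" if "finite A" for f A c
    using that by (induction A) (simp_all add: m0l ml)
  have sumr: "m c (sum f A) = (\<Sum>a\<in>A. m c (f a))" if "finite A" for f A c
    using that by (induction A) (simp_all add: m0r mr)
  have lo: "(\<Sum>k\<le>p. alt k (m (F (skip k)) (G (\<lambda>j. skip k (j + p)))))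
     = (\<Sum>k\<le>p. alt k (m (F (skip k)) (G (\<lambda>j. j + p + 1))))"
    by (intro sum.cong refl arg_cong[where f="alt _"] arg_cong2[where f=m] G) (auto simp: skip_def)
  have "(\<Sum>k=p+1..p+q+1. alt k (m (F (skip k)) (G (\<lambda>j. skip k (j + p)))))
     = (\<Sum>k=1..q+1. alt (k+p) (m (F (skip (k+p))) (G (\<lambda>j. skip (k+p) (j + p)))))"
    using sum.shift_bounds_cl_nat_ivl[of "\<lambda>k. alt k (m (F (skip k)) (G (\<lambda>j. skip k (j + p))))" 1 p "q+1"]
    by (simp add: add.commute del: sum.cl_ivl_Suc)
  also have "\<dots> = (\<Sum>k=1..q+1. alt p (alt k (m (F (\<lambda>j. j)) (G (\<lambda>j. skip k j + p)))))"
    by (intro sum.cong refl, subst add.commute, subst alt_plus_exponent)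
       (intro arg_cong[where f="alt _"] arg_cong2[where f=m] F G; auto simp: skip_def)
  finally have hi: "(\<Sum>k=p+1..p+q+1. alt k (m (F (skip k)) (G (\<lambda>j. skip k (j + p)))))
     = alt p (\<Sum>k=1..q+1. alt k (m (F (\<lambda>j. j)) (G (\<lambda>j. skip k j + p))))"
    by (simp only: alt_sum)
  have r1: "m (\<Sum>k\<le>p + 1. alt k (F (skip k))) (G (\<lambda>j. j + p + 1))
     = (\<Sum>k\<le>p. alt k (m (F (skip k)) (G (\<lambda>j. j + p + 1)))) + alt (p+1) (m (F (\<lambda>j. j)) (G (\<lambda>j. j + p + 1)))"
  proof -
    have "F (skip (Suc p)) = F (\<lambda>j. j)" by (rule F) (auto simp: skip_def)
    then show ?thesis by (simp add: suml altl ml)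
  qed
  have r2: "m (F (\<lambda>j. j)) (\<Sum>k\<le>q + 1. alt k (G (\<lambda>j. skip k j + p)))
    = m (F (\<lambda>j. j)) (G (\<lambda>j. j + p + 1)) + (\<Sum>k=1..q+1. alt k (m (F (\<lambda>j. j)) (G (\<lambda>j. skip k j + p))))"
  proof -
    have "{..q+1} = insert 0 {1..q+1}" by auto
    moreover have "alt 0 (G (\<lambda>j. skip 0 j + p)) = G (\<lambda>j. j + p + 1)" by (simp add: alt_def skip_def)
    ultimately show ?thesis by (simp add: sumr altr mr del: sum.cl_ivl_Suc sum.atMost_Suc)
  qed
  show ?thesis unfolding sum_atMost_split lo hi r1 r2 by (simp add: alt_add alt_Suc)
qed

text \<open>Enumerates the vertices outside the open interval from \<open>j\<close> to \<open>j + q\<close>.\<close>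

definition vjoin :: "nat \<Rightarrow> nat \<Rightarrow> nat \<Rightarrow> nat" where
  "vjoin j q i = (if i \<le> j then i else i + q - 1)"

text \<open>The coboundary of Steenrod's product \<open>F \<union>\<^sub>1 G\<close> for a cocycle \<open>F\<close>. The terms that involve interior faces
  of \<open>F\<close> are eliminated with the cocycle condition, and the rest telescopes in \<open>j\<close>.\<close>

lemma cup1_faces:
  fixes F G :: "(nat \<Rightarrow> nat) \<Rightarrow> 'c::comm_ring_1"
  assumes F: "\<And>\<alpha> \<beta>. (\<And>j. j \<le> p \<Longrightarrow> \<alpha> j = \<beta> j) \<Longrightarrow> F \<alpha> = F \<beta>"
    and G: "\<And>\<alpha> \<beta>. (\<And>j. j \<le> q \<Longrightarrow> \<alpha> j = \<beta> j) \<Longrightarrow> G \<alpha> = G \<beta>"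
    and cocycle: "\<And>j. j \<le> p \<Longrightarrow> (\<Sum>k\<le>p + 1. (- 1) ^ k * F (vjoin j q \<circ> skip k)) = 0"
  shows "(\<Sum>k\<le>p + q. (- 1) ^ k * (\<Sum>j<p. (- 1) ^ ((q + 1) * j) * F (skip k \<circ> vjoin j q) * G (\<lambda>i. skip k (i + j))))
    = (- 1) ^ q * (F (\<lambda>i. i + q) * G (\<lambda>i. i) - (- 1) ^ (p * q) * F (\<lambda>i. i) * G (\<lambda>i. i + p))
      + (\<Sum>j<p. (- 1) ^ (q * j) * F (vjoin j (q + 1)) * (\<Sum>k\<le>q + 1. (- 1) ^ k * G (\<lambda>i. skip k i + j)))"
proof -
  \<comment> \<open>\<open>P\<close> and \<open>Q\<close> collect the faces of \<open>F\<close>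
    before and after the gap at \<open>j\<close>. The two faces at its ends are \<open>a\<close>,
    which removes vertex \<open>j\<close>, and \<open>b\<close>, which removes the vertex behind the
    gap and so makes it longer by one.\<close>
  define P where "P j = (\<Sum>k<j. (- 1) ^ k * F (vjoin j q \<circ> skip k))" for j
  define Q where "Q j = (\<Sum>k=j+2..p+1. (- 1) ^ k * F (vjoin j q \<circ> skip k))" for j
  define a where "a j = F (vjoin j q \<circ> skip j)" for j
  define b where "b j = F (vjoin j (q + 1))" for j
  define g where "g j = G (\<lambda>i. i + j)" for j
  define d where "d j = (\<Sum>k\<le>q + 1. (- 1) ^ k * G (\<lambda>i. skip k i + j))" for j
  \<comment> \<open>Removing the near end of the gap at \<open>j + 1\<close> leaves the same
    vertices as removing the far end of the gap at \<open>j\<close>. This identification links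
    consecutive \<open>j\<close>.\<close>
  have ab: "a (Suc j) = b j" for j
    unfolding a_def b_def by (rule F) (auto simp: vjoin_def skip_def)
  have rel: "P j + (-1)^j * a j - (-1)^j * b j + Q j = 0" if "j \<le> p" for j
  proof -
    let ?t = "\<lambda>k. (- 1) ^ k * F (vjoin j q \<circ> skip k)"
    have "{..p+1} = {..<j} \<union> insert j (insert (j+1) {j+2..p+1})" using that by auto
    then have "sum ?t {..p+1} = sum ?t {..<j} + sum ?t (insert j (insert (j+1) {j+2..p+1}))"
      by (simp only:, subst sum.union_disjoint) auto
    moreover have "F (vjoin j q \<circ> skip (Suc j)) = b j"
      unfolding b_def by (rule F) (auto simp: vjoin_def skip_def)
    ultimately show ?thesis
      using cocycle[OF that] unfolding P_def Q_def a_def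
      by (simp add: algebra_simps del: sum.cl_ivl_Suc)
  qed
  have inner: "(\<Sum>k\<le>p + q. (- 1) ^ k * (F (skip k \<circ> vjoin j q) * G (\<lambda>i. skip k (i + j))))
     = P (Suc j) * g (Suc j) + (-1)^j * b j * (d j - g (Suc j) + (-1)^q * g j) + (-1)^(q+1) * Q j * g j"
    if jp: "j < p" for j
  proof -
    let ?t = "\<lambda>k. (- 1) ^ k * (F (skip k \<circ> vjoin j q) * G (\<lambda>i. skip k (i + j)))"
    \<comment> \<open>A face up to \<open>j\<close> moves the gap of \<open>F\<close> and shifts
      \<open>G\<close>; a face from \<open>j + 1\<close> to \<open>j + q\<close> only lengthens the
      gap for \<open>F\<close> and is an interior face for \<open>G\<close>; a later face leaves
      \<open>G\<close> alone.\<close>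
    have "{..p+q} = {..j} \<union> ({j+1..j+q} \<union> {j+q+1..p+q})" using jp by auto
    then have "sum ?t {..p+q} = sum ?t {..j} + (sum ?t {j+1..j+q} + sum ?t {j+q+1..p+q})"
      by (simp only:, subst sum.union_disjoint; (subst sum.union_disjoint)?) auto
    moreover have "sum ?t {..j} = P (Suc j) * g (Suc j)"
    proof -
      have "F (skip k \<circ> vjoin j q) = F (vjoin (Suc j) q \<circ> skip k)" "G (\<lambda>i. skip k (i + j)) = g (Suc j)" if "k \<le> j" for k
        unfolding g_def using that by (intro F G; auto simp: vjoin_def skip_def)+
      then have "sum ?t {..j} = (\<Sum>k\<le>j. (-1)^k * (F (vjoin (Suc j) q \<circ> skip k) * g (Suc j)))"
        by (intro sum.cong) auto
      then show ?thesis unfolding P_def by (simp add: sum_distrib_right mult.assoc lessThan_Suc_atMost)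
    qed
    moreover have "sum ?t {j+1..j+q} = (-1)^j * b j * (d j - g (Suc j) + (-1)^q * g j)"
    proof -
      have "sum ?t {j+1..j+q} = (\<Sum>k=1..q. ?t (k + j))"
        using sum.shift_bounds_cl_nat_ivl[of ?t 1 j q] by (simp add: add.commute)
      also have "\<dots> = (\<Sum>k=1..q. (-1)^j * b j * ((-1)^k * G (\<lambda>i. skip k i + j)))"
      proof (intro sum.cong refl)
        fix k assume k: "k \<in> {1..q}"
        have "F (skip (k+j) \<circ> vjoin j q) = b j" unfolding b_def using k by (intro F) (auto simp: vjoin_def skip_def)
        moreover have "G (\<lambda>i. skip (k+j) (i + j)) = G (\<lambda>i. skip k i + j)" by (intro G) (auto simp: skip_def)
        ultimately show "?t (k + j) = (-1)^j * b j * ((-1)^k * G (\<lambda>i. skip k i + j))"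
          by (simp add: power_add mult_ac)
      qed
      also have "\<dots> = (-1)^j * b j * (\<Sum>k=1..q. (-1)^k * G (\<lambda>i. skip k i + j))"
        by (simp add: sum_distrib_left)
      also have "(\<Sum>k=1..q. (-1)^k * G (\<lambda>i. skip k i + j)) = d j - g (Suc j) + (-1)^q * g j"
      proof -
        have "{..q+1} = insert 0 (insert (q+1) {1..q})" by auto
        moreover have "G (\<lambda>i. skip 0 i + j) = g (Suc j)" unfolding g_def by (intro G) (auto simp: skip_def)
        moreover have "G (\<lambda>i. skip (Suc q) i + j) = g j" unfolding g_def by (intro G) (auto simp: skip_def)
        ultimately show ?thesis unfolding d_def by simp
      qed
      finally show ?thesis .
    qed
    moreover have "sum ?t {j+q+1..p+q} = (-1)^(q+1) * Q j * g j"
    proof -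
      have "sum ?t {j+q+1..p+q} = (\<Sum>k=j+1..p. ?t (k + q))"
        using sum.shift_bounds_cl_nat_ivl[of ?t "j+1" q p] by (simp add: add_ac)
      also have "\<dots> = (\<Sum>k=j+1..p. (-1)^(q+1) * g j * ((-1)^(k+1) * F (vjoin j q \<circ> skip (k+1))))"
      proof (intro sum.cong refl)
        fix k assume k: "k \<in> {j+1..p}"
        have "F (skip (k+q) \<circ> vjoin j q) = F (vjoin j q \<circ> skip (k+1))" using k by (intro F) (auto simp: vjoin_def skip_def)
        moreover have "G (\<lambda>i. skip (k+q) (i + j)) = g j" unfolding g_def using k by (intro G) (auto simp: skip_def)
        ultimately show "?t (k + q) = (-1)^(q+1) * g j * ((-1)^(k+1) * F (vjoin j q \<circ> skip (k+1)))"
          by (simp add: power_add mult_ac)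
      qed
      also have "\<dots> = (\<Sum>k=j+2..p+1. (-1)^(q+1) * g j * ((-1)^k * F (vjoin j q \<circ> skip k)))"
        using sum.shift_bounds_cl_nat_ivl[of "\<lambda>k. (-1)^(q+1) * g j * ((-1)^k * F (vjoin j q \<circ> skip k))" "j+1" 1 p]
        by (simp del: sum.cl_ivl_Suc)
      also have "\<dots> = (-1)^(q+1) * Q j * g j" unfolding Q_def
        by (simp add: sum_distrib_left mult_ac del: sum.cl_ivl_Suc)
      finally show ?thesis .
    qed
    ultimately show ?thesis by (simp add: add.assoc)
  qed
  \<comment> \<open>The potential of the telescoping sum. After \<open>Q j\<close> has been
    eliminated by the cocycle relation, what remains besides the products of \<open>b j\<close> and
    \<open>d j\<close> are terms in \<open>P\<close> and \<open>a\<close> at \<open>j\<close> and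
    \<open>j + 1\<close>, which are those of \<open>D\<close>.\<close>
  define D where "D j = - ((-1)^q * (-1)^((q+1)*j) * P j * g j) - (-1)^(q+j) * (-1)^((q+1)*j) * a j * g j" for j
  have step: "(-1)^((q+1)*j) * (P (Suc j) * g (Suc j) + (-1)^j * b j * (d j - g (Suc j) + (-1)^q * g j) + (-1)^(q+1) * Q j * g j)
     = D (Suc j) - D j + (-1)^(q*j) * b j * d j" if "j < p" for j
  proof -
    have Q: "Q j = - P j - (-1)^j * a j + (-1)^j * b j" using rel[of j] that by (simp add: algebra_simps eq_neg_iff_add_eq_0)
    show ?thesis unfolding Q D_def ab
      by (cases "even q"; cases "even j") (simp_all add: algebra_simps power_add power_mult)
  qed
  have "(\<Sum>k\<le>p + q. (- 1) ^ k * (\<Sum>j<p. (- 1) ^ ((q + 1) * j) * F (skip k \<circ> vjoin j q) * G (\<lambda>i. skip k (i + j))))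
     = (\<Sum>k\<le>p + q. \<Sum>j<p. (- 1) ^ ((q + 1) * j) * ((-1)^k * (F (skip k \<circ> vjoin j q) * G (\<lambda>i. skip k (i + j)))))"
    by (simp add: sum_distrib_left mult_ac)
  also have "\<dots> = (\<Sum>j<p. \<Sum>k\<le>p + q. (- 1) ^ ((q + 1) * j) * ((-1)^k * (F (skip k \<circ> vjoin j q) * G (\<lambda>i. skip k (i + j)))))"
    by (rule sum.swap)
  also have "\<dots> = (\<Sum>j<p. D (Suc j) - D j + (-1)^(q*j) * b j * d j)"
    by (intro sum.cong refl) (simp only: flip: sum_distrib_left, simp only: inner step lessThan_iff)
  also have "\<dots> = D p - D 0 + (\<Sum>j<p. (-1)^(q*j) * b j * d j)"
    by (simp only: sum.distrib sum_lessThan_telescope)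
  also have "D 0 = - ((-1)^q * F (\<lambda>i. i + q) * G (\<lambda>i. i))"
  proof -
    have "a 0 = F (\<lambda>i. i + q)" unfolding a_def by (rule F) (auto simp: vjoin_def skip_def)
    then show ?thesis by (simp add: D_def P_def g_def)
  qed
  \<comment> \<open>At \<open>j = p\<close> no faces are left behind the gap, so the relation gives
    \<open>P p\<close> in terms of the whole of \<open>F\<close> and \<open>a p\<close>, and
    \<open>a p\<close> drops out of \<open>D p\<close>.\<close>
  also have "D p = - ((-1)^q * (-1)^(p*q) * F (\<lambda>i. i) * G (\<lambda>i. i + p))"
  proof -
    have b: "b p = F (\<lambda>i. i)" unfolding b_def by (rule F) (auto simp: vjoin_def)
    have P: "P p = (-1)^p * F (\<lambda>i. i) - (-1)^p * a p" using rel[of p] b unfolding Q_def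
      by (simp add: algebra_simps eq_neg_iff_add_eq_0)
    show ?thesis unfolding D_def g_def P
      by (cases "even p"; cases "even q") (simp_all add: algebra_simps power_add)
  qed
  finally show ?thesis unfolding b_def d_def by (rule trans) (simp add: right_diff_distrib mult.assoc)
qed

section \<open>Singular cohomology\<close>

lemma cochains_zero: "(\<lambda>s. 0) \<in> cochains p X"
  by (simp add: cochains_def)

lemma cochains_add: "f \<in> cochains p X \<Longrightarrow> g \<in> cochains p X \<Longrightarrow> (\<lambda>s. f s + g s) \<in> cochains p X"
  by (force simp: cochains_def)

lemma cochains_map: "f \<in> cochains p X \<Longrightarrow> h 0 = 0 \<Longrightarrow> (\<lambda>s. h (f s)) \<in> cochains p X"
  unfolding cochains_def by (clarsimp, metis)

lemma coboundary_in_cochains: "coboundary p X f \<in> cochains (p + 1) X"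
  by (auto simp: cochains_def coboundary_def)

lemma coboundary_eq_vface:
  assumes "singular_simplex (Suc p) X s"
  shows "coboundary (int p) X f s = (\<Sum>i\<le>Suc p. alt i (f (vface p (skip i) s)))"
proof -
  have n: "nat (int p + 1) = Suc p" by simp
  have "(\<Sum>i\<le>Suc p. if even i then f (singular_face (Suc p) i s) else - f (singular_face (Suc p) i s))
    = (\<Sum>i\<le>Suc p. alt i (f (vface p (skip i) s)))"
    by (rule sum.cong) (auto simp: alt_def singular_face_eq_vface)
  then show ?thesis unfolding coboundary_def n using assms by simp
qed

lemma coboundary_negative: "p < 0 \<Longrightarrow> coboundary p X f = (\<lambda>s. 0)"
  by (simp add: coboundary_def)

lemma coboundary_outside: "\<not> (0 \<le> p \<and> singular_simplex (nat (p + 1)) X s) \<Longrightarrow> coboundary p X f s = 0"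
  by (auto simp: coboundary_def)

lemma coboundary_add:
  fixes f g :: "'a ssimplex \<Rightarrow> 'c::ab_group_add"
  shows "coboundary p X (\<lambda>s. f s + g s) = (\<lambda>s. coboundary p X f s + coboundary p X g s)"
proof -
  have "(\<Sum>i\<le>n. if even i then a i + b i else - (a i + b i)) =
    (\<Sum>i\<le>n. if even i then a i else - a i) + (\<Sum>i\<le>n. if even i then b i else - b i)"
    for n and a b :: "nat \<Rightarrow> 'c"
    by (subst sum.distrib[symmetric], rule sum.cong) auto
  then show ?thesis by (auto simp: coboundary_def fun_eq_iff)
qed

text \<open>Naturality in the coefficients. It serves the inclusion of the integers in the reals,
  the projection to the circle, negation and division by a torsion order.\<close>

lemma coboundary_hom:
  fixes h :: "'b::ab_group_add \<Rightarrow> 'c::ab_group_add" and f :: "'a ssimplex \<Rightarrow> 'b"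
  assumes h: "\<And>x y. h (x + y) = h x + h y"
  shows "coboundary p X (\<lambda>s. h (f s)) = (\<lambda>s. h (coboundary p X f s))"
proof -
  have h0: "h 0 = 0" using h[of 0 0] by simp
  have hn: "h (- x) = - h x" for x using h[of "-x" x] h0 by (simp add: eq_neg_iff_add_eq_0)
  have hs: "h (sum a A) = (\<Sum>x\<in>A. h (a x))" if "finite A" for a and A :: "nat set"
    using that by (induction A) (simp_all add: h h0)
  have "(\<Sum>i\<le>n. if even i then h (a i) else - h (a i)) = h (\<Sum>i\<le>n. if even i then a i else - a i)"
    for n and a :: "nat \<Rightarrow> 'b"
    by (subst hs) (auto simp: hn intro: sum.cong)
  then show ?thesis by (auto simp: coboundary_def fun_eq_iff h0)
qed

lemma coboundary_zero: "coboundary p X (\<lambda>s. 0) = (\<lambda>s. 0)"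
  using coboundary_hom[of "\<lambda>x. 0" p X] by simp

lemma coboundary_uminus: "coboundary p X (\<lambda>s. - f s) = (\<lambda>s. - coboundary p X f s)"
  by (rule coboundary_hom) simp

lemma coboundary_diff: "coboundary p X (\<lambda>s. f s - g s) = (\<lambda>s. coboundary p X f s - coboundary p X g s)"
  using coboundary_add[of p X f "\<lambda>s. - g s"] by (simp add: coboundary_uminus)

text \<open>For \<open>i < k\<close> the simplicial identity
  \<open>skip i \<circ> skip (k - 1) = skip k \<circ> skip i\<close> pairs the term at
  \<open>(k, i)\<close> with the one at \<open>(i, k - 1)\<close>. The exponents differ by one, so
  each pair cancels.\<close>

lemma sum_faces_of_faces:
  fixes F :: "(nat \<Rightarrow> nat) \<Rightarrow> 'c::ab_group_add"
  shows "(\<Sum>k\<le>Suc (Suc p). alt k (\<Sum>i\<le>Suc p. alt i (F (skip k \<circ> skip i)))) = 0"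
proof -
  define t where "t x = alt (fst x + snd x) (F (skip (fst x) \<circ> skip (snd x)))" for x
  define A where "A = {x. fst x \<le> Suc (Suc p) \<and> snd x < fst x}"
  define B where "B = {x. fst x \<le> snd x \<and> snd x \<le> Suc p}"
  have eq: "{..Suc (Suc p)} \<times> {..Suc p} = A \<union> B" by (auto simp: A_def B_def)
  then have fin: "finite A" "finite B" by (metis finite_Un finite_SigmaI finite_atMost)+
  have "(\<Sum>k\<le>Suc (Suc p). alt k (\<Sum>i\<le>Suc p. alt i (F (skip k \<circ> skip i))))
    = (\<Sum>k\<le>Suc (Suc p). \<Sum>i\<le>Suc p. t (k, i))"
    by (simp only: alt_sum alt_plus_exponent t_def fst_conv snd_conv)
  also have "\<dots> = sum t ({..Suc (Suc p)} \<times> {..Suc p})"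
    using sum.cartesian_product[of "\<lambda>k i. t (k, i)" "{..Suc p}" "{..Suc (Suc p)}"] by (simp only: case_prod_eta)
  also have "\<dots> = sum t A + sum t B"
    unfolding eq by (rule sum.union_disjoint[OF fin]) (force simp: A_def B_def)
  also have "sum t A = (\<Sum>x\<in>B. - t x)"
  proof (rule sum.reindex_bij_witness[where i = "\<lambda>x. (Suc (snd x), fst x)" and j = "\<lambda>x. (snd x, fst x - 1)"])
    fix x assume "x \<in> A"
    then obtain k i where x: "x = (k, i)" "k \<le> Suc (Suc p)" "i < k" by (cases x) (auto simp: A_def)
    show "(Suc (snd (snd x, fst x - 1)), fst (snd x, fst x - 1)) = x" using x by simp
    show "(snd x, fst x - 1) \<in> B" using x by (auto simp: B_def)
    have "skip i (skip (k - 1) j) = skip k (skip i j)" for j using x by (auto simp: skip_def)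
    then have e1: "skip i \<circ> skip (k - 1) = skip k \<circ> skip i" by (intro ext) simp
    have e2: "k + i = Suc (i + (k - 1))" using x by simp
    have "alt (k + i) (F (skip k \<circ> skip i)) = - alt (i + (k - 1)) (F (skip i \<circ> skip (k - 1)))"
      unfolding e1 by (subst e2) (rule alt_Suc)
    then show "- t (snd x, fst x - 1) = t x" by (simp only: x t_def fst_conv snd_conv)
  next
    fix x assume "x \<in> B"
    then show "(snd (Suc (snd x), fst x), fst (Suc (snd x), fst x) - 1) = x" "(Suc (snd x), fst x) \<in> A"
      by (auto simp: A_def B_def)
  qed
  finally show ?thesis by (simp only: sum_negf left_minus)
qed

lemma coboundary_coboundary: "coboundary (p + 1) X (coboundary p X f) = (\<lambda>s. 0)"
proof
  fix s
  show "coboundary (p + 1) X (coboundary p X f) s = 0"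
  proof (cases "0 \<le> p \<and> singular_simplex (nat (p + 2)) X s")
    case True
    then obtain n where p: "p = int n" using zero_le_imp_eq_int by blast
    then have s: "singular_simplex (Suc (Suc n)) X s" using True by (simp add: nat_add_distrib)
    have "coboundary p X f (vface (Suc n) (skip k) s) = (\<Sum>i\<le>Suc n. alt i (f (vface n (skip k \<circ> skip i) s)))"
      if "k \<le> Suc (Suc n)" for k
    proof -
      have "singular_simplex (Suc n) X (vface (Suc n) (skip k) s)"
        using s that by (rule_tac singular_simplex_vface) (auto simp: skip_def)
      moreover have "vface n (skip i) (vface (Suc n) (skip k) s) = vface n (skip k \<circ> skip i) s" for i
        by (rule vface_vface) (auto simp: skip_def)
      ultimately show ?thesis unfolding p by (simp only: coboundary_eq_vface)
    qed
    then have "coboundary (p + 1) X (coboundary p X f) s =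
      (\<Sum>k\<le>Suc (Suc n). alt k (\<Sum>i\<le>Suc n. alt i (f (vface n (skip k \<circ> skip i) s))))"
      using coboundary_eq_vface[OF s, of "coboundary p X f"]
      by (simp only: p of_nat_Suc add.commute[of 1], intro sum.cong refl) simp
    then show ?thesis by (simp only: sum_faces_of_faces[where p = n and F = "\<lambda>\<alpha>. f (vface n \<alpha> s)"])
  next
    case False
    show ?thesis
    proof (cases "p < 0")
      case True
      then show ?thesis by (simp add: coboundary_negative coboundary_zero)
    next
      case 2: False
      then show ?thesis using False by (intro coboundary_outside) (auto simp: algebra_simps)
    qed
  qed
qed

section \<open>Cohomology classes as cosets\<close>

lemma coboundary_coboundary': "coboundary p X (coboundary (p - 1) X f) = (\<lambda>s. 0)"
  using coboundary_coboundary[of "p - 1"] by simp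

lemma carrier_cocycle_group: "f \<in> carrier (cocycle_group p X) \<longleftrightarrow> f \<in> cochains p X \<and> coboundary p X f = (\<lambda>s. 0)"
  by (simp add: cocycle_group_def)

lemma mult_cocycle_group [simp]: "f \<otimes>\<^bsub>cocycle_group p X\<^esub> g = (\<lambda>s. f s + g s)"
  by (simp add: cocycle_group_def)

lemma one_cocycle_group [simp]: "\<one>\<^bsub>cocycle_group p X\<^esub> = (\<lambda>s. 0)"
  by (simp add: cocycle_group_def)

lemma comm_group_cocycle_group: "comm_group (cocycle_group p X :: ('a ssimplex \<Rightarrow> 'c::ab_group_add) monoid)"
proof (rule comm_groupI)
  fix f assume f: "f \<in> carrier (cocycle_group p X :: ('a ssimplex \<Rightarrow> 'c) monoid)"
  show "\<exists>g\<in>carrier (cocycle_group p X). g \<otimes>\<^bsub>cocycle_group p X\<^esub> f = \<one>\<^bsub>cocycle_group p X\<^esub>"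
    by (rule bexI[of _ "\<lambda>s. - f s"]) (use f in \<open>auto simp: carrier_cocycle_group coboundary_uminus cochains_map\<close>)
qed (auto simp: carrier_cocycle_group cochains_add coboundary_add cochains_zero coboundary_zero add.assoc add.commute)

lemma subgroup_coboundaries: "subgroup (coboundaries p X) (cocycle_group p X :: ('a ssimplex \<Rightarrow> 'c::ab_group_add) monoid)"
proof (rule group.subgroupI[OF comm_group.axioms(2)[OF comm_group_cocycle_group]])
  show "coboundaries p X \<subseteq> carrier (cocycle_group p X :: ('a ssimplex \<Rightarrow> 'c) monoid)"
    using coboundary_in_cochains[of "p - 1"] by (auto simp: coboundaries_def carrier_cocycle_group coboundary_coboundary')
  show "coboundaries p X \<noteq> ({} :: ('a ssimplex \<Rightarrow> 'c) set)"
    using cochains_zero by (auto simp: coboundaries_def)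
next
  fix f assume "f \<in> (coboundaries p X :: ('a ssimplex \<Rightarrow> 'c) set)"
  then obtain h where h: "h \<in> cochains (p - 1) X" "f = coboundary (p - 1) X h" by (auto simp: coboundaries_def)
  have f: "f \<in> carrier (cocycle_group p X)"
    using coboundary_in_cochains[of "p - 1"] by (auto simp: h carrier_cocycle_group coboundary_coboundary')
  have "inv\<^bsub>cocycle_group p X\<^esub> f = (\<lambda>s. - f s)"
    using f by (intro group.inv_equality[OF comm_group.axioms(2)[OF comm_group_cocycle_group]])
      (auto simp: carrier_cocycle_group coboundary_uminus cochains_map)
  also have "\<dots> = coboundary (p - 1) X (\<lambda>s. - h s)" by (simp add: h coboundary_uminus)
  finally show "inv\<^bsub>cocycle_group p X\<^esub> f \<in> coboundaries p X"
    unfolding coboundaries_def using cochains_map[OF h(1), of uminus] by simp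
next
  fix f g assume "f \<in> (coboundaries p X :: ('a ssimplex \<Rightarrow> 'c) set)" "g \<in> (coboundaries p X :: ('a ssimplex \<Rightarrow> 'c) set)"
  then obtain h k where "h \<in> cochains (p - 1) X" "f = coboundary (p - 1) X h" "k \<in> cochains (p - 1) X" "g = coboundary (p - 1) X k"
    by (auto simp: coboundaries_def)
  then show "f \<otimes>\<^bsub>cocycle_group p X\<^esub> g \<in> coboundaries p X"
    unfolding coboundaries_def by (intro image_eqI[of _ _ "\<lambda>s. h s + k s"]) (auto simp: coboundary_add cochains_add)
qed

lemma normal_coboundaries: "coboundaries p X \<lhd> (cocycle_group p X :: ('a ssimplex \<Rightarrow> 'c::ab_group_add) monoid)"
  by (simp add: comm_group.normal_iff_subgroup[OF comm_group_cocycle_group] subgroup_coboundaries)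

lemma comm_group_cohomology_group: "comm_group (cohomology_group p X :: ('a ssimplex \<Rightarrow> 'c::ab_group_add) set monoid)"
  unfolding cohomology_group_def
  by (rule comm_group.abelian_FactGroup[OF comm_group_cocycle_group subgroup_coboundaries])

definition cclass :: "int \<Rightarrow> 'a topology \<Rightarrow> ('a ssimplex \<Rightarrow> 'c::ab_group_add) \<Rightarrow> ('a ssimplex \<Rightarrow> 'c) set" where
  "cclass p X f = coboundaries p X #>\<^bsub>cocycle_group p X\<^esub> f"

lemma mem_cclass: "g \<in> cclass p X f \<longleftrightarrow> (\<exists>h\<in>cochains (p - 1) X. g = (\<lambda>s. f s + coboundary (p - 1) X h s))"
  by (auto simp: cclass_def r_coset_def coboundaries_def add.commute)

lemma carrier_cohomology_group: "carrier (cohomology_group p X) = cclass p X ` carrier (cocycle_group p X)"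
  by (simp add: cohomology_group_def carrier_FactGroup cclass_def[abs_def])

lemma cclass_self: "f \<in> cclass p X f"
  unfolding mem_cclass by (rule bexI[OF _ cochains_zero]) (simp add: coboundary_zero)

lemma cclass_eq:
  assumes "f \<in> carrier (cocycle_group p X)" "g \<in> cclass p X f"
  shows "cclass p X g = cclass p X f" "g \<in> carrier (cocycle_group p X)"
proof -
  interpret group "cocycle_group p X" using comm_group.axioms(2)[OF comm_group_cocycle_group] .
  show "cclass p X g = cclass p X f"
    using repr_independence[OF assms(2)[unfolded cclass_def] assms(1) subgroup_coboundaries] by (simp add: cclass_def)
  show "g \<in> carrier (cocycle_group p X)"
    using subgroup.elemrcos_carrier[OF subgroup_coboundaries group_axioms assms[unfolded cclass_def]] .
qed

lemma cohomology_rep: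
  assumes "u \<in> carrier (cohomology_group p X)" "f \<in> u"
  shows "f \<in> carrier (cocycle_group p X)" "u = cclass p X f"
  using assms cclass_eq unfolding carrier_cohomology_group by blast+

lemma cohomology_repE:
  assumes "u \<in> carrier (cohomology_group p X)"
  obtains f where "f \<in> carrier (cocycle_group p X)" "u = cclass p X f" "f \<in> u"
  using assms cclass_self unfolding carrier_cohomology_group by blast

lemma cclass_mult:
  assumes "f \<in> carrier (cocycle_group p X)" "g \<in> carrier (cocycle_group p X)"
  shows "cclass p X f \<otimes>\<^bsub>cohomology_group p X\<^esub> cclass p X g = cclass p X (\<lambda>s. f s + g s)"
  using normal.rcos_sum[OF normal_coboundaries assms] by (simp add: cclass_def cohomology_group_def)

lemma one_cohomology_group: "\<one>\<^bsub>cohomology_group p X\<^esub> = coboundaries p X"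
  by (simp add: cohomology_group_def)

lemma cclass_pow:
  fixes f :: "'a ssimplex \<Rightarrow> int"
  assumes "f \<in> carrier (cocycle_group p X)"
  shows "cclass p X f [^]\<^bsub>cohomology_group p X\<^esub> n = cclass p X (\<lambda>s. int n * f s) \<and>
    (\<lambda>s. int n * f s) \<in> carrier (cocycle_group p X)"
proof (induction n)
  case 0
  have "cclass p X (\<lambda>s. 0 :: int) = coboundaries p X"
    by (auto simp: mem_cclass coboundaries_def)
  then show ?case by (simp add: one_cohomology_group carrier_cocycle_group cochains_zero coboundary_zero)
next
  case (Suc n)
  interpret H: group "cohomology_group p X :: ('a ssimplex \<Rightarrow> int) set monoid"
    using comm_group.axioms(2)[OF comm_group_cohomology_group] .
  have "(\<lambda>s. int n * f s + f s) \<in> carrier (cocycle_group p X)"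
    using Suc assms by (auto simp: carrier_cocycle_group cochains_add coboundary_add)
  moreover have "(\<lambda>s. int n * f s + f s) = (\<lambda>s. int (Suc n) * f s)" by (auto simp: algebra_simps)
  ultimately show ?case using Suc assms cclass_mult[of "\<lambda>s. int n * f s" p X f] by simp
qed

text \<open>The way to compute an operation on classes: once all its values on representatives are
  cohomologous to one of them, the union of their cosets is a single coset.\<close>

lemma cohom_class_eq:
  assumes "f \<in> carrier (cocycle_group p X)" "F \<noteq> {}" "F \<subseteq> cclass p X f"
  shows "cohom_class p X F = cclass p X f"
proof -
  have "cohom_class p X F = (\<Union>g\<in>F. cclass p X g)"
    by (auto simp: cohom_class_def set_mult_def cclass_def r_coset_def)
  also have "\<dots> = cclass p X f" using assms(2,3) cclass_eq(1)[OF assms(1)] by blast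
  finally show ?thesis .
qed

section \<open>Restriction of cochains to a subspace\<close>

lemma cochain_pullback_id:
  "cochain_pullback p Y id f s = (if 0 \<le> p \<and> singular_simplex (nat p) Y s then f s else 0)"
proof -
  have "simplex_map (nat p) id s = s" if "singular_simplex (nat p) Y s"
    using that by (simp add: simplex_map_def singular_simplex_def extensional_restrict)
  then show ?thesis by (simp add: cochain_pullback_def)
qed

lemma cochain_pullback_in_cochains: "cochain_pullback p Y h f \<in> cochains p Y"
  by (auto simp: cochains_def cochain_pullback_def)

lemma coboundary_pullback_id:
  "coboundary p (subtopology X S) (cochain_pullback p (subtopology X S) id f)
     = cochain_pullback (p + 1) (subtopology X S) id (coboundary p X f)"
proof
  fix s
  show "coboundary p (subtopology X S) (cochain_pullback p (subtopology X S) id f) s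
     = cochain_pullback (p + 1) (subtopology X S) id (coboundary p X f) s"
  proof (cases "0 \<le> p \<and> singular_simplex (nat (p + 1)) (subtopology X S) s")
    case True
    then obtain n where p: "p = int n" using zero_le_imp_eq_int by blast
    have s: "singular_simplex (Suc n) (subtopology X S) s" using True by (simp add: p nat_add_distrib)
    then have s': "singular_simplex (Suc n) X s" by (simp add: singular_simplex_subtopology)
    \<comment> \<open>The faces of a simplex of \<open>S\<close> are again simplices of
      \<open>S\<close>, so the cut-off built into the pullback does not affect them.\<close>
    have "singular_simplex n (subtopology X S) (vface n (skip k) s)" if "k \<le> Suc n" for k
      using s that by (rule_tac singular_simplex_vface) (auto simp: skip_def)
    then have "(\<Sum>i\<le>Suc n. alt i (cochain_pullback p (subtopology X S) id f (vface n (skip i) s)))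
       = (\<Sum>i\<le>Suc n. alt i (f (vface n (skip i) s)))"
      by (intro sum.cong refl) (simp add: cochain_pullback_id p)
    moreover have "nat (int n + 1) = Suc n" by simp
    ultimately show ?thesis
      by (simp add: p coboundary_eq_vface[OF s] coboundary_eq_vface[OF s'] cochain_pullback_id[of "int n + 1"] s del: sum.atMost_Suc)
  next
    case False
    then show ?thesis
      by (auto simp: cochain_pullback_id coboundary_outside coboundary_negative)
  qed
qed

lemma cochain_pullback_zero: "cochain_pullback p Y h (\<lambda>s. 0) = (\<lambda>s. 0)"
  by (auto simp: cochain_pullback_def)

lemma cochain_pullback_cocycle:
  "f \<in> carrier (cocycle_group p X) \<Longrightarrow>
    cochain_pullback p (subtopology X S) id f \<in> carrier (cocycle_group p (subtopology X S))"
  by (simp add: carrier_cocycle_group cochain_pullback_in_cochains coboundary_pullback_id cochain_pullback_zero)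

lemma cohom_pullback_cclass:
  assumes f: "f \<in> carrier (cocycle_group p X)"
  shows "cohom_pullback p (subtopology X S) id (cclass p X f)
    = cclass p (subtopology X S) (cochain_pullback p (subtopology X S) id f)"
  unfolding cohom_pullback_def
proof (rule cohom_class_eq)
  let ?Y = "subtopology X S"
  show "cochain_pullback p ?Y id ` cclass p X f \<subseteq> cclass p ?Y (cochain_pullback p ?Y id f)"
  proof clarify
    fix g assume "g \<in> cclass p X f"
    then obtain h where h: "g = (\<lambda>s. f s + coboundary (p - 1) X h s)" by (auto simp: mem_cclass)
    have "coboundary (p - 1) ?Y (cochain_pullback (p - 1) ?Y id h) = cochain_pullback p ?Y id (coboundary (p - 1) X h)"
      using coboundary_pullback_id[of "p - 1" X S h] by simp
    moreover have "cochain_pullback p ?Y id g = (\<lambda>s. cochain_pullback p ?Y id f s + cochain_pullback p ?Y id (coboundary (p - 1) X h) s)"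
      by (auto simp: cochain_pullback_def h)
    ultimately show "cochain_pullback p ?Y id g \<in> cclass p ?Y (cochain_pullback p ?Y id f)"
      unfolding mem_cclass by (intro bexI[of _ "cochain_pullback (p - 1) ?Y id h"]) (auto simp: cochain_pullback_in_cochains)
  qed
qed (use f cclass_self in \<open>auto intro: cochain_pullback_cocycle\<close>)

text \<open>Torsion read on cochains: triviality of the \<open>n\<close>-th power provides an
  integral cochain \<open>c\<close> with coboundary \<open>n f\<close>. Over the reals
  \<open>c\<close> divided by \<open>n\<close> is then a primitive of \<open>f\<close>.\<close>

lemma torsion_rep:
  assumes u: "u \<in> carrier (torsion_cohomology p X)"
  obtains f n c where "f \<in> carrier (cocycle_group p X)" "u = cclass p X f" "n > (0::nat)"
    "c \<in> cochains (p - 1) X" "\<And>s. int n * f s = coboundary (p - 1) X c s"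
proof -
  obtain n :: nat where uc: "u \<in> carrier (cohomology_group p X)" and n: "n > 0"
    "u [^]\<^bsub>cohomology_group p X\<^esub> n = \<one>\<^bsub>cohomology_group p X\<^esub>"
    using u by (auto simp: torsion_cohomology_def)
  obtain f where f: "f \<in> carrier (cocycle_group p X)" "u = cclass p X f" using cohomology_repE[OF uc] .
  have "cclass p X (\<lambda>s. int n * f s) = coboundaries p X"
    using n(2) cclass_pow[OF f(1), of n] by (simp add: f(2) one_cohomology_group)
  then have "(\<lambda>s. int n * f s) \<in> coboundaries p X" using cclass_self by metis
  then obtain c where "c \<in> cochains (p - 1) X" "(\<lambda>s. int n * f s) = coboundary (p - 1) X c"
    by (auto simp: coboundaries_def)
  then show ?thesis using that f n(1) by metis
qed

lemma comm_group_torsion_cohomology: "comm_group (torsion_cohomology p X)"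
proof -
  let ?H = "cohomology_group p X :: ('a ssimplex \<Rightarrow> int) set monoid"
  let ?T = "{u \<in> carrier ?H. \<exists>n::nat. n > 0 \<and> u [^]\<^bsub>?H\<^esub> n = \<one>\<^bsub>?H\<^esub>}"
  interpret H: comm_group ?H by (rule comm_group_cohomology_group)
  have "subgroup ?T ?H"
  proof (rule H.subgroupI)
    show "?T \<noteq> {}" using H.one_closed H.nat_pow_one by (metis (mono_tags, lifting) empty_iff mem_Collect_eq zero_less_one)
  next
    fix u assume "u \<in> ?T"
    then show "inv\<^bsub>?H\<^esub> u \<in> ?T" using H.nat_pow_inv by (auto simp: )
  next
    fix u v assume "u \<in> ?T" "v \<in> ?T"
    then obtain n k :: nat where nk: "u \<in> carrier ?H" "v \<in> carrier ?H" "n > 0" "k > 0"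
      "u [^]\<^bsub>?H\<^esub> n = \<one>\<^bsub>?H\<^esub>" "v [^]\<^bsub>?H\<^esub> k = \<one>\<^bsub>?H\<^esub>" by auto
    have "(u \<otimes>\<^bsub>?H\<^esub> v) [^]\<^bsub>?H\<^esub> (n * k) = (u [^]\<^bsub>?H\<^esub> n) [^]\<^bsub>?H\<^esub> k \<otimes>\<^bsub>?H\<^esub> (v [^]\<^bsub>?H\<^esub> k) [^]\<^bsub>?H\<^esub> n"
      using nk(1,2) by (simp add: H.nat_pow_distrib H.nat_pow_pow mult.commute)
    then have "(u \<otimes>\<^bsub>?H\<^esub> v) [^]\<^bsub>?H\<^esub> (n * k) = \<one>\<^bsub>?H\<^esub>" using nk by simp
    moreover have "n * k > 0" using nk by simp
    ultimately show "u \<otimes>\<^bsub>?H\<^esub> v \<in> ?T" using nk(1,2) by blast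
  qed auto
  then have "group (?H\<lparr>carrier := ?T\<rparr>)" by (rule subgroup.subgroup_is_group[OF _ H.is_group])
  then have "comm_group (?H\<lparr>carrier := ?T\<rparr>)"
    by (rule group.group_comm_groupI) (simp add: H.m_comm)
  then show ?thesis by (simp add: torsion_cohomology_def)
qed

section \<open>Evaluation on chains and cup products\<close>

text \<open>The real counterpart of the sum in \<open>kronecker\<close>. Computations take place
  over the reals, where torsion classes have primitives, and are reduced modulo the integers at the
  end.\<close>

definition eval_chain :: "('a ssimplex \<Rightarrow> real) \<Rightarrow> 'a chain \<Rightarrow> real" where
  "eval_chain f z = (\<Sum>s\<in>Poly_Mapping.keys z. of_int (Poly_Mapping.lookup z s) * f s)"

lemma eval_chain_superset:
  assumes "finite A" "Poly_Mapping.keys z \<subseteq> A"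
  shows "eval_chain f z = (\<Sum>s\<in>A. of_int (Poly_Mapping.lookup z s) * f s)"
  unfolding eval_chain_def by (rule sum.mono_neutral_left) (use assms in \<open>auto simp: in_keys_iff\<close>)

lemma eval_chain_zero [simp]: "eval_chain f 0 = 0"
  by (simp add: eval_chain_def)

lemma eval_chain_of [simp]: "eval_chain f (frag_of s) = f s"
  by (simp add: eval_chain_def)

lemma eval_chain_diff: "eval_chain f (a - b) = eval_chain f a - eval_chain f b"
proof -
  let ?A = "Poly_Mapping.keys a \<union> Poly_Mapping.keys b"
  have "Poly_Mapping.keys (a - b) \<subseteq> ?A" by (rule keys_diff)
  then have "eval_chain f (a - b) = (\<Sum>s\<in>?A. of_int (Poly_Mapping.lookup (a - b) s) * f s)"
    by (intro eval_chain_superset) auto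
  moreover have "eval_chain f a = (\<Sum>s\<in>?A. of_int (Poly_Mapping.lookup a s) * f s)"
    "eval_chain f b = (\<Sum>s\<in>?A. of_int (Poly_Mapping.lookup b s) * f s)"
    by (intro eval_chain_superset; auto)+
  ultimately show ?thesis by (simp add: lookup_minus left_diff_distrib sum_subtractf)
qed

lemma eval_chain_minus: "eval_chain f (- a) = - eval_chain f a"
  using eval_chain_diff[of f 0 a] by simp

lemma eval_chain_add: "eval_chain f (a + b) = eval_chain f a + eval_chain f b"
  using eval_chain_diff[of f a "- b"] by (simp add: eval_chain_minus)

lemma eval_chain_sum: "finite I \<Longrightarrow> eval_chain f (\<Sum>i\<in>I. g i) = (\<Sum>i\<in>I. eval_chain f (g i))"
  by (induction I rule: finite_induct) (simp_all add: eval_chain_add)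

lemma eval_chain_cong: "(\<And>s. s \<in> Poly_Mapping.keys z \<Longrightarrow> f s = g s) \<Longrightarrow> eval_chain f z = eval_chain g z"
  by (simp add: eval_chain_def)

lemma eval_chain_fun_add: "eval_chain (\<lambda>s. f s + g s) z = eval_chain f z + eval_chain g z"
  by (simp add: eval_chain_def distrib_left sum.distrib)

lemma eval_chain_fun_scale: "eval_chain (\<lambda>s. c * f s) z = c * eval_chain f z"
  by (simp add: eval_chain_def sum_distrib_left mult_ac)

lemma eval_chain_Ints: "(\<And>s. s \<in> Poly_Mapping.keys z \<Longrightarrow> f s \<in> \<int>) \<Longrightarrow> eval_chain f z \<in> \<int>"
  unfolding eval_chain_def by (intro Ints_sum Ints_mult Ints_of_int) 

lemma eval_chain_boundary:
  "eval_chain f (chain_boundary (Suc p) z)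
    = eval_chain (\<lambda>s. \<Sum>k\<le>Suc p. alt k (f (singular_face (Suc p) k s))) z"
proof (rule frag_induction[of z UNIV])
  fix s :: "'a ssimplex"
  have "eval_chain f (frag_cmul ((-1) ^ k) (frag_of t)) = alt k (f t)" for k t
    by (cases "even k") (simp_all add: alt_def eval_chain_minus)
  then show "eval_chain f (chain_boundary (Suc p) (frag_of s))
      = eval_chain (\<lambda>s. \<Sum>k\<le>Suc p. alt k (f (singular_face (Suc p) k s))) (frag_of s)"
    by (simp add: chain_boundary_of eval_chain_sum del: sum.atMost_Suc)
qed (simp_all add: chain_boundary_diff eval_chain_diff)

lemma eval_chain_coboundary:
  assumes "singular_chain (Suc p) X z"
  shows "eval_chain (coboundary (int p) X f) z = eval_chain f (chain_boundary (Suc p) z)"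
  unfolding eval_chain_boundary
proof (rule eval_chain_cong)
  fix s assume "s \<in> Poly_Mapping.keys z"
  then have "singular_simplex (Suc p) X s" using assms by (auto simp: singular_chain_def)
  then show "coboundary (int p) X f s = (\<Sum>k\<le>Suc p. alt k (f (singular_face (Suc p) k s)))"
    by (subst coboundary_eq_vface) (auto intro!: sum.cong simp: singular_face_eq_vface)
qed

lemma eval_coboundary_cycle:
  assumes "singular_relcycle p X {} z"
  shows "eval_chain (coboundary (int p - 1) X f) z = 0"
proof (cases p)
  \<comment> \<open>Here the coboundary starts in degree -1 and is zero by convention.\<close>
  case 0
  then show ?thesis by (simp add: coboundary_negative eval_chain_def)
next
  case (Suc n)
  then show ?thesis using assms eval_chain_coboundary[of n X z f] by (simp add: singular_cycle)
qed

section \<open>The circle as the reals modulo the integers\<close>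

lemma to_circle_add: "to_circle (x + y) = to_circle x + to_circle y"
  by transfer simp

lemma to_circle_zero: "to_circle 0 = 0"
  by transfer simp

lemma to_circle_eq_zero: "to_circle x = 0 \<longleftrightarrow> x \<in> \<int>"
  by transfer simp

lemma to_circle_minus: "to_circle (- x) = - to_circle x"
  by transfer simp

lemma to_circle_sum: "to_circle (\<Sum>i\<in>A. f i) = (\<Sum>i\<in>A. to_circle (f i))"
  by (induction A rule: infinite_finite_induct) (simp_all add: to_circle_add to_circle_zero)

lemma circle_scale_to_circle: "circle_scale n (to_circle x) = to_circle (of_int n * x)"
  by transfer simp

lemma to_circle_surj: "\<exists>x. to_circle x = c"
  by transfer (metis Ints_0 diff_self)

lemma circle_scale_add: "circle_scale n (x + y) = circle_scale n x + circle_scale n y"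
  by transfer (simp add: algebra_simps)

lemma circle_scale_add_left: "circle_scale (n + k) x = circle_scale n x + circle_scale k x"
  by transfer (simp add: algebra_simps)

text \<open>The lift is chosen simplex by simplex; its compatibility with coboundaries comes from
  \<open>coboundary_hom\<close>.\<close>

lemma circle_cochain_lift:
  obtains r where "f = (\<lambda>s. to_circle (r s))"
  using to_circle_surj by (metis ext)

section \<open>The Kronecker pairing\<close>

lemma homology_classE:
  assumes "\<xi> \<in> carrier (homology_group (int p) X)" "z \<in> \<xi>"
  shows "singular_relcycle p X {} z" "\<xi> = homologous_rel_set p X {} z"
proof -
  obtain z0 where z0: "singular_relcycle p X {} z0" "\<xi> = homologous_rel_set p X {} z0"
    using assms(1) by (auto simp: carrier_relative_homology_group)
  then have h: "homologous_rel p X {} z0 z" using assms(2) by simp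
  show "singular_relcycle p X {} z" using homologous_rel_singular_relcycle[OF h] z0 by simp
  show "\<xi> = homologous_rel_set p X {} z" using z0(2) h homologous_rel_set_eq[of p X "{}" z0 z] by simp
qed

lemma homology_class_nonempty: "\<xi> \<in> carrier (homology_group (int p) X) \<Longrightarrow> \<exists>z. z \<in> \<xi>"
  by (auto simp: carrier_relative_homology_group intro: homologous_rel_refl)

text \<open>The description in \<open>kronecker\<close> has a unique solution for two reasons.
  Changing the cocycle by a coboundary changes nothing on a cycle. Changing the cycle by a boundary
  adds a value of the coboundary of \<open>r\<close>, and this coboundary is integer-valued because
  \<open>r\<close> is a cocycle in the circle.\<close>

lemma kronecker_eq:
  assumes u: "u \<in> carrier (cohomology_group (int p) X)" "(\<lambda>s. to_circle (r s)) \<in> u"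
    and \<xi>: "\<xi> \<in> carrier (homology_group (int p) X)" "z \<in> \<xi>"
  shows "kronecker (int p) X u \<xi> = to_circle (eval_chain r z)"
proof -
  have val: "(\<Sum>s\<in>Poly_Mapping.keys y. circle_scale (Poly_Mapping.lookup y s) (f s)) = to_circle (eval_chain r z)"
    if f: "f \<in> u" and y: "y \<in> \<xi>" for f y
  proof -
    have "f \<in> cclass (int p) X (\<lambda>s. to_circle (r s))" using f cohomology_rep[OF u] by simp
    then obtain h where h: "f = (\<lambda>s. to_circle (r s) + coboundary (int p - 1) X h s)" by (auto simp: mem_cclass)
    obtain hr where "h = (\<lambda>s. to_circle (hr s))" by (rule circle_cochain_lift)
    then have f': "f = (\<lambda>s. to_circle (r s + coboundary (int p - 1) X hr s))"
      by (simp add: h to_circle_add coboundary_hom)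
    have "(\<Sum>s\<in>Poly_Mapping.keys y. circle_scale (Poly_Mapping.lookup y s) (f s))
      = to_circle (eval_chain (\<lambda>s. r s + coboundary (int p - 1) X hr s) y)"
      by (simp add: f' circle_scale_to_circle eval_chain_def to_circle_sum)
    also have "eval_chain (\<lambda>s. r s + coboundary (int p - 1) X hr s) y = eval_chain r y"
      using eval_coboundary_cycle[OF homology_classE(1)[OF \<xi>(1) y]] by (simp add: eval_chain_fun_add)
    also have "to_circle (eval_chain r y) = to_circle (eval_chain r z)"
    proof -
      have "homologous_rel p X {} z y" using homology_classE(2)[OF \<xi>] y by simp
      then have "singular_relboundary p X {} (z - y)" by (simp add: homologous_rel_def)
      then obtain d where d: "singular_chain (Suc p) X d" "chain_boundary (Suc p) d = z - y"
        unfolding singular_boundary by blast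
      have "coboundary (int p) X r s \<in> \<int>" for s
      proof -
        have "(\<lambda>s. to_circle (coboundary (int p) X r s)) = (\<lambda>s. 0)"
          using cohomology_rep(1)[OF u] by (simp add: carrier_cocycle_group coboundary_hom to_circle_add)
        then show ?thesis by (metis to_circle_eq_zero)
      qed
      then have "eval_chain r (z - y) \<in> \<int>"
        using eval_chain_coboundary[OF d(1), of r] d(2) by (metis eval_chain_Ints)
      then have "to_circle (eval_chain r z - eval_chain r y) = 0"
        by (simp add: to_circle_eq_zero eval_chain_diff)
      moreover have "to_circle (eval_chain r z) = to_circle (eval_chain r z - eval_chain r y) + to_circle (eval_chain r y)"
        by (simp flip: to_circle_add)
      ultimately show ?thesis by simp
    qed
    finally show ?thesis .
  qed
  show ?thesis unfolding kronecker_def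
  proof (rule the_equality, intro conjI)
    show "\<exists>f\<in>u. \<exists>y\<in>\<xi>. to_circle (eval_chain r z)
        = (\<Sum>s\<in>Poly_Mapping.keys y. circle_scale (Poly_Mapping.lookup y s) (f s))"
      using val[OF u(2) \<xi>(2)] u(2) \<xi>(2) by metis
  qed (use u \<xi> val in auto)
qed

section \<open>Cup products\<close>

definition biadditive :: "('x::ab_group_add \<Rightarrow> 'y::ab_group_add \<Rightarrow> 'z::ab_group_add) \<Rightarrow> bool" where
  "biadditive m \<longleftrightarrow> (\<forall>a b c. m (a + b) c = m a c + m b c) \<and> (\<forall>a b c. m a (b + c) = m a b + m a c)"

lemma biadditive_zero_left: "biadditive m \<Longrightarrow> m 0 c = 0"
  unfolding biadditive_def by (metis add_cancel_right_right)

lemma biadditive_zero_right: "biadditive m \<Longrightarrow> m c 0 = 0"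
  unfolding biadditive_def by (metis add_cancel_right_right)

text \<open>The coefficient pairing is a parameter: circle by integers, reals by integers, integers
  by reals and reals by reals all occur, and share one Leibniz rule.\<close>

definition cup ::
  "('x::ab_group_add \<Rightarrow> 'y::ab_group_add \<Rightarrow> 'z::ab_group_add) \<Rightarrow> int \<Rightarrow> int \<Rightarrow> 'a topology \<Rightarrow>
    ('a ssimplex \<Rightarrow> 'x) \<Rightarrow> ('a ssimplex \<Rightarrow> 'y) \<Rightarrow> 'a ssimplex \<Rightarrow> 'z" where
  "cup m p q X f g = (\<lambda>s. if 0 \<le> p \<and> 0 \<le> q \<and> singular_simplex (nat (p + q)) X s
     then m (f (front_face (nat p) s)) (g (back_face (nat p) (nat q) s)) else 0)"

lemma cochain_cup_eq_cup: "cochain_cup p q X = cup (\<lambda>x n. circle_scale n x) p q X"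
  by (simp add: cochain_cup_def cup_def fun_eq_iff)

lemma biadditive_circle_scale: "biadditive (\<lambda>x n. circle_scale n x)"
  by (simp add: biadditive_def circle_scale_add circle_scale_add_left)

lemma cup_in_cochains: "cup m p q X f g \<in> cochains (p + q) X"
  by (auto simp: cochains_def cup_def)

lemma cup_add_left: "biadditive m \<Longrightarrow> cup m p q X (\<lambda>s. f s + f' s) g = (\<lambda>s. cup m p q X f g s + cup m p q X f' g s)"
  by (auto simp: cup_def biadditive_def)

lemma cup_add_right: "biadditive m \<Longrightarrow> cup m p q X f (\<lambda>s. g s + g' s) = (\<lambda>s. cup m p q X f g s + cup m p q X f g' s)"
  by (auto simp: cup_def biadditive_def)

lemma cup_zero_left: "biadditive m \<Longrightarrow> cup m p q X (\<lambda>s. 0) g = (\<lambda>s. 0)"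
  by (simp add: cup_def biadditive_zero_left[of m] fun_eq_iff)

lemma cup_zero_right: "biadditive m \<Longrightarrow> cup m p q X f (\<lambda>s. 0) = (\<lambda>s. 0)"
  by (simp add: cup_def biadditive_zero_right[of m] fun_eq_iff)

lemma cup_leibniz:
  assumes m: "biadditive m"
  shows "coboundary (p + q) X (cup m p q X f g) = (\<lambda>s. cup m (p + 1) q X (coboundary p X f) g s
    + alt (nat p) (cup m p (q + 1) X f (coboundary q X g) s))"
proof
  fix s
  consider "p < 0" | "q < 0" | "0 \<le> p" "0 \<le> q" "singular_simplex (nat (p + q + 1)) X s"
    | "0 \<le> p" "0 \<le> q" "\<not> singular_simplex (nat (p + q + 1)) X s" by linarith
  then show "coboundary (p + q) X (cup m p q X f g) s = cup m (p + 1) q X (coboundary p X f) g s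
    + alt (nat p) (cup m p (q + 1) X f (coboundary q X g) s)"
  proof cases
    \<comment> \<open>The delicate value is \<open>p = - 1\<close>: the first product on the right
      then lies in degree \<open>p + 1 = 0\<close> for its first factor and is not zero by
      convention, but this factor is a coboundary from degree -1 and vanishes.\<close>
    case 1
    then have "cup m p q X f g = (\<lambda>s. 0)" by (auto simp: cup_def)
    then show ?thesis using 1 m by (simp add: coboundary_negative coboundary_zero cup_zero_left alt_def) (simp add: cup_def)
  next
    case 2
    then have "cup m p q X f g = (\<lambda>s. 0)" by (auto simp: cup_def)
    then show ?thesis using 2 m by (simp add: coboundary_negative coboundary_zero cup_zero_right alt_def) (simp add: cup_def)
  next
    case 3
    then obtain a b where ab: "p = int a" "q = int b" using zero_le_imp_eq_int by blast
    have n: "nat (int a + int b) = a + b" "nat (int a + int b + 1) = Suc (a + b)" "nat (int a + 1) = Suc a"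
      "nat (int b + 1) = Suc b" "nat (int a + 1 + int b) = Suc (a + b)" "nat (int a + (int b + 1)) = Suc (a + b)" by auto
    have s: "singular_simplex (Suc (a + b)) X s" using 3 by (simp add: ab n)
    have face: "cup m p q X f g (vface (a + b) (skip k) s)
      = m (f (vface a (skip k) s)) (g (vface b (\<lambda>j. skip k (j + a)) s))" if "k \<le> Suc (a + b)" for k
    proof -
      have "singular_simplex (a + b) X (vface (a + b) (skip k) s)"
        using s that by (rule_tac singular_simplex_vface) (auto simp: skip_def)
      moreover have "vface a (\<lambda>j. j) (vface (a + b) (skip k) s) = vface a (skip k) s"
        by (subst vface_vface) (auto simp: comp_def)
      moreover have "vface b (\<lambda>j. j + a) (vface (a + b) (skip k) s) = vface b (\<lambda>j. skip k (j + a)) s"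
        by (subst vface_vface) (auto simp: comp_def)
      ultimately show ?thesis by (simp add: cup_def ab n front_face_eq_vface back_face_eq_vface)
    qed
    have "coboundary (p + q) X (cup m p q X f g) s
       = (\<Sum>k\<le>Suc (a + b). alt k (m (f (vface a (skip k) s)) (g (vface b (\<lambda>j. skip k (j + a)) s))))"
      using coboundary_eq_vface[OF s, of "cup m p q X f g"]
      by (simp only: ab of_nat_add, intro sum.cong refl) (simp add: face[unfolded ab])
    also have "\<dots> = m (\<Sum>k\<le>Suc a. alt k (f (vface a (skip k) s))) (g (vface b (\<lambda>j. j + a + 1) s)) +
      alt a (m (f (vface a (\<lambda>j. j) s)) (\<Sum>k\<le>Suc b. alt k (g (vface b (\<lambda>j. skip k j + a) s))))"
    proof -
      have "(\<Sum>k\<le>a + b + 1. alt k (m (f (vface a (skip k) s)) (g (vface b (\<lambda>j. skip k (j + a)) s))))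
        = m (\<Sum>k\<le>a + 1. alt k (f (vface a (skip k) s))) (g (vface b (\<lambda>j. j + a + 1) s)) +
      alt a (m (f (vface a (\<lambda>j. j) s)) (\<Sum>k\<le>b + 1. alt k (g (vface b (\<lambda>j. skip k j + a) s))))"
        using m by (intro leibniz_faces[where F = "\<lambda>\<alpha>. f (vface a \<alpha> s)" and G = "\<lambda>\<alpha>. g (vface b \<alpha> s)"])
          (auto simp: biadditive_def intro!: arg_cong[where f=f] arg_cong[where f=g] vface_cong)
      then show ?thesis by (simp del: sum.atMost_Suc)
    qed
    also have "(\<Sum>k\<le>Suc a. alt k (f (vface a (skip k) s))) = coboundary p X f (front_face (Suc a) s)"
    proof -
      have "singular_simplex (Suc a) X (vface (Suc a) (\<lambda>j. j) s)" using s by (rule singular_simplex_vface) auto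
      moreover have "vface a (skip k) (vface (Suc a) (\<lambda>j. j) s) = vface a (skip k) s" if "k \<le> Suc a" for k
      proof -
        have "skip k j \<le> Suc a" if "j \<le> a" for j using that by (simp add: skip_def)
        then show ?thesis by (subst vface_vface) (simp_all add: comp_def)
      qed
      ultimately show ?thesis unfolding ab front_face_eq_vface by (subst coboundary_eq_vface) (auto intro!: sum.cong)
    qed
    also have "(\<Sum>k\<le>Suc b. alt k (g (vface b (\<lambda>j. skip k j + a) s))) = coboundary q X g (back_face a (Suc b) s)"
    proof -
      have "singular_simplex (Suc b) X (vface (Suc b) (\<lambda>j. j + a) s)" using s by (rule singular_simplex_vface) auto
      moreover have "vface b (skip k) (vface (Suc b) (\<lambda>j. j + a) s) = vface b (\<lambda>j. skip k j + a) s" if "k \<le> Suc b" for k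
        by (subst vface_vface) (use that in \<open>auto simp: comp_def skip_def\<close>)
      ultimately show ?thesis unfolding ab back_face_eq_vface by (subst coboundary_eq_vface) (auto intro!: sum.cong)
    qed
    finally show ?thesis using s by (simp add: cup_def ab n back_face_eq_vface front_face_eq_vface)
  next
    case 4
    then have "\<not> singular_simplex (nat (p + 1 + q)) X s" "\<not> singular_simplex (nat (p + (q + 1))) X s"
      by (simp_all add: algebra_simps)
    then show ?thesis using 4 by (simp add: coboundary_outside cup_def alt_def)
  qed
qed

lemma cochain_cup_cocycle:
  assumes "f \<in> carrier (cocycle_group p X)" "g \<in> carrier (cocycle_group q X)"
  shows "cochain_cup p q X f g \<in> carrier (cocycle_group (p + q) X)"
  using assms by (simp add: carrier_cocycle_group cochain_cup_eq_cup cup_in_cochains biadditive_circle_scale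
      cup_leibniz cup_zero_left cup_zero_right alt_def)

text \<open>Replace \<open>f\<close> by \<open>f + \<delta> h\<close> and then \<open>g\<close> by
  \<open>g + \<delta> c\<close>. As \<open>f\<close> and the new \<open>g\<close> are cocycles, the
  Leibniz rule presents the change of the product as the coboundary of \<open>h \<union> g'\<close>
  plus, up to sign, \<open>f \<union> c\<close>.\<close>

lemma cohom_cup_cclass:
  assumes f: "f \<in> carrier (cocycle_group p X)" and g: "g \<in> carrier (cocycle_group q X)"
  shows "cohom_cup p q X (cclass p X f) (cclass q X g) = cclass (p + q) X (cochain_cup p q X f g)"
  unfolding cohom_cup_def
proof (rule cohom_class_eq)
  let ?c = "cup (\<lambda>x n. circle_scale n x)"
  note b = biadditive_circle_scale
  show "{cochain_cup p q X f' g' |f' g'. f' \<in> cclass p X f \<and> g' \<in> cclass q X g} \<subseteq> cclass (p + q) X (cochain_cup p q X f g)"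
  proof clarify
    fix f' g' assume f': "f' \<in> cclass p X f" and g': "g' \<in> cclass q X g"
    obtain h where h: "h \<in> cochains (p - 1) X" "f' = (\<lambda>s. f s + coboundary (p - 1) X h s)"
      using f' by (auto simp: mem_cclass)
    obtain c where c: "c \<in> cochains (q - 1) X" "g' = (\<lambda>s. g s + coboundary (q - 1) X c s)"
      using g' by (auto simp: mem_cclass)
    have dg': "coboundary q X g' = (\<lambda>s. 0)" using cclass_eq(2)[OF g g'] by (simp add: carrier_cocycle_group)
    have df: "coboundary p X f = (\<lambda>s. 0)" using f by (simp add: carrier_cocycle_group)
    have 1: "?c p q X (coboundary (p - 1) X h) g' = coboundary (p + q - 1) X (?c (p - 1) q X h g')"
      using cup_leibniz[OF b, of "p - 1" q X h g'] by (simp add: dg' cup_zero_right[OF b] alt_def algebra_simps)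
    have 2: "?c p q X f (coboundary (q - 1) X c) = coboundary (p + q - 1) X (\<lambda>s. alt (nat p) (?c p (q - 1) X f c s))"
    proof -
      have d: "coboundary (p + q - 1) X (?c p (q - 1) X f c) = (\<lambda>s. alt (nat p) (?c p q X f (coboundary (q - 1) X c) s))"
        using cup_leibniz[OF b, of p "q - 1" X f c] by (simp add: df cup_zero_left[OF b] algebra_simps)
      have "coboundary (p + q - 1) X (\<lambda>s. alt (nat p) (?c p (q - 1) X f c s))
         = (\<lambda>s. alt (nat p) (alt (nat p) (?c p q X f (coboundary (q - 1) X c) s)))"
        by (subst coboundary_hom) (simp_all add: alt_add d)
      also have "\<dots> = ?c p q X f (coboundary (q - 1) X c)" by (auto simp: alt_def)
      finally show ?thesis by (rule sym)
    qed
    have "cochain_cup p q X f' g' = (\<lambda>s. cochain_cup p q X f g s +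
      coboundary (p + q - 1) X (\<lambda>s. ?c (p - 1) q X h g' s + alt (nat p) (?c p (q - 1) X f c s)) s)"
    proof -
      have e1: "?c p q X f' g' = (\<lambda>s. ?c p q X f g' s + ?c p q X (coboundary (p - 1) X h) g' s)"
        unfolding h(2) by (rule cup_add_left[OF b])
      have e2: "?c p q X f g' = (\<lambda>s. ?c p q X f g s + ?c p q X f (coboundary (q - 1) X c) s)"
        unfolding c(2) by (rule cup_add_right[OF b])
      have "x = y + z \<Longrightarrow> y = u + v \<Longrightarrow> x = u + (z + v)" for x y z u v :: circle by (simp add: add_ac)
      from this[OF fun_cong[OF e1] fun_cong[OF e2]] show ?thesis
        unfolding cochain_cup_eq_cup coboundary_add 1[symmetric] 2[symmetric] by (rule ext)
    qed
    moreover have "(\<lambda>s. ?c (p - 1) q X h g' s + alt (nat p) (?c p (q - 1) X f c s)) \<in> cochains (p + q - 1) X"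
    proof (rule cochains_add)
      show "?c (p - 1) q X h g' \<in> cochains (p + q - 1) X"
        using cup_in_cochains[of "\<lambda>x n. circle_scale n x" "p - 1" q X h g'] by (simp add: algebra_simps)
      have "?c p (q - 1) X f c \<in> cochains (p + q - 1) X"
        using cup_in_cochains[of "\<lambda>x n. circle_scale n x" p "q - 1" X f c] by (simp add: algebra_simps)
      then show "(\<lambda>s. alt (nat p) (?c p (q - 1) X f c s)) \<in> cochains (p + q - 1) X"
        by (rule cochains_map) (simp add: alt_def)
    qed
    ultimately show "cochain_cup p q X f' g' \<in> cclass (p + q) X (cochain_cup p q X f g)"
      unfolding mem_cclass by blast
  qed
  show "{cochain_cup p q X f' g' |f' g'. f' \<in> cclass p X f \<and> g' \<in> cclass q X g} \<noteq> {}"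
    using cclass_self[of f p X] cclass_self[of g q X] by auto
qed (rule cochain_cup_cocycle[OF f g])

section \<open>The torsion linking pairing\<close>

abbreviation rcup :: "int \<Rightarrow> int \<Rightarrow> 'a topology \<Rightarrow> ('a ssimplex \<Rightarrow> real) \<Rightarrow> ('a ssimplex \<Rightarrow> int) \<Rightarrow> 'a ssimplex \<Rightarrow> real" where
  "rcup \<equiv> cup (\<lambda>x n. x * of_int n)"

lemma biadditive_mult: "biadditive (\<lambda>x y. x * (y :: real))"
  by (simp add: biadditive_def algebra_simps)

lemma biadditive_rmult: "biadditive (\<lambda>(x :: real) n. x * of_int n)"
  by (simp add: biadditive_def algebra_simps)

lemma cochain_cup_to_circle: "cochain_cup p q X (\<lambda>s. to_circle (r s)) b = (\<lambda>s. to_circle (rcup p q X r b s))"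
  by (auto simp: cochain_cup_def cup_def circle_scale_to_circle mult.commute to_circle_zero)

text \<open>Exhibits that the torsion class \<open>u\<close> vanishes over \<open>\<real>\<close>; the sign is that of the Bockstein map.\<close>

definition real_primitive :: "int \<Rightarrow> 'a topology \<Rightarrow> ('a ssimplex \<Rightarrow> int) set \<Rightarrow> ('a ssimplex \<Rightarrow> int) \<Rightarrow> ('a ssimplex \<Rightarrow> real) \<Rightarrow> bool" where
  "real_primitive p X u b r \<longleftrightarrow> u \<in> carrier (cohomology_group p X) \<and> b \<in> u \<and> r \<in> cochains (p - 1) X \<and>
     (\<lambda>s. of_int (b s)) = (\<lambda>s. - coboundary (p - 1) X r s)"

lemma real_primitive_cocycle: "real_primitive p X u b r \<Longrightarrow> b \<in> carrier (cocycle_group p X)"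
  using cohomology_rep(1) by (auto simp: real_primitive_def)

lemma real_primitive_exists:
  assumes "u \<in> carrier (torsion_cohomology p X)"
  obtains b r where "real_primitive p (subtopology X S) (cohom_pullback p (subtopology X S) id u) b r"
proof -
  let ?Y = "subtopology X S"
  obtain f n c where f: "f \<in> carrier (cocycle_group p X)" "u = cclass p X f" and n: "n > (0::nat)"
    and c: "c \<in> cochains (p - 1) X" "\<And>s. int n * f s = coboundary (p - 1) X c s"
    using torsion_rep[OF assms] by metis
  define b where "b = cochain_pullback p ?Y id f"
  define d where "d = cochain_pullback (p - 1) ?Y id c"
  have d: "coboundary (p - 1) ?Y d = (\<lambda>s. int n * b s)"
    using coboundary_pullback_id[of "p - 1" X S c] c(2)[symmetric] by (auto simp: d_def b_def cochain_pullback_def)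
  \<comment> \<open>The coboundary of \<open>d\<close> is \<open>n b\<close>, so division by
    \<open>n\<close> gives a real primitive. The minus sign is the one in
    \<open>bockstein\<close>.\<close>
  define r where "r s = (- 1 / real n) * of_int (d s)" for s
  have "real_primitive p ?Y (cohom_pullback p ?Y id u) b r" unfolding real_primitive_def
  proof (intro conjI)
    have b: "b \<in> carrier (cocycle_group p ?Y)" unfolding b_def by (rule cochain_pullback_cocycle[OF f(1)])
    have u: "cohom_pullback p ?Y id u = cclass p ?Y b" unfolding b_def f(2) by (rule cohom_pullback_cclass[OF f(1)])
    show "cohom_pullback p ?Y id u \<in> carrier (cohomology_group p ?Y)" using b u by (auto simp: carrier_cohomology_group)
    show "b \<in> cohom_pullback p ?Y id u" using cclass_self u by blast
    have "d \<in> cochains (p - 1) ?Y" unfolding d_def by (rule cochain_pullback_in_cochains)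
    then show "r \<in> cochains (p - 1) ?Y" unfolding r_def[abs_def]
      by (rule cochains_map[where h = "\<lambda>x. (- 1 / real n) * of_int x"]) simp
    have "coboundary (p - 1) ?Y r = (\<lambda>s. (- 1 / real n) * of_int (coboundary (p - 1) ?Y d s))"
      unfolding r_def[abs_def]
      by (rule coboundary_hom[where h = "\<lambda>x. (- 1 / real n) * of_int x"]) (simp add: algebra_simps add_divide_distrib)
    then show "(\<lambda>s. of_int (b s)) = (\<lambda>s. - coboundary (p - 1) ?Y r s)" using n by (simp add: d)
  qed
  then show ?thesis using that by blast
qed

text \<open>Representatives and primitives add, which reduces biadditivity of the linking pairing to
  that of the cup product.\<close>

lemma real_primitive_mult:
  assumes u: "u \<in> carrier (torsion_cohomology p X)" and v: "v \<in> carrier (torsion_cohomology p X)"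
    and a: "real_primitive p (subtopology X S) (cohom_pullback p (subtopology X S) id u) a r"
    and b: "real_primitive p (subtopology X S) (cohom_pullback p (subtopology X S) id v) b t"
  shows "real_primitive p (subtopology X S) (cohom_pullback p (subtopology X S) id (u \<otimes>\<^bsub>torsion_cohomology p X\<^esub> v))
    (\<lambda>s. a s + b s) (\<lambda>s. r s + t s)"
proof -
  let ?Y = "subtopology X S" and ?H = "cohomology_group p (subtopology X S) :: ('a ssimplex \<Rightarrow> int) set monoid"
  obtain f where f: "f \<in> carrier (cocycle_group p X)" "u = cclass p X f" using torsion_rep[OF u] by metis
  obtain g where g: "g \<in> carrier (cocycle_group p X)" "v = cclass p X g" using torsion_rep[OF v] by metis
  have "u \<otimes>\<^bsub>torsion_cohomology p X\<^esub> v = cclass p X (\<lambda>s. f s + g s)"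
    using cclass_mult[OF f(1) g(1)] by (simp add: torsion_cohomology_def f g)
  moreover have "(\<lambda>s. f s + g s) \<in> carrier (cocycle_group p X)"
    using f g by (simp add: carrier_cocycle_group cochains_add coboundary_add)
  moreover have "cochain_pullback p ?Y id (\<lambda>s. f s + g s) = (\<lambda>s. cochain_pullback p ?Y id f s + cochain_pullback p ?Y id g s)"
    by (auto simp: cochain_pullback_def)
  ultimately have uv: "cohom_pullback p ?Y id (u \<otimes>\<^bsub>torsion_cohomology p X\<^esub> v)
    = cohom_pullback p ?Y id u \<otimes>\<^bsub>?H\<^esub> cohom_pullback p ?Y id v"
    by (simp add: cohom_pullback_cclass f g cclass_mult cochain_pullback_cocycle)
  have ua: "cohom_pullback p ?Y id u = cclass p ?Y a" "a \<in> carrier (cocycle_group p ?Y)"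
    and vb: "cohom_pullback p ?Y id v = cclass p ?Y b" "b \<in> carrier (cocycle_group p ?Y)"
    using a b cohomology_rep unfolding real_primitive_def by blast+
  have "cohom_pullback p ?Y id u \<otimes>\<^bsub>?H\<^esub> cohom_pullback p ?Y id v = cclass p ?Y (\<lambda>s. a s + b s)"
    unfolding ua vb by (rule cclass_mult[OF ua(2) vb(2)])
  moreover have "(\<lambda>s. a s + b s) \<in> carrier (cocycle_group p ?Y)"
    using ua vb by (simp add: carrier_cocycle_group cochains_add coboundary_add)
  ultimately have "cohom_pullback p ?Y id (u \<otimes>\<^bsub>torsion_cohomology p X\<^esub> v) \<in> carrier ?H"
    "(\<lambda>s. a s + b s) \<in> cohom_pullback p ?Y id (u \<otimes>\<^bsub>torsion_cohomology p X\<^esub> v)"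
    by (simp_all add: uv carrier_cohomology_group cclass_self)
  then show ?thesis using a b unfolding real_primitive_def
    by (auto simp: cochains_add coboundary_add fun_eq_iff)
qed

text \<open>Lifts of cohomologous circle cocycles differ by a real coboundary and an integral
  cochain \<open>c\<close>. The first disappears under another coboundary, the second changes
  \<open>b\<close> by an integral coboundary. Hence all cocycles obtained lie in one class, and
  subtracting suitable \<open>c\<close> from \<open>r\<close> reaches every member of it.\<close>

lemma bockstein_eq:
  assumes "real_primitive p X u b r"
  shows "(\<lambda>s. to_circle (r s)) \<in> carrier (cocycle_group (p - 1) X)"
    "bockstein p X (cclass (p - 1) X (\<lambda>s. to_circle (r s))) = u"
proof -
  have r: "r \<in> cochains (p - 1) X" and br: "\<And>s. of_int (b s) = - coboundary (p - 1) X r s"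
    using assms by (auto simp: real_primitive_def fun_eq_iff)
  have u: "u \<in> carrier (cohomology_group p X)" "b \<in> u" using assms by (auto simp: real_primitive_def)
  note ub = cohomology_rep[OF u]
  have "coboundary (p - 1) X r s = of_int (- b s)" for s using br[of s] by simp
  then have "to_circle (coboundary (p - 1) X r s) = 0" for s
    unfolding to_circle_eq_zero by (metis Ints_of_int)
  then show z: "(\<lambda>s. to_circle (r s)) \<in> carrier (cocycle_group (p - 1) X)"
    using r by (auto simp: carrier_cocycle_group coboundary_hom to_circle_add to_circle_zero intro: cochains_map)
  show "bockstein p X (cclass (p - 1) X (\<lambda>s. to_circle (r s))) = u"
  proof (rule Set.set_eqI, rule iffI)
    fix b1 assume "b1 \<in> bockstein p X (cclass (p - 1) X (\<lambda>s. to_circle (r s)))"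
    then obtain r1 where r1: "r1 \<in> cochains (p - 1) X" "(\<lambda>s. to_circle (r1 s)) \<in> cclass (p - 1) X (\<lambda>s. to_circle (r s))"
      "\<And>s. of_int (b1 s) = - coboundary (p - 1) X r1 s"
      by (auto simp: bockstein_def comp_def)
    obtain h where h: "h \<in> cochains (p - 2) X" "\<And>s. to_circle (r1 s) = to_circle (r s) + coboundary (p - 2) X h s"
      using r1(2) by (auto simp: mem_cclass fun_eq_iff)
    obtain hr where hr: "h = (\<lambda>s. to_circle (hr s))" by (rule circle_cochain_lift)
    have "to_circle (r1 s - r s - coboundary (p - 2) X hr s) = 0" for s
    proof -
      have "to_circle (r1 s) = to_circle (r s + coboundary (p - 2) X hr s)"
        using h(2)[of s] by (simp add: hr coboundary_hom to_circle_add)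
      moreover have "to_circle (r1 s) = to_circle (r1 s - r s - coboundary (p - 2) X hr s) + to_circle (r s + coboundary (p - 2) X hr s)"
        by (simp flip: to_circle_add)
      ultimately show ?thesis by simp
    qed
    then have "\<forall>s. \<exists>k. r1 s - r s - coboundary (p - 2) X hr s = of_int k"
      unfolding to_circle_eq_zero by (metis Ints_cases)
    then obtain c where c: "\<And>s. r1 s - r s - coboundary (p - 2) X hr s = of_int (c s)" by metis
    \<comment> \<open>The integral difference is a cochain because the three real functions it is
      made of vanish outside the simplices of degree \<open>p - 1\<close>.\<close>
    have "c \<in> cochains (p - 1) X"
    proof -
      have "coboundary (p - 2) X hr \<in> cochains (p - 1) X" using coboundary_in_cochains[of "p - 2" X hr] by simp
      then have "c s = 0" if "\<not> (0 \<le> p - 1 \<and> singular_simplex (nat (p - 1)) X s)" for s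
        using c[of s] r r1(1) that unfolding cochains_def by (smt (verit) mem_Collect_eq of_int_eq_0_iff)
      then show ?thesis by (auto simp: cochains_def)
    qed
    moreover have "b1 s = b s + coboundary (p - 1) X (\<lambda>s. - c s) s" for s
    proof -
      have "r1 = (\<lambda>s. (r s + coboundary (p - 2) X hr s) + of_int (c s))" using c by (auto simp: algebra_simps)
      then have "coboundary (p - 1) X r1 s = coboundary (p - 1) X r s + coboundary (p - 1) X (coboundary (p - 2) X hr) s
          + of_int (coboundary (p - 1) X c s)"
        by (simp add: coboundary_add coboundary_hom)
      then have "of_int (b1 s) = (of_int (b s - coboundary (p - 1) X c s) :: real)"
        using coboundary_coboundary[of "p - 2" X hr] by (simp add: r1(3) br)
      then show ?thesis unfolding of_int_eq_iff by (simp add: coboundary_uminus)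
    qed
    ultimately have "b1 \<in> cclass p X b" unfolding mem_cclass
      by (intro bexI[of _ "\<lambda>s. - c s"]) (auto intro: cochains_map)
    then show "b1 \<in> u" using ub by simp
  next
    fix b1 assume b1: "b1 \<in> u"
    then have "b1 \<in> cclass p X b" using ub by simp
    then obtain c where c: "c \<in> cochains (p - 1) X" "b1 = (\<lambda>s. b s + coboundary (p - 1) X c s)"
      by (auto simp: mem_cclass)
    \<comment> \<open>An integral shift is invisible in the circle and adds the coboundary of
      \<open>c\<close> to the cocycle that the lift determines.\<close>
    define r1 where "r1 s = r s + of_int (- c s)" for s
    have "to_circle \<circ> r1 = (\<lambda>s. to_circle (r s))"
    proof
      fix s
      have "to_circle (of_int (- c s)) = 0" unfolding to_circle_eq_zero by (rule Ints_of_int)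
      then show "(to_circle \<circ> r1) s = to_circle (r s)" unfolding r1_def comp_def to_circle_add by simp
    qed
    moreover have "r1 \<in> cochains (p - 1) X" unfolding r1_def[abs_def]
      by (intro cochains_add r cochains_map[OF c(1), where h = "\<lambda>x. of_int (- x)"]) simp
    moreover have "of_int (b1 s) = - coboundary (p - 1) X r1 s" for s
      unfolding r1_def[abs_def] coboundary_add
      by (subst coboundary_hom[where h = "\<lambda>x. of_int (- x)"]) (simp_all add: c br)
    ultimately show "b1 \<in> bockstein p X (cclass (p - 1) X (\<lambda>s. to_circle (r s)))"
      unfolding bockstein_def using cclass_self cohomology_rep(1)[OF u(1) b1]
      by (intro CollectI conjI bexI[of _ r1]) auto
  qed
qed

text \<open>The value depends only on the Bockstein image of the circle-valued class: two lifts differ by a real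
  cocycle \<open>w\<close>, and \<open>w \<union> b'\<close> is up to sign the coboundary of \<open>w \<union> r'\<close>.\<close>

lemma linking_well_defined:
  assumes u: "real_primitive p X u b r" and u': "real_primitive q X u' b' r'"
    and pq: "p + q = int N + 1" and \<xi>: "\<xi> \<in> carrier (homology_group (int N) X)" "z \<in> \<xi>"
  shows "(THE x. \<exists>v\<in>carrier (cohomology_group (p - 1) X). bockstein p X v = u \<and>
      x = kronecker (int N) X (cohom_cup (p - 1) q X v u') \<xi>) = to_circle (eval_chain (rcup (p - 1) q X r b') z)"
proof -
  have d: "p - 1 + q = int N" using pq by simp
  have u'c: "u' = cclass q X b'" "b' \<in> carrier (cocycle_group q X)"
    using u' cohomology_rep unfolding real_primitive_def by blast+
  have kron: "kronecker (int N) X (cohom_cup (p - 1) q X (cclass (p - 1) X (\<lambda>s. to_circle (r1 s))) u') \<xi>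
      = to_circle (eval_chain (rcup (p - 1) q X r1 b') z)"
    if r1: "(\<lambda>s. to_circle (r1 s)) \<in> carrier (cocycle_group (p - 1) X)" for r1
  proof (rule kronecker_eq[OF _ _ \<xi>])
    have c: "cohom_cup (p - 1) q X (cclass (p - 1) X (\<lambda>s. to_circle (r1 s))) u' =
      cclass (int N) X (\<lambda>s. to_circle (rcup (p - 1) q X r1 b' s))"
      using cohom_cup_cclass[OF r1 u'c(2)] by (simp add: u'c(1) d cochain_cup_to_circle)
    have "(\<lambda>s. to_circle (rcup (p - 1) q X r1 b' s)) \<in> carrier (cocycle_group (int N) X)"
      using cochain_cup_cocycle[OF r1 u'c(2)] by (simp add: d cochain_cup_to_circle)
    then show "cohom_cup (p - 1) q X (cclass (p - 1) X (\<lambda>s. to_circle (r1 s))) u' \<in> carrier (cohomology_group (int N) X)"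
      unfolding c carrier_cohomology_group by blast
    show "(\<lambda>s. to_circle (rcup (p - 1) q X r1 b' s)) \<in> cohom_cup (p - 1) q X (cclass (p - 1) X (\<lambda>s. to_circle (r1 s))) u'"
      unfolding c by (rule cclass_self)
  qed
  note B = bockstein_eq[OF u]
  show ?thesis
  proof (rule the_equality)
    show "\<exists>v\<in>carrier (cohomology_group (p - 1) X). bockstein p X v = u \<and>
        to_circle (eval_chain (rcup (p - 1) q X r b') z) = kronecker (int N) X (cohom_cup (p - 1) q X v u') \<xi>"
      using B kron[OF B(1)] by (intro bexI[of _ "cclass (p - 1) X (\<lambda>s. to_circle (r s))"])
        (auto simp: carrier_cohomology_group)
  next
    fix x assume "\<exists>v\<in>carrier (cohomology_group (p - 1) X). bockstein p X v = u \<and>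
      x = kronecker (int N) X (cohom_cup (p - 1) q X v u') \<xi>"
    then obtain v where v: "v \<in> carrier (cohomology_group (p - 1) X)" "bockstein p X v = u"
      and x: "x = kronecker (int N) X (cohom_cup (p - 1) q X v u') \<xi>" by blast
    \<comment> \<open>Asking for \<open>b\<close> itself, rather than some member of its class,
      yields a lift with coboundary exactly \<open>- b\<close>. Its difference from \<open>r\<close>
      is then a real cocycle.\<close>
    have "b \<in> bockstein p X v" using u v(2) by (simp add: real_primitive_def)
    then obtain r1 where r1: "r1 \<in> cochains (p - 1) X" "(\<lambda>s. to_circle (r1 s)) \<in> v"
      "\<And>s. of_int (b s) = - coboundary (p - 1) X r1 s"
      by (auto simp: bockstein_def comp_def)
    have x': "x = to_circle (eval_chain (rcup (p - 1) q X r1 b') z)"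
      using kron cohomology_rep[OF v(1) r1(2)] x by simp
    define w where "w s = r1 s - r s" for s
    have w: "coboundary (p - 1) X w = (\<lambda>s. 0)"
      using u r1(3) unfolding w_def[abs_def] coboundary_diff real_primitive_def by (simp add: fun_eq_iff)
    have b': "rcup (p - 1) q X w b' s = - 1 * cup (\<lambda>x y. x * y) (p - 1) q X w (coboundary (q - 1) X r') s" for s
      using u' by (simp add: real_primitive_def cup_def fun_eq_iff)
    have "coboundary (int N - 1) X (cup (\<lambda>x y. x * y) (p - 1) (q - 1) X w r')
      = (\<lambda>s. alt (nat (p - 1)) (cup (\<lambda>x y. x * y) (p - 1) q X w (coboundary (q - 1) X r') s))"
      using cup_leibniz[OF biadditive_mult, of "p - 1" "q - 1" X w r'] d
      by (simp add: w cup_zero_left[OF biadditive_mult] algebra_simps)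
    then have "eval_chain (\<lambda>s. alt (nat (p - 1)) (cup (\<lambda>x y. x * y) (p - 1) q X w (coboundary (q - 1) X r') s)) z = 0"
      using eval_coboundary_cycle[OF homology_classE(1)[OF \<xi>]] by metis
    then have "eval_chain (cup (\<lambda>x y. x * y) (p - 1) q X w (coboundary (q - 1) X r')) z = 0"
      by (simp add: alt_eq_mult eval_chain_fun_scale)
    then have "eval_chain (rcup (p - 1) q X w b') z = 0"
      unfolding b'[abs_def] by (simp only: eval_chain_fun_scale)
    moreover have "eval_chain (rcup (p - 1) q X r1 b') z = eval_chain (rcup (p - 1) q X r b') z + eval_chain (rcup (p - 1) q X w b') z"
    proof -
      have "r1 = (\<lambda>s. r s + w s)" by (simp add: w_def)
      then show ?thesis by (simp add: cup_add_left[OF biadditive_rmult] eval_chain_fun_add)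
    qed
    ultimately show "x = to_circle (eval_chain (rcup (p - 1) q X r b') z)" using x' by simp
  qed
qed

text \<open>Were \<open>g\<close> a cocycle, the two products would agree up to sign on cycles. Here
  its coboundary is the integral cochain \<open>e\<close>, and the coboundary of
  \<open>f \<union>\<^sub>1 g\<close> has the extra term \<open>f \<union>\<^sub>1 e\<close>, whose
  value on an integral cycle is an integer.\<close>

lemma cup_commutative:
  fixes f :: "'a ssimplex \<Rightarrow> int" and g :: "'a ssimplex \<Rightarrow> real" and e :: "'a ssimplex \<Rightarrow> int"
  assumes f: "coboundary (int p) X f = (\<lambda>s. 0)" and g: "coboundary (int q) X g = (\<lambda>s. of_int (e s))"
    and z: "singular_relcycle (p + q) X {} z" and p: "0 < p"
  shows "eval_chain (rcup (int q) (int p) X g f) z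
    - (- 1) ^ (p * q) * eval_chain (cup (\<lambda>n x. of_int n * x) (int p) (int q) X f g) z \<in> \<int>"
proof -
  let ?l = "rcup (int q) (int p) X g f" and ?r = "cup (\<lambda>n x. of_int n * x) (int p) (int q) X f g"
  \<comment> \<open>\<open>h\<close> is \<open>f \<union>\<^sub>1 g\<close>, and \<open>I\<close> is
    the same product with the coboundary of \<open>g\<close>. The degree of the second factor has
    grown by one, so the sign exponent \<open>(q + 1) j\<close> becomes \<open>(q + 2) j\<close>,
    that is \<open>q j\<close>.\<close>
  define h where "h t = (\<Sum>j<p. (- 1) ^ ((q + 1) * j) * of_int (f (vface p (vjoin j q) t)) * g (vface q (\<lambda>i. i + j) t))" for t
  define I where "I s = (\<Sum>j<p. (- 1) ^ (q * j) * of_int (f (vface p (vjoin j (q + 1)) s)) *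
    (\<Sum>k\<le>q + 1. (- 1) ^ k * g (vface q (\<lambda>i. skip k i + j) s)))" for s
  have key: "coboundary (int (p + q) - 1) X h s = (- 1) ^ q * (?l s - (- 1) ^ (p * q) * ?r s) + I s" and int: "I s \<in> \<int>"
    if "s \<in> Poly_Mapping.keys z" for s
  proof -
    have s: "singular_simplex (p + q) X s" using z that by (auto simp: singular_cycle singular_chain_def)
    have n: "nat (int p + int q) = p + q" by simp
    have dg: "(\<Sum>k\<le>q + 1. (- 1) ^ k * g (vface q (\<lambda>i. skip k i + j) s)) = of_int (e (vface (q + 1) (\<lambda>i. i + j) s))"
      if "j < p" for j
    proof -
      have "singular_simplex (Suc q) X (vface (q + 1) (\<lambda>i. i + j) s)"
        using s that by (simp only: Suc_eq_plus1, rule_tac singular_simplex_vface) auto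
      then have "of_int (e (vface (q + 1) (\<lambda>i. i + j) s)) = (\<Sum>k\<le>Suc q. alt k (g (vface q (skip k) (vface (q + 1) (\<lambda>i. i + j) s))))"
        using coboundary_eq_vface[of q X _ g] g by (simp add: fun_eq_iff)
      also have "\<dots> = (\<Sum>k\<le>q + 1. (- 1) ^ k * g (vface q (\<lambda>i. skip k i + j) s))"
      proof (simp only: Suc_eq_plus1, intro sum.cong refl)
        fix k assume "k \<in> {..q + 1}"
        have "vface q (skip k) (vface (q + 1) (\<lambda>i. i + j) s) = vface q ((\<lambda>i. i + j) \<circ> skip k) s"
          by (rule vface_vface) (simp add: skip_def)
        then show "alt k (g (vface q (skip k) (vface (q + 1) (\<lambda>i. i + j) s))) = (- 1) ^ k * g (vface q (\<lambda>i. skip k i + j) s)"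
          by (simp add: alt_eq_mult comp_def)
      qed
      finally show ?thesis by simp
    qed
    have "I s = (\<Sum>j<p. (- 1) ^ (q * j) * of_int (f (vface p (vjoin j (q + 1)) s)) * of_int (e (vface (q + 1) (\<lambda>i. i + j) s)))"
      unfolding I_def by (intro sum.cong refl) (simp only: dg lessThan_iff)
    then show "I s \<in> \<int>"
      by (simp only:) (intro Ints_sum Ints_mult Ints_of_int Ints_power Ints_minus Ints_1)
    have cocycle: "(\<Sum>k\<le>p + 1. (- 1) ^ k * of_int (f (vface p (vjoin j q \<circ> skip k) s))) = (0 :: real)" if "j \<le> p" for j
    proof -
      have "singular_simplex (Suc p) X (vface (Suc p) (vjoin j q) s)"
        using s by (rule singular_simplex_vface) (use that in \<open>auto simp: vjoin_def\<close>)
      then have "(\<Sum>k\<le>Suc p. alt k (f (vface p (skip k) (vface (Suc p) (vjoin j q) s)))) = 0"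
        using coboundary_eq_vface[of p X _ f] f by (simp add: fun_eq_iff)
      moreover have "vface p (skip k) (vface (Suc p) (vjoin j q) s) = vface p (vjoin j q \<circ> skip k) s" for k
        by (rule vface_vface) (simp add: skip_def)
      ultimately have "(\<Sum>k\<le>p + 1. alt k (f (vface p (vjoin j q \<circ> skip k) s))) = 0" by simp
      then have "(\<Sum>k\<le>p + 1. (- 1) ^ k * f (vface p (vjoin j q \<circ> skip k) s)) = 0" by (simp only: alt_eq_mult)
      then have "of_int (\<Sum>k\<le>p + 1. (- 1) ^ k * f (vface p (vjoin j q \<circ> skip k) s)) = (0 :: real)" by (simp only: of_int_0)
      then show ?thesis by (simp del: sum.atMost_Suc)
    qed
    obtain n where pq: "p + q = Suc n" using p by (metis add_is_0 gr0_implies_Suc less_irrefl neq0_conv)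
    have "coboundary (int (p + q) - 1) X h s = (\<Sum>k\<le>p + q. (- 1) ^ k * h (vface n (skip k) s))"
      using coboundary_eq_vface[of n X s h] s by (simp add: pq alt_eq_mult del: sum.atMost_Suc)
    also have "\<dots> = (\<Sum>k\<le>p + q. (- 1) ^ k * (\<Sum>j<p. (- 1) ^ ((q + 1) * j) *
        of_int (f (vface p (skip k \<circ> vjoin j q) s)) * g (vface q (\<lambda>i. skip k (i + j)) s)))"
    proof (intro sum.cong refl arg_cong2[where f = "(*)"])
      fix k
      have "vface p (vjoin j q) (vface n (skip k) s) = vface p (skip k \<circ> vjoin j q) s"
        "vface q (\<lambda>i. i + j) (vface n (skip k) s) = vface q (\<lambda>i. skip k (i + j)) s" if "j < p" for j
        using pq that by (subst vface_vface; auto simp: vjoin_def comp_def)+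
      then show "h (vface n (skip k) s) = (\<Sum>j<p. (- 1) ^ ((q + 1) * j) *
        of_int (f (vface p (skip k \<circ> vjoin j q) s)) * g (vface q (\<lambda>i. skip k (i + j)) s))"
        unfolding h_def by (intro sum.cong refl) simp
    qed
    also have "\<dots> = (- 1) ^ q * (of_int (f (vface p (\<lambda>i. i + q) s)) * g (vface q (\<lambda>i. i) s)
        - (- 1) ^ (p * q) * of_int (f (vface p (\<lambda>i. i) s)) * g (vface q (\<lambda>i. i + p) s)) + I s"
      unfolding I_def
      by (rule cup1_faces[where F = "\<lambda>\<alpha>. of_int (f (vface p \<alpha> s))" and G = "\<lambda>\<alpha>. g (vface q \<alpha> s)"])
        (use cocycle in \<open>auto intro: arg_cong[where f = f] arg_cong[where f = g] vface_cong simp del: sum.atMost_Suc\<close>)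
    also have "of_int (f (vface p (\<lambda>i. i + q) s)) * g (vface q (\<lambda>i. i) s) = ?l s"
      using s by (simp add: cup_def n front_face_eq_vface back_face_eq_vface add.commute)
    also have "(- 1) ^ (p * q) * of_int (f (vface p (\<lambda>i. i) s)) * g (vface q (\<lambda>i. i + p) s) = (- 1) ^ (p * q) * ?r s"
      using s by (simp add: cup_def n front_face_eq_vface back_face_eq_vface)
    finally show "coboundary (int (p + q) - 1) X h s = (- 1) ^ q * (?l s - (- 1) ^ (p * q) * ?r s) + I s" .
  qed
  have "eval_chain (coboundary (int (p + q) - 1) X h) z = 0" by (rule eval_coboundary_cycle[OF z])
  moreover have "eval_chain (coboundary (int (p + q) - 1) X h) z
     = eval_chain (\<lambda>s. (- 1) ^ q * (?l s + (- ((- 1) ^ (p * q))) * ?r s) + I s) z"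
    by (rule eval_chain_cong) (drule key, simp)
  moreover have "\<dots> = (- 1) ^ q * (eval_chain ?l z + (- ((- 1) ^ (p * q))) * eval_chain ?r z) + eval_chain I z"
    by (simp only: eval_chain_fun_add eval_chain_fun_scale)
  ultimately have "(- 1) ^ q * (eval_chain ?l z - (- 1) ^ (p * q) * eval_chain ?r z) = - eval_chain I z"
    by simp
  then have "eval_chain ?l z - (- 1) ^ (p * q) * eval_chain ?r z = - ((- 1) ^ q * eval_chain I z)"
    by (cases "even q") simp_all
  moreover have "eval_chain I z \<in> \<int>" by (rule eval_chain_Ints) (rule int)
  ultimately show ?thesis by (simp only:) (intro Ints_minus Ints_mult Ints_power Ints_1)
qed

text \<open>Outside the homology group the condition in \<open>kronecker\<close> is unsatisfiable,
  and its value is the unspecified but fixed element \<open>THE r. False\<close>, whatever the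
  cohomology class.\<close>

lemma linking_degenerate:
  fixes M :: "('a, 'm::{finite,linorder}) spacetime_data"
  assumes "fundamental_class M S \<notin> carrier (homology_group (int CARD('m) - 1) (subtopology (mtop M) S))"
  shows "linking M S p u u' = (THE r. False)"
proof -
  have k: "kronecker (int CARD('m) - 1) (subtopology (mtop M) S) v (fundamental_class M S) = (THE r. False)" for v
    unfolding kronecker_def using assms by simp
  show ?thesis
  proof (cases "\<exists>v\<in>carrier (cohomology_group (p - 1) (subtopology (mtop M) S)).
      bockstein p (subtopology (mtop M) S) v = cohom_pullback p (subtopology (mtop M) S) id u")
    case True
    then show ?thesis unfolding linking_def Let_def k by (intro the_equality) auto
  next
    \<comment> \<open>Without a preimage under the Bockstein map the outer description is
      unsatisfiable as well, and so denotes the same element.\<close>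
    case False
    then have "(\<lambda>r. \<exists>v\<in>carrier (cohomology_group (p - 1) (subtopology (mtop M) S)).
      bockstein p (subtopology (mtop M) S) v = cohom_pullback p (subtopology (mtop M) S) id u \<and>
      r = (THE r :: circle. False)) = (\<lambda>r. False)" by (intro ext) blast
    then show ?thesis unfolding linking_def Let_def k by (rule arg_cong)
  qed
qed

text \<open>With a cycle \<open>z\<close> in the fundamental class, linking numbers of torsion
  classes become evaluations of real cochains on \<open>z\<close>.\<close>

locale oriented_slice =
  fixes M :: "('a, 'm::{finite,linorder}) spacetime_data" and S :: "'a set" and z :: "'a chain"
  assumes fundamental: "fundamental_class M S \<in> carrier (homology_group (int CARD('m) - 1) (subtopology (mtop M) S))"
    and rep: "z \<in> fundamental_class M S"
begin

abbreviation Y :: "'a topology" where "Y \<equiv> subtopology (mtop M) S"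
abbreviation tors :: "int \<Rightarrow> ('a ssimplex \<Rightarrow> int) set monoid" where "tors p \<equiv> torsion_cohomology p (mtop M)"
abbreviation primitive :: "int \<Rightarrow> ('a ssimplex \<Rightarrow> int) set \<Rightarrow> ('a ssimplex \<Rightarrow> int) \<Rightarrow> ('a ssimplex \<Rightarrow> real) \<Rightarrow> bool"
  where "primitive p u \<equiv> real_primitive p Y (cohom_pullback p Y id u)"

lemma dim: "int CARD('m) - 1 = int (CARD('m) - 1)"
  using zero_less_card_finite[where 'a = 'm] by (simp add: of_nat_diff Suc_leI)

lemma z_cycle: "singular_relcycle (CARD('m) - 1) Y {} z"
  using homology_classE(1)[of _ "CARD('m) - 1"] fundamental rep unfolding dim by blast

lemma linking_eq:
  assumes "primitive p u b r" "primitive (int CARD('m) - p) u' b' r'"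
  shows "linking M S p u u' = to_circle (eval_chain (rcup (p - 1) (int CARD('m) - p) Y r b') z)"
proof -
  have "p + (int CARD('m) - p) = int (CARD('m) - 1) + 1" using dim by linarith
  from linking_well_defined[OF assms this fundamental[unfolded dim] rep] show ?thesis
    by (simp only: linking_def Let_def dim)
qed

lemma linking_mult_left:
  assumes u: "u \<in> carrier (tors p)" and v: "v \<in> carrier (tors p)" and w: "w \<in> carrier (tors (int CARD('m) - p))"
  shows "linking M S p (u \<otimes>\<^bsub>tors p\<^esub> v) w = linking M S p u w + linking M S p v w"
proof -
  obtain a r where a: "primitive p u a r" by (rule real_primitive_exists[OF u])
  obtain b t where b: "primitive p v b t" by (rule real_primitive_exists[OF v])
  obtain c x where c: "primitive (int CARD('m) - p) w c x" by (rule real_primitive_exists[OF w])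
  show ?thesis
    unfolding linking_eq[OF a c] linking_eq[OF b c] linking_eq[OF real_primitive_mult[OF u v a b] c]
    by (simp add: cup_add_left[OF biadditive_rmult] eval_chain_fun_add to_circle_add)
qed

lemma linking_mult_right:
  assumes u: "u \<in> carrier (tors (int CARD('m) - p))" and v: "v \<in> carrier (tors (int CARD('m) - p))" and w: "w \<in> carrier (tors p)"
  shows "linking M S p w (u \<otimes>\<^bsub>tors (int CARD('m) - p)\<^esub> v) = linking M S p w u + linking M S p w v"
proof -
  obtain a r where a: "primitive (int CARD('m) - p) u a r" by (rule real_primitive_exists[OF u])
  obtain b t where b: "primitive (int CARD('m) - p) v b t" by (rule real_primitive_exists[OF v])
  obtain c x where c: "primitive p w c x" by (rule real_primitive_exists[OF w])
  show ?thesis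
    unfolding linking_eq[OF c a] linking_eq[OF c b] linking_eq[OF c real_primitive_mult[OF u v a b]]
    by (simp add: cup_add_right[OF biadditive_rmult] eval_chain_fun_add to_circle_add)
qed

text \<open>Evaluating the coboundary of \<open>r \<union> t\<close> on the cycle gives
  \<open>b \<union> t = (-1)^k r \<union> c\<close>, because the coboundaries of \<open>r\<close>
  and \<open>t\<close> are \<open>- b\<close> and \<open>- c\<close>. Interchanging \<open>t\<close>
  and \<open>b\<close> by \<open>cup_commutative\<close> costs \<open>(-1)^(k q)\<close> and an
  integer. With \<open>q + 1 = m - k\<close> the exponents \<open>k q\<close> and \<open>k\<close>
  add up to \<open>k (m - k)\<close>.\<close>

lemma linking_commute:
  assumes k: "k \<le> CARD('m)" and u: "u \<in> carrier (tors (int k))" and w: "w \<in> carrier (tors (int CARD('m) - int k))"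
  shows "linking M S (int CARD('m) - int k) w u = alt (k * (CARD('m) - k)) (linking M S (int k) u w)"
proof -
  obtain b r where b: "primitive (int k) u b r" by (rule real_primitive_exists[OF u])
  obtain c t where c: "primitive (int CARD('m) - int k) w c t" by (rule real_primitive_exists[OF w])
  have br: "coboundary (int k - 1) Y r = (\<lambda>s. - of_int (b s))"
    and ct: "coboundary (int CARD('m) - int k - 1) Y t = (\<lambda>s. of_int (- c s))"
    using b c by (simp_all add: real_primitive_def fun_eq_iff)
  have cocycle: "coboundary (int k) Y b = (\<lambda>s. 0)"
    using real_primitive_cocycle[OF b] by (simp add: carrier_cocycle_group)
  have L1: "linking M S (int k) u w = to_circle (eval_chain (rcup (int k - 1) (int CARD('m) - int k) Y r c) z)"
    by (rule linking_eq[OF b c])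
  have L2: "linking M S (int CARD('m) - int k) w u = to_circle (eval_chain (rcup (int CARD('m) - int k - 1) (int k) Y t b) z)"
    using linking_eq[OF c, of u b r] b by simp
  consider "k = 0" | "k = CARD('m)" | "0 < k" "k < CARD('m)" using k by linarith
  then show ?thesis
  proof cases
    \<comment> \<open>A primitive of a class of degree 0 lives in degree -1, so the representative
      is zero and both pairings vanish. The case \<open>k = m\<close> is the same for the other
      class.\<close>
    case 1
    then have "b = (\<lambda>s. 0)" using br by (simp add: coboundary_negative fun_eq_iff)
    then show ?thesis unfolding L1 L2 using \<open>k = 0\<close>
      by (simp add: cup_zero_right[OF biadditive_rmult] alt_def) (simp add: cup_def)
  next
    case 2
    then have "c = (\<lambda>s. 0)" using ct by (simp add: coboundary_negative fun_eq_iff)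
    then show ?thesis unfolding L1 L2 using \<open>k = CARD('m)\<close>
      by (simp add: cup_zero_right[OF biadditive_rmult] alt_def) (simp add: cup_def)
  next
    case 3
    \<comment> \<open>\<open>q\<close> is the degree of the primitive \<open>t\<close>, and
      \<open>k + q\<close> the dimension of the slice.\<close>
    define q where "q = CARD('m) - k - 1"
    have q: "int CARD('m) - int k = int q + 1" "int CARD('m) - int k - 1 = int q" "CARD('m) - 1 = k + q" "CARD('m) - k = q + 1" "int k - 1 + 1 = int k"
      using 3 by (auto simp: q_def)
    have zc: "singular_relcycle (k + q) Y {} z" using z_cycle q(3) by simp
    let ?bt = "cup (\<lambda>n x. of_int n * x) (int k) (int q) Y b t"
    have A: "eval_chain (rcup (int q) (int k) Y t b) z - (- 1) ^ (k * q) * eval_chain ?bt z \<in> \<int>"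
      by (rule cup_commutative[OF cocycle ct[unfolded q(2)] zc 3(1)])
    have deg: "int (k + q) - 1 = int k - 1 + int q" by simp
    have "coboundary (int k - 1 + int q) Y (cup (\<lambda>x y. x * y) (int k - 1) (int q) Y r t)
      = (\<lambda>s. - 1 * ?bt s + (- ((- 1) ^ (k - 1))) * rcup (int k - 1) (int q + 1) Y r c s)"
    proof -
      have "nat (int k - 1) = k - 1" by auto
      moreover have "cup (\<lambda>x y. x * y) (int k) (int q) Y (\<lambda>s. - real_of_int (b s)) t = (\<lambda>s. - 1 * ?bt s)"
        by (auto simp: cup_def)
      moreover have "cup (\<lambda>x y. x * y) (int k - 1) (int q + 1) Y r (\<lambda>s. real_of_int (- c s)) = (\<lambda>s. - 1 * rcup (int k - 1) (int q + 1) Y r c s)"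
        by (auto simp: cup_def)
      ultimately show ?thesis
        using cup_leibniz[OF biadditive_mult, of "int k - 1" "int q" Y r t]
        unfolding br ct[unfolded q(2)] by (simp add: alt_eq_mult)
    qed
    then have "- 1 * eval_chain ?bt z + (- ((- 1) ^ (k - 1))) * eval_chain (rcup (int k - 1) (int q + 1) Y r c) z = 0"
      using eval_coboundary_cycle[OF zc, of "cup (\<lambda>x y. x * y) (int k - 1) (int q) Y r t"] unfolding deg
      by (simp only: eval_chain_fun_add eval_chain_fun_scale)
    then have B: "eval_chain ?bt z = (- 1) ^ k * eval_chain (rcup (int k - 1) (int q + 1) Y r c) z"
      using 3(1) by (cases k) auto
    have "eval_chain (rcup (int q) (int k) Y t b) z - alt (k * (CARD('m) - k)) (eval_chain (rcup (int k - 1) (int q + 1) Y r c) z) \<in> \<int>"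
      using A unfolding B alt_eq_mult q(4) by (simp add: power_add algebra_simps)
    then have "to_circle (eval_chain (rcup (int q) (int k) Y t b) z - alt (k * (CARD('m) - k)) (eval_chain (rcup (int k - 1) (int q + 1) Y r c) z)) = 0"
      by (simp only: to_circle_eq_zero)
    moreover have "to_circle (x - y) = to_circle x - to_circle y" for x y
      using to_circle_add[of x "- y"] by (simp add: to_circle_minus)
    moreover have "to_circle (alt n x) = alt n (to_circle x)" for n x by (simp add: alt_def to_circle_minus)
    ultimately show ?thesis unfolding L1 L2 unfolding q(1,2) by simp
  qed
qed

end

section \<open>Enveloping algebras\<close>

text \<open>The norm provides the bound that makes the supremum \<open>max_seminorm\<close> finite.
  Its nonnegativity makes zero a C*-seminorm, so the supremum is over a nonempty set.\<close>

locale normed_star_algebra = ring A for A :: "'b star_algebra" (structure) +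
  assumes smult_closed [simp, intro]: "x \<in> carrier A \<Longrightarrow> c \<odot> x \<in> carrier A"
    and smult_add_right: "x \<in> carrier A \<Longrightarrow> y \<in> carrier A \<Longrightarrow> c \<odot> (x \<oplus> y) = c \<odot> x \<oplus> c \<odot> y"
    and smult_add_left: "x \<in> carrier A \<Longrightarrow> (c + d) \<odot> x = c \<odot> x \<oplus> d \<odot> x"
    and smult_smult: "x \<in> carrier A \<Longrightarrow> c \<odot> (d \<odot> x) = (c * d) \<odot> x"
    and smult_one [simp]: "x \<in> carrier A \<Longrightarrow> 1 \<odot> x = x"
    and smult_mult_left: "x \<in> carrier A \<Longrightarrow> y \<in> carrier A \<Longrightarrow> (c \<odot> x) \<otimes> y = c \<odot> (x \<otimes> y)"
    and smult_mult_right: "x \<in> carrier A \<Longrightarrow> y \<in> carrier A \<Longrightarrow> x \<otimes> (c \<odot> y) = c \<odot> (x \<otimes> y)"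
    and star_closed [simp, intro]: "x \<in> carrier A \<Longrightarrow> star A x \<in> carrier A"
    and star_star [simp]: "x \<in> carrier A \<Longrightarrow> star A (star A x) = x"
    and star_mult: "x \<in> carrier A \<Longrightarrow> y \<in> carrier A \<Longrightarrow> star A (x \<otimes> y) = star A y \<otimes> star A x"
    and star_add: "x \<in> carrier A \<Longrightarrow> y \<in> carrier A \<Longrightarrow> star A (x \<oplus> y) = star A x \<oplus> star A y"
    and star_smult: "x \<in> carrier A \<Longrightarrow> star A (c \<odot> x) = cnj c \<odot> star A x"
    and nrm_nonneg: "x \<in> carrier A \<Longrightarrow> 0 \<le> nrm A x"
begin

section \<open>The largest C*-seminorm\<close>

abbreviation mx :: "'b \<Rightarrow> real" where "mx \<equiv> max_seminorm A"

lemma smult_zero: "x \<in> carrier A \<Longrightarrow> 0 \<odot> x = \<zero>"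
  using smult_add_left[of x 0 0] by (metis add.r_cancel_one' add_0 smult_closed)

lemma uminus_smult: "x \<in> carrier A \<Longrightarrow> \<ominus> x = (- 1) \<odot> x"
  using smult_add_left[of x 1 "- 1"] by (simp add: smult_zero minus_equality add.m_comm)

lemma minus_smult: "x \<in> carrier A \<Longrightarrow> y \<in> carrier A \<Longrightarrow> x \<ominus> y = x \<oplus> (- 1) \<odot> y"
  by (simp add: a_minus_def uminus_smult)

lemma cstar_seminormD:
  assumes "cstar_seminorm A \<rho>"
  shows "x \<in> carrier A \<Longrightarrow> 0 \<le> \<rho> x" "x \<in> carrier A \<Longrightarrow> \<rho> x \<le> nrm A x"
    "x \<in> carrier A \<Longrightarrow> \<rho> (star A x \<otimes> x) = (\<rho> x)\<^sup>2" "x \<in> carrier A \<Longrightarrow> \<rho> (c \<odot> x) = cmod c * \<rho> x"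
    "x \<in> carrier A \<Longrightarrow> y \<in> carrier A \<Longrightarrow> \<rho> (x \<oplus> y) \<le> \<rho> x + \<rho> y"
    "x \<in> carrier A \<Longrightarrow> y \<in> carrier A \<Longrightarrow> \<rho> (x \<otimes> y) \<le> \<rho> x * \<rho> y"
  using assms by (auto simp: cstar_seminorm_def)

lemma cstar_seminorm_zero: "cstar_seminorm A (\<lambda>x. 0)"
  by (simp add: cstar_seminorm_def nrm_nonneg)

lemma bdd_seminorms: "x \<in> carrier A \<Longrightarrow> bdd_above ((\<lambda>\<rho>. \<rho> x) ` Collect (cstar_seminorm A))"
  by (rule bdd_aboveI[of _ "nrm A x"]) (auto dest: cstar_seminormD(2))

lemma max_seminorm_upper: "cstar_seminorm A \<rho> \<Longrightarrow> x \<in> carrier A \<Longrightarrow> \<rho> x \<le> mx x"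
  unfolding max_seminorm_def by (rule cSUP_upper) (auto intro: bdd_seminorms)

lemma max_seminorm_least:
  "x \<in> carrier A \<Longrightarrow> (\<And>\<rho>. cstar_seminorm A \<rho> \<Longrightarrow> \<rho> x \<le> K) \<Longrightarrow> mx x \<le> K"
  unfolding max_seminorm_def by (rule cSUP_least) (use cstar_seminorm_zero in auto)

text \<open>Subadditivity and submultiplicativity are inherited by suprema of nonnegative functions.
  The C*-identity is inherited because squaring is increasing on nonnegative reals, so it commutes
  with the supremum.\<close>

lemma cstar_seminorm_max: "cstar_seminorm A mx"
proof -
  have nonneg: "0 \<le> mx x" if "x \<in> carrier A" for x
    using max_seminorm_upper[OF cstar_seminorm_zero that] by simp
  show ?thesis unfolding cstar_seminorm_def
  proof (intro ballI conjI allI)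
    fix x assume x: "x \<in> carrier A"
    show "0 \<le> mx x" by (rule nonneg[OF x])
    show "mx x \<le> nrm A x" by (rule max_seminorm_least[OF x]) (rule cstar_seminormD(2)[OF _ x])
    show "mx (star A x \<otimes> x) = (mx x)\<^sup>2"
    proof (rule antisym)
      show "mx (star A x \<otimes> x) \<le> (mx x)\<^sup>2"
      proof (rule max_seminorm_least)
        fix \<rho> assume \<rho>: "cstar_seminorm A \<rho>"
        show "\<rho> (star A x \<otimes> x) \<le> (mx x)\<^sup>2"
          unfolding cstar_seminormD(3)[OF \<rho> x]
          by (rule power_mono[OF max_seminorm_upper[OF \<rho> x] cstar_seminormD(1)[OF \<rho> x]])
      qed (use x in simp)
      have "mx x \<le> sqrt (mx (star A x \<otimes> x))"
      proof (rule max_seminorm_least[OF x])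
        fix \<rho> assume \<rho>: "cstar_seminorm A \<rho>"
        have "(\<rho> x)\<^sup>2 \<le> mx (star A x \<otimes> x)"
          using max_seminorm_upper[OF \<rho>, of "star A x \<otimes> x"] x by (simp add: cstar_seminormD(3)[OF \<rho> x])
        then show "\<rho> x \<le> sqrt (mx (star A x \<otimes> x))" by (rule real_le_rsqrt)
      qed
      then show "(mx x)\<^sup>2 \<le> mx (star A x \<otimes> x)"
        using nonneg[of "star A x \<otimes> x"] nonneg[OF x] x by (metis m_closed star_closed real_sqrt_le_iff real_sqrt_unique sqrt_le_D)
    qed
    show "mx (c \<odot> x) = cmod c * mx x" for c
    proof -
      have le: "mx (c \<odot> x) \<le> cmod c * mx x" if "x \<in> carrier A" for c x
      proof (rule max_seminorm_least)
        fix \<rho> assume \<rho>: "cstar_seminorm A \<rho>"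
        show "\<rho> (c \<odot> x) \<le> cmod c * mx x"
          unfolding cstar_seminormD(4)[OF \<rho> that] by (intro mult_left_mono max_seminorm_upper[OF \<rho> that]) simp
      qed (use that in simp)
      show ?thesis
      proof (cases "c = 0")
        case True
        then show ?thesis using le[OF x, of c] nonneg[of "c \<odot> x"] x by simp
      next
        case False
        \<comment> \<open>The reverse inequality is the one already proved, applied to the inverse
          of \<open>c\<close> and to \<open>c \<odot> x\<close>.\<close>
        have "mx x \<le> cmod (inverse c) * mx (c \<odot> x)"
          using le[of "c \<odot> x" "inverse c"] x False by (simp add: smult_smult)
        then have "cmod c * mx x \<le> mx (c \<odot> x)" using False by (simp add: norm_divide divide_simps mult.commute)
        then show ?thesis using le[OF x, of c] by simp
      qed
    qed
    fix y assume y: "y \<in> carrier A"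
    show "mx (x \<oplus> y) \<le> mx x + mx y"
    proof (rule max_seminorm_least)
      fix \<rho> assume \<rho>: "cstar_seminorm A \<rho>"
      show "\<rho> (x \<oplus> y) \<le> mx x + mx y"
        using cstar_seminormD(5)[OF \<rho> x y] max_seminorm_upper[OF \<rho> x] max_seminorm_upper[OF \<rho> y] by simp
    qed (use x y in simp)
    show "mx (x \<otimes> y) \<le> mx x * mx y"
    proof (rule max_seminorm_least)
      fix \<rho> assume \<rho>: "cstar_seminorm A \<rho>"
      have "\<rho> x * \<rho> y \<le> mx x * mx y"
        by (intro mult_mono max_seminorm_upper[OF \<rho>] x y nonneg cstar_seminormD(1)[OF \<rho>])
      then show "\<rho> (x \<otimes> y) \<le> mx x * mx y" using cstar_seminormD(6)[OF \<rho> x y] by simp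
    qed (use x y in simp)
  qed
qed

lemmas mxD = cstar_seminormD[OF cstar_seminorm_max]

text \<open>The C*-identity and submultiplicativity bound the square of \<open>\<rho> y\<close> by
  \<open>\<rho> (star A y) * \<rho> y\<close>. Cancel one factor and apply the result to
  \<open>star A x\<close> too.\<close>

lemma cstar_seminorm_star:
  assumes \<rho>: "cstar_seminorm A \<rho>" and x: "x \<in> carrier A"
  shows "\<rho> (star A x) = \<rho> x"
proof -
  have le: "\<rho> y \<le> \<rho> (star A y)" if y: "y \<in> carrier A" for y
  proof (cases "\<rho> y = 0")
    case True
    then show ?thesis using cstar_seminormD(1)[OF \<rho>, of "star A y"] y by simp
  next
    case False
    have "\<rho> y * \<rho> y \<le> \<rho> (star A y) * \<rho> y"
      using cstar_seminormD(3)[OF \<rho> y] cstar_seminormD(6)[OF \<rho> star_closed[OF y] y] by (simp add: power2_eq_square)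
    then show ?thesis using False cstar_seminormD(1)[OF \<rho> y] by simp
  qed
  show ?thesis using le[OF x] le[OF star_closed[OF x]] x by simp
qed

lemma mx_zero [simp]: "mx \<zero> = 0"
  using mxD(4)[OF zero_closed, of 0] by (simp add: smult_zero)

lemma mx_uminus: "x \<in> carrier A \<Longrightarrow> mx (\<ominus> x) = mx x"
  by (simp add: uminus_smult mxD(4))

lemma mx_minus_commute: "x \<in> carrier A \<Longrightarrow> y \<in> carrier A \<Longrightarrow> mx (x \<ominus> y) = mx (y \<ominus> x)"
  using mx_uminus[of "x \<ominus> y"] by (simp add: a_minus_def minus_add minus_minus a_comm)

lemma mx_triangle:
  assumes "x \<in> carrier A" "y \<in> carrier A" "w \<in> carrier A"
  shows "mx (x \<ominus> w) \<le> mx (x \<ominus> y) + mx (y \<ominus> w)"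
proof -
  have "x \<ominus> w = (x \<ominus> y) \<oplus> (y \<ominus> w)" using assms by (simp add: a_minus_def a_assoc r_neg2 l_neg r_neg1)
  then show ?thesis using mxD(5)[of "x \<ominus> y" "y \<ominus> w"] assms by simp
qed

lemma mx_diff_le: "x \<in> carrier A \<Longrightarrow> y \<in> carrier A \<Longrightarrow> \<bar>mx x - mx y\<bar> \<le> mx (x \<ominus> y)"
  using mx_triangle[of x y \<zero>] mx_triangle[of y x \<zero>] mx_minus_commute[of x y]
  by (simp add: a_minus_def)

section \<open>Cauchy sequences and null sequences\<close>

definition null :: "(nat \<Rightarrow> 'b) \<Rightarrow> bool" where
  "null d \<longleftrightarrow> (\<lambda>i. mx (d i)) \<longlonglongrightarrow> 0"

lemma nullI: "(\<And>i. d i \<in> carrier A) \<Longrightarrow> (\<And>i. mx (d i) \<le> e i) \<Longrightarrow> e \<longlonglongrightarrow> 0 \<Longrightarrow> null d"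
  unfolding null_def by (rule tendsto_sandwich[of "\<lambda>i. 0"]) (auto simp: mxD(1))

lemma cauchy_carrier: "a \<in> cauchy_seqs A \<Longrightarrow> a i \<in> carrier A"
  by (auto simp: cauchy_seqs_def)

lemma cauchy_Cauchy:
  assumes "a \<in> cauchy_seqs A" shows "convergent (\<lambda>i. mx (a i))"
proof -
  have "Cauchy (\<lambda>i. mx (a i))" unfolding Cauchy_def
  proof (intro allI impI)
    fix e :: real assume "e > 0"
    then obtain N where N: "\<forall>i\<ge>N. \<forall>j\<ge>N. mx (a i \<ominus> a j) < e"
      using assms unfolding cauchy_seqs_def max_dist_def by blast
    have "dist (mx (a i)) (mx (a j)) < e" if "i \<ge> N" "j \<ge> N" for i j
      using mx_diff_le[OF cauchy_carrier[OF assms] cauchy_carrier[OF assms], of i j] N that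
      by (auto simp: dist_real_def intro: le_less_trans)
    then show "\<exists>M. \<forall>m\<ge>M. \<forall>n\<ge>M. dist (mx (a m)) (mx (a n)) < e" by blast
  qed
  then show ?thesis by (simp add: Cauchy_convergent_iff)
qed

lemma cauchy_bounded:
  assumes "a \<in> cauchy_seqs A" obtains K where "K > 0" "\<And>i. mx (a i) \<le> K"
proof -
  have "Bseq (\<lambda>i. mx (a i))" using cauchy_Cauchy[OF assms] by (rule convergent_imp_Bseq)
  then obtain K where "K > 0" "\<And>i. norm (mx (a i)) \<le> K" by (auto simp: Bseq_def)
  then show ?thesis using that by (metis abs_le_D1 real_norm_def)
qed

text \<open>One criterion for all operations: differences are dominated by those of two Cauchy
  sequences. Unary operations use the same sequence twice.\<close>

lemma cauchy_seqsI:
  assumes "\<And>i. a i \<in> carrier A"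
    and "\<And>i j. mx (a i \<ominus> a j) \<le> K * mx (b i \<ominus> b j) + L * mx (c i \<ominus> c j)"
    and b: "b \<in> cauchy_seqs A" and c: "c \<in> cauchy_seqs A" and KL: "K > 0" "L > 0"
  shows "a \<in> cauchy_seqs A"
  unfolding cauchy_seqs_def max_dist_def
proof (intro CollectI conjI allI impI)
  fix e :: real assume e: "e > 0"
  obtain N where N: "\<And>i j. i \<ge> N \<Longrightarrow> j \<ge> N \<Longrightarrow> mx (b i \<ominus> b j) < e / (2 * K)"
    using b divide_pos_pos[OF e, of "2 * K"] KL unfolding cauchy_seqs_def max_dist_def by fastforce
  obtain N' where N': "\<And>i j. i \<ge> N' \<Longrightarrow> j \<ge> N' \<Longrightarrow> mx (c i \<ominus> c j) < e / (2 * L)"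
    using c divide_pos_pos[OF e, of "2 * L"] KL unfolding cauchy_seqs_def max_dist_def by fastforce
  have "mx (a i \<ominus> a j) < e" if "i \<ge> max N N'" "j \<ge> max N N'" for i j
  proof -
    have "K * mx (b i \<ominus> b j) < e / 2" "L * mx (c i \<ominus> c j) < e / 2"
      using N[of i j] N'[of i j] that KL by (simp_all add: field_simps)
    then show ?thesis using assms(2)[of i j] by linarith
  qed
  then show "\<exists>N. \<forall>i\<ge>N. \<forall>j\<ge>N. mx (a i \<ominus> a j) < e" by blast
qed (use assms(1) in auto)

lemma cauchy_const: "x \<in> carrier A \<Longrightarrow> (\<lambda>i. x) \<in> cauchy_seqs A"
  by (auto simp: cauchy_seqs_def max_dist_def a_minus_def r_neg)

lemma seq_class_self: "a \<in> cauchy_seqs A \<Longrightarrow> a \<in> seq_class A a"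
  by (auto simp: seq_class_def max_dist_def a_minus_def r_neg cauchy_carrier)

lemma mem_seq_class: "b \<in> seq_class A a \<longleftrightarrow> b \<in> cauchy_seqs A \<and> null (\<lambda>i. b i \<ominus> a i)"
  by (simp add: seq_class_def max_dist_def null_def)

lemma seq_class_eqI:
  assumes a: "a \<in> cauchy_seqs A" and b: "b \<in> cauchy_seqs A" and n: "null (\<lambda>i. a i \<ominus> b i)"
  shows "seq_class A a = seq_class A b"
proof -
  have sub: "seq_class A x \<subseteq> seq_class A y"
    if x: "x \<in> cauchy_seqs A" and y: "y \<in> cauchy_seqs A" and n: "null (\<lambda>i. x i \<ominus> y i)" for x y
  proof
    fix c assume c: "c \<in> seq_class A x"
    have "null (\<lambda>i. c i \<ominus> y i)"
    proof (rule nullI)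
      show "mx (c i \<ominus> y i) \<le> mx (c i \<ominus> x i) + mx (x i \<ominus> y i)" for i
        using c x y by (intro mx_triangle) (auto simp: mem_seq_class cauchy_carrier)
      show "(\<lambda>i. mx (c i \<ominus> x i) + mx (x i \<ominus> y i)) \<longlonglongrightarrow> 0"
        using c n unfolding mem_seq_class null_def by (auto intro: tendsto_add_zero)
    qed (use c y in \<open>auto simp: mem_seq_class cauchy_carrier\<close>)
    then show "c \<in> seq_class A y" using c by (simp add: mem_seq_class)
  qed
  have "null (\<lambda>i. b i \<ominus> a i)"
    using n mx_minus_commute[OF cauchy_carrier[OF a] cauchy_carrier[OF b]] by (simp add: null_def)
  then show ?thesis using sub[OF a b n] sub[OF b a] by blast
qed

lemma seq_class_eqD: "a \<in> cauchy_seqs A \<Longrightarrow> seq_class A a = seq_class A b \<Longrightarrow> null (\<lambda>i. a i \<ominus> b i)"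
  using seq_class_self mem_seq_class by blast

section \<open>The operations of the completion\<close>

lemma enveloping_carrierE:
  assumes "x \<in> carrier (enveloping A)"
  obtains a where "a \<in> cauchy_seqs A" "x = seq_class A a"
  using assms by (auto simp: enveloping_def)

lemma seq_class_carrier: "a \<in> cauchy_seqs A \<Longrightarrow> seq_class A a \<in> carrier (enveloping A)"
  by (simp add: enveloping_def)

lemma cauchy_add:
  assumes a: "a \<in> cauchy_seqs A" and b: "b \<in> cauchy_seqs A"
  shows "(\<lambda>i. a i \<oplus> b i) \<in> cauchy_seqs A"
proof (rule cauchy_seqsI[OF _ _ a b, of _ 1 1])
  fix i j
  note c = cauchy_carrier[OF a] cauchy_carrier[OF b]
  have "(a i \<oplus> b i) \<ominus> (a j \<oplus> b j) = (a i \<ominus> a j) \<oplus> (b i \<ominus> b j)"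
    using c by (simp add: a_minus_def minus_add a_ac)
  then show "mx ((a i \<oplus> b i) \<ominus> (a j \<oplus> b j)) \<le> 1 * mx (a i \<ominus> a j) + 1 * mx (b i \<ominus> b j)"
    using mxD(5)[of "a i \<ominus> a j" "b i \<ominus> b j"] c by simp
qed (use a b in \<open>auto simp: cauchy_carrier\<close>)

lemma cauchy_smult:
  assumes a: "a \<in> cauchy_seqs A"
  shows "(\<lambda>i. c \<odot> a i) \<in> cauchy_seqs A"
proof (rule cauchy_seqsI[OF _ _ a a, of _ "cmod c + 1" 1])
  fix i j
  note ca = cauchy_carrier[OF a]
  have "c \<odot> a i \<ominus> c \<odot> a j = c \<odot> (a i \<ominus> a j)"
    using ca by (simp add: minus_smult smult_add_right smult_smult mult.commute)
  then show "mx (c \<odot> a i \<ominus> c \<odot> a j) \<le> (cmod c + 1) * mx (a i \<ominus> a j) + 1 * mx (a i \<ominus> a j)"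
    using ca mxD(1)[of "a i \<ominus> a j"] by (simp add: mxD(4) algebra_simps)
qed (use a in \<open>auto simp: cauchy_carrier add_nonneg_pos\<close>)

lemma cauchy_star:
  assumes a: "a \<in> cauchy_seqs A"
  shows "(\<lambda>i. star A (a i)) \<in> cauchy_seqs A"
proof (rule cauchy_seqsI[OF _ _ a a, of _ 1 1])
  fix i j
  note ca = cauchy_carrier[OF a]
  have "star A (a i) \<ominus> star A (a j) = star A (a i \<ominus> a j)"
    using ca by (simp add: minus_smult star_add star_smult)
  then show "mx (star A (a i) \<ominus> star A (a j)) \<le> 1 * mx (a i \<ominus> a j) + 1 * mx (a i \<ominus> a j)"
    using ca mxD(1)[of "a i \<ominus> a j"] by (simp add: cstar_seminorm_star[OF cstar_seminorm_max])
qed (use a in \<open>auto simp: cauchy_carrier\<close>)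

lemma mult_minus_mult:
  assumes "x \<in> carrier A" "y \<in> carrier A" "u \<in> carrier A" "v \<in> carrier A"
  shows "x \<otimes> y \<ominus> u \<otimes> v = x \<otimes> (y \<ominus> v) \<oplus> (x \<ominus> u) \<otimes> v"
  using assms by (simp add: a_minus_def r_distr l_distr r_minus l_minus a_assoc r_neg1)

lemma mx_mult_minus_mult:
  assumes "x \<in> carrier A" "y \<in> carrier A" "u \<in> carrier A" "v \<in> carrier A"
  shows "mx (x \<otimes> y \<ominus> u \<otimes> v) \<le> mx x * mx (y \<ominus> v) + mx v * mx (x \<ominus> u)"
proof -
  have "mx (x \<otimes> y \<ominus> u \<otimes> v) \<le> mx (x \<otimes> (y \<ominus> v)) + mx ((x \<ominus> u) \<otimes> v)"
    unfolding mult_minus_mult[OF assms] using assms by (intro mxD(5)) auto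
  moreover have "mx (x \<otimes> (y \<ominus> v)) \<le> mx x * mx (y \<ominus> v)" "mx ((x \<ominus> u) \<otimes> v) \<le> mx (x \<ominus> u) * mx v"
    using assms by (intro mxD(6); simp)+
  ultimately show ?thesis by (simp add: mult.commute)
qed

lemma cauchy_mult:
  assumes a: "a \<in> cauchy_seqs A" and b: "b \<in> cauchy_seqs A"
  shows "(\<lambda>i. a i \<otimes> b i) \<in> cauchy_seqs A"
proof -
  note c = cauchy_carrier[OF a] cauchy_carrier[OF b]
  obtain K where K: "K > 0" "\<And>i. mx (a i) \<le> K" using cauchy_bounded[OF a] by blast
  obtain L where L: "L > 0" "\<And>i. mx (b i) \<le> L" using cauchy_bounded[OF b] by blast
  show ?thesis
  proof (rule cauchy_seqsI[OF _ _ b a K(1) L(1)])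
    fix i j
    have "mx (a i) * mx (b i \<ominus> b j) \<le> K * mx (b i \<ominus> b j)" "mx (b j) * mx (a i \<ominus> a j) \<le> L * mx (a i \<ominus> a j)"
      using c by (intro mult_right_mono K L mxD(1); simp)+
    then show "mx (a i \<otimes> b i \<ominus> a j \<otimes> b j) \<le> K * mx (b i \<ominus> b j) + L * mx (a i \<ominus> a j)"
      using mx_mult_minus_mult[of "a i" "b i" "a j" "b j"] c by simp
  qed (use c in auto)
qed

text \<open>The union over representatives collapses to one class, because null changes of the
  arguments change the result by a null sequence. Products additionally use that Cauchy sequences
  are bounded.\<close>

lemma enveloping_add:
  assumes a: "a \<in> cauchy_seqs A" and b: "b \<in> cauchy_seqs A"
  shows "seq_class A a \<oplus>\<^bsub>enveloping A\<^esub> seq_class A b = seq_class A (\<lambda>i. a i \<oplus> b i)"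
proof -
  have "seq_class A (\<lambda>i. a' i \<oplus> b' i) = seq_class A (\<lambda>i. a i \<oplus> b i)"
    if "a' \<in> seq_class A a" "b' \<in> seq_class A b" for a' b'
  proof (rule seq_class_eqI)
    have a': "a' \<in> cauchy_seqs A" "null (\<lambda>i. a' i \<ominus> a i)" and b': "b' \<in> cauchy_seqs A" "null (\<lambda>i. b' i \<ominus> b i)"
      using that by (auto simp: mem_seq_class)
    note c = cauchy_carrier[OF a] cauchy_carrier[OF b] cauchy_carrier[OF a'(1)] cauchy_carrier[OF b'(1)]
    show "(\<lambda>i. a' i \<oplus> b' i) \<in> cauchy_seqs A" "(\<lambda>i. a i \<oplus> b i) \<in> cauchy_seqs A"
      by (rule cauchy_add; fact)+
    show "null (\<lambda>i. (a' i \<oplus> b' i) \<ominus> (a i \<oplus> b i))"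
    proof (rule nullI)
      show "mx ((a' i \<oplus> b' i) \<ominus> (a i \<oplus> b i)) \<le> mx (a' i \<ominus> a i) + mx (b' i \<ominus> b i)" for i
      proof -
        have "(a' i \<oplus> b' i) \<ominus> (a i \<oplus> b i) = (a' i \<ominus> a i) \<oplus> (b' i \<ominus> b i)"
          using c by (simp add: a_minus_def minus_add a_ac)
        then show ?thesis using mxD(5)[of "a' i \<ominus> a i" "b' i \<ominus> b i"] c by simp
      qed
      show "(\<lambda>i. mx (a' i \<ominus> a i) + mx (b' i \<ominus> b i)) \<longlonglongrightarrow> 0"
        using a'(2) b'(2) unfolding null_def by (rule tendsto_add_zero)
    qed (use c in auto)
  qed
  then have "(\<Union>a'\<in>seq_class A a. \<Union>b'\<in>seq_class A b. seq_class A (\<lambda>i. a' i \<oplus> b' i)) = seq_class A (\<lambda>i. a i \<oplus> b i)"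
    using seq_class_self[OF a] seq_class_self[OF b] by blast
  then show ?thesis by (simp add: enveloping_def)
qed

lemma enveloping_mult:
  assumes a: "a \<in> cauchy_seqs A" and b: "b \<in> cauchy_seqs A"
  shows "seq_class A a \<otimes>\<^bsub>enveloping A\<^esub> seq_class A b = seq_class A (\<lambda>i. a i \<otimes> b i)"
proof -
  have "seq_class A (\<lambda>i. a' i \<otimes> b' i) = seq_class A (\<lambda>i. a i \<otimes> b i)"
    if "a' \<in> seq_class A a" "b' \<in> seq_class A b" for a' b'
  proof (rule seq_class_eqI)
    have a': "a' \<in> cauchy_seqs A" "null (\<lambda>i. a' i \<ominus> a i)" and b': "b' \<in> cauchy_seqs A" "null (\<lambda>i. b' i \<ominus> b i)"
      using that by (auto simp: mem_seq_class)
    note c = cauchy_carrier[OF a] cauchy_carrier[OF b] cauchy_carrier[OF a'(1)] cauchy_carrier[OF b'(1)]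
    show "(\<lambda>i. a' i \<otimes> b' i) \<in> cauchy_seqs A" "(\<lambda>i. a i \<otimes> b i) \<in> cauchy_seqs A"
      by (rule cauchy_mult; fact)+
    obtain K where K: "K > 0" "\<And>i. mx (a' i) \<le> K" using cauchy_bounded[OF a'(1)] by blast
    obtain L where L: "L > 0" "\<And>i. mx (b i) \<le> L" using cauchy_bounded[OF b] by blast
    show "null (\<lambda>i. (a' i \<otimes> b' i) \<ominus> (a i \<otimes> b i))"
    proof (rule nullI)
      show "mx ((a' i \<otimes> b' i) \<ominus> (a i \<otimes> b i)) \<le> K * mx (b' i \<ominus> b i) + L * mx (a' i \<ominus> a i)" for i
      proof -
        have "mx (a' i) * mx (b' i \<ominus> b i) \<le> K * mx (b' i \<ominus> b i)" "mx (b i) * mx (a' i \<ominus> a i) \<le> L * mx (a' i \<ominus> a i)"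
          using c by (intro mult_right_mono K L mxD(1); simp)+
        then show ?thesis using mx_mult_minus_mult[of "a' i" "b' i" "a i" "b i"] c by simp
      qed
      show "(\<lambda>i. K * mx (b' i \<ominus> b i) + L * mx (a' i \<ominus> a i)) \<longlonglongrightarrow> 0"
        using a'(2) b'(2) unfolding null_def by (intro tendsto_add_zero tendsto_mult_right_zero)
    qed (use c in auto)
  qed
  then have "(\<Union>a'\<in>seq_class A a. \<Union>b'\<in>seq_class A b. seq_class A (\<lambda>i. a' i \<otimes> b' i)) = seq_class A (\<lambda>i. a i \<otimes> b i)"
    using seq_class_self[OF a] seq_class_self[OF b] by blast
  then show ?thesis by (simp add: enveloping_def)
qed

lemma enveloping_smult:
  assumes a: "a \<in> cauchy_seqs A"
  shows "c \<odot>\<^bsub>enveloping A\<^esub> seq_class A a = seq_class A (\<lambda>i. c \<odot> a i)"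
proof -
  have "seq_class A (\<lambda>i. c \<odot> a' i) = seq_class A (\<lambda>i. c \<odot> a i)" if "a' \<in> seq_class A a" for a'
  proof (rule seq_class_eqI)
    have a': "a' \<in> cauchy_seqs A" "null (\<lambda>i. a' i \<ominus> a i)" using that by (auto simp: mem_seq_class)
    note ca = cauchy_carrier[OF a] cauchy_carrier[OF a'(1)]
    show "(\<lambda>i. c \<odot> a' i) \<in> cauchy_seqs A" "(\<lambda>i. c \<odot> a i) \<in> cauchy_seqs A" by (rule cauchy_smult; fact)+
    have "c \<odot> a' i \<ominus> c \<odot> a i = c \<odot> (a' i \<ominus> a i)" for i
      using ca by (simp add: minus_smult smult_add_right smult_smult mult.commute)
    then show "null (\<lambda>i. c \<odot> a' i \<ominus> c \<odot> a i)"
      using a'(2) ca unfolding null_def by (simp add: mxD(4) tendsto_mult_right_zero)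
  qed
  then have "(\<Union>a'\<in>seq_class A a. seq_class A (\<lambda>i. c \<odot> a' i)) = seq_class A (\<lambda>i. c \<odot> a i)"
    using seq_class_self[OF a] by blast
  then show ?thesis by (simp add: enveloping_def)
qed

lemma enveloping_star:
  assumes a: "a \<in> cauchy_seqs A"
  shows "star (enveloping A) (seq_class A a) = seq_class A (\<lambda>i. star A (a i))"
proof -
  have "seq_class A (\<lambda>i. star A (a' i)) = seq_class A (\<lambda>i. star A (a i))" if "a' \<in> seq_class A a" for a'
  proof (rule seq_class_eqI)
    have a': "a' \<in> cauchy_seqs A" "null (\<lambda>i. a' i \<ominus> a i)" using that by (auto simp: mem_seq_class)
    note ca = cauchy_carrier[OF a] cauchy_carrier[OF a'(1)]
    show "(\<lambda>i. star A (a' i)) \<in> cauchy_seqs A" "(\<lambda>i. star A (a i)) \<in> cauchy_seqs A" by (rule cauchy_star; fact)+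
    have "star A (a' i) \<ominus> star A (a i) = star A (a' i \<ominus> a i)" for i
      using ca by (simp add: minus_smult star_add star_smult)
    then show "null (\<lambda>i. star A (a' i) \<ominus> star A (a i))"
      using a'(2) ca unfolding null_def by (simp add: cstar_seminorm_star[OF cstar_seminorm_max])
  qed
  then have "(\<Union>a'\<in>seq_class A a. seq_class A (\<lambda>i. star A (a' i))) = seq_class A (\<lambda>i. star A (a i))"
    using seq_class_self[OF a] by blast
  then show ?thesis by (simp add: enveloping_def)
qed

lemma enveloping_nrm:
  assumes a: "a \<in> cauchy_seqs A"
  shows "(\<lambda>i. mx (a i)) \<longlonglongrightarrow> nrm (enveloping A) (seq_class A a)"
proof -
  obtain l where l: "(\<lambda>i. mx (a i)) \<longlonglongrightarrow> l" using cauchy_Cauchy[OF a] by (auto simp: convergent_def)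
  have "r = l" if "a' \<in> seq_class A a" "(\<lambda>i. mx (a' i)) \<longlonglongrightarrow> r" for a' r
  proof -
    have a': "a' \<in> cauchy_seqs A" "null (\<lambda>i. a' i \<ominus> a i)" using that by (auto simp: mem_seq_class)
    have "(\<lambda>i. mx (a' i) - mx (a i)) \<longlonglongrightarrow> 0"
      by (rule Lim_null_comparison[OF _ a'(2)[unfolded null_def]])
        (simp add: mx_diff_le cauchy_carrier[OF a] cauchy_carrier[OF a'(1)])
    moreover have "(\<lambda>i. mx (a' i) - mx (a i)) \<longlonglongrightarrow> r - l" by (intro tendsto_diff that l)
    ultimately show ?thesis using LIMSEQ_unique by fastforce
  qed
  then have "(THE r. \<exists>a'\<in>seq_class A a. (\<lambda>i. mx (a' i)) \<longlonglongrightarrow> r) = l"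
    using l seq_class_self[OF a] by (intro the_equality) blast+
  then show ?thesis using l by (simp add: enveloping_def)
qed

lemma enveloping_map_carrier: "x \<in> carrier A \<Longrightarrow> enveloping_map A x \<in> carrier (enveloping A)"
  by (simp add: enveloping_map_def seq_class_carrier cauchy_const)

lemma nrm_enveloping_map: "x \<in> carrier A \<Longrightarrow> nrm (enveloping A) (enveloping_map A x) = mx x"
  using enveloping_nrm[OF cauchy_const, of x] by (simp add: enveloping_map_def LIMSEQ_const_iff)

section \<open>Extension of functionals to the completion\<close>

definition extend_functional :: "('b \<Rightarrow> complex) \<Rightarrow> (nat \<Rightarrow> 'b) set \<Rightarrow> complex" where
  "extend_functional \<phi> = (\<lambda>x\<in>carrier (enveloping A). lim (\<lambda>i. \<phi> ((SOME a. a \<in> x) i)))"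

lemma linear_functional_minus:
  assumes "linear_functional A \<phi>" "x \<in> carrier A" "y \<in> carrier A"
  shows "\<phi> (x \<ominus> y) = \<phi> x - \<phi> y"
proof -
  have "\<phi> (x \<oplus> (-1) \<odot> y) = \<phi> x + \<phi> ((-1) \<odot> y)" "\<phi> ((-1) \<odot> y) = (-1) * \<phi> y"
    using assms by (simp_all add: linear_functional_def)
  then show ?thesis by (simp add: minus_smult assms)
qed

text \<open>A bounded functional takes null sequences to null sequences, so the limit along the
  representative picked by \<open>SOME\<close> is the limit along any other.\<close>

lemma extend_functional:
  assumes lin: "linear_functional A \<phi>" and bd: "\<And>x. x \<in> carrier A \<Longrightarrow> cmod (\<phi> x) \<le> K * mx x"
    and a: "a \<in> cauchy_seqs A"
  shows "(\<lambda>i. \<phi> (a i)) \<longlonglongrightarrow> extend_functional \<phi> (seq_class A a)"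
proof -
  define b where "b = (SOME b. b \<in> seq_class A a)"
  have "b \<in> seq_class A a" unfolding b_def by (rule someI[of "\<lambda>b. b \<in> seq_class A a", OF seq_class_self[OF a]])
  then have b: "b \<in> cauchy_seqs A" "null (\<lambda>i. b i \<ominus> a i)" by (auto simp: mem_seq_class)
  \<comment> \<open>The constant is enlarged to a positive one, by which it is possible to
    divide.\<close>
  have K: "cmod (\<phi> x) \<le> (\<bar>K\<bar> + 1) * mx x" if "x \<in> carrier A" for x
    using bd[OF that] mult_right_mono[of K "\<bar>K\<bar> + 1" "mx x"] mxD(1)[OF that] by linarith
  have "Cauchy (\<lambda>i. \<phi> (b i))" unfolding Cauchy_def
  proof (intro allI impI)
    fix e :: real assume e: "e > 0"
    then have "e / (\<bar>K\<bar> + 1) > 0" by (simp add: add_nonneg_pos)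
    then obtain N where N: "\<forall>i\<ge>N. \<forall>j\<ge>N. mx (b i \<ominus> b j) < e / (\<bar>K\<bar> + 1)"
      using b(1) unfolding cauchy_seqs_def max_dist_def by blast
    have "dist (\<phi> (b i)) (\<phi> (b j)) < e" if "i \<ge> N" "j \<ge> N" for i j
    proof -
      have "dist (\<phi> (b i)) (\<phi> (b j)) = cmod (\<phi> (b i \<ominus> b j))"
        by (simp add: dist_norm linear_functional_minus[OF lin] cauchy_carrier[OF b(1)])
      also have "\<dots> \<le> (\<bar>K\<bar> + 1) * mx (b i \<ominus> b j)" by (rule K) (simp add: cauchy_carrier[OF b(1)])
      also have "\<dots> < e" using N that by (simp add: field_simps add_nonneg_pos)
      finally show ?thesis .
    qed
    then show "\<exists>M. \<forall>m\<ge>M. \<forall>n\<ge>M. dist (\<phi> (b m)) (\<phi> (b n)) < e" by blast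
  qed
  then have l: "(\<lambda>i. \<phi> (b i)) \<longlonglongrightarrow> lim (\<lambda>i. \<phi> (b i))"
    by (simp add: Cauchy_convergent_iff convergent_LIMSEQ_iff)
  have "(\<lambda>i. \<phi> (b i \<ominus> a i)) \<longlonglongrightarrow> 0"
  proof (rule Lim_null_comparison[of _ "\<lambda>i. (\<bar>K\<bar> + 1) * mx (b i \<ominus> a i)"])
    show "\<forall>\<^sub>F i in sequentially. cmod (\<phi> (b i \<ominus> a i)) \<le> (\<bar>K\<bar> + 1) * mx (b i \<ominus> a i)"
      by (intro always_eventually allI K) (simp add: cauchy_carrier a b)
    show "(\<lambda>i. (\<bar>K\<bar> + 1) * mx (b i \<ominus> a i)) \<longlonglongrightarrow> 0"
      using b(2) unfolding null_def by (rule tendsto_mult_right_zero)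
  qed
  then have "(\<lambda>i. \<phi> (b i) - \<phi> (b i \<ominus> a i)) \<longlonglongrightarrow> lim (\<lambda>i. \<phi> (b i)) - 0" by (intro tendsto_diff l)
  moreover have "\<phi> (b i) - \<phi> (b i \<ominus> a i) = \<phi> (a i)" for i
    by (simp add: linear_functional_minus[OF lin] cauchy_carrier a b)
  ultimately show ?thesis by (simp add: extend_functional_def seq_class_carrier[OF a] b_def)
qed

lemma extend_functional_linear:
  assumes lin: "linear_functional A \<phi>" and bd: "\<And>x. x \<in> carrier A \<Longrightarrow> cmod (\<phi> x) \<le> K * mx x"
  shows "linear_functional (enveloping A) (extend_functional \<phi>)"
    "continuous_functional (enveloping A) (extend_functional \<phi>)"
proof -
  have E: "(\<lambda>i. \<phi> (a i)) \<longlonglongrightarrow> extend_functional \<phi> (seq_class A a)" if "a \<in> cauchy_seqs A" for a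
    by (rule extend_functional[OF lin bd that])
  show "linear_functional (enveloping A) (extend_functional \<phi>)"
    unfolding linear_functional_def
  proof (intro ballI conjI allI)
    fix x assume "x \<in> carrier (enveloping A)"
    then obtain a where a: "a \<in> cauchy_seqs A" "x = seq_class A a" by (rule enveloping_carrierE)
    show "extend_functional \<phi> (c \<odot>\<^bsub>enveloping A\<^esub> x) = c * extend_functional \<phi> x" for c
    proof -
      have "\<phi> (c \<odot> a i) = c * \<phi> (a i)" for i
        using lin cauchy_carrier[OF a(1)] by (simp add: linear_functional_def)
      then have "(\<lambda>i. c * \<phi> (a i)) \<longlonglongrightarrow> extend_functional \<phi> (seq_class A (\<lambda>i. c \<odot> a i))"
        using E[OF cauchy_smult[OF a(1)], of c] by simp
      moreover have "(\<lambda>i. c * \<phi> (a i)) \<longlonglongrightarrow> c * extend_functional \<phi> x"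
        unfolding a(2) by (intro tendsto_mult_left E a)
      ultimately show ?thesis unfolding a(2) enveloping_smult[OF a(1)] by (rule LIMSEQ_unique)
    qed
    fix y assume "y \<in> carrier (enveloping A)"
    then obtain b where b: "b \<in> cauchy_seqs A" "y = seq_class A b" by (rule enveloping_carrierE)
    have "\<phi> (a i \<oplus> b i) = \<phi> (a i) + \<phi> (b i)" for i
      using lin cauchy_carrier[OF a(1)] cauchy_carrier[OF b(1)] by (simp add: linear_functional_def)
    then have "(\<lambda>i. \<phi> (a i) + \<phi> (b i)) \<longlonglongrightarrow> extend_functional \<phi> (seq_class A (\<lambda>i. a i \<oplus> b i))"
      using E[OF cauchy_add[OF a(1) b(1)]] by simp
    moreover have "(\<lambda>i. \<phi> (a i) + \<phi> (b i)) \<longlonglongrightarrow> extend_functional \<phi> x + extend_functional \<phi> y"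
      unfolding a(2) b(2) by (intro tendsto_add E a b)
    ultimately show "extend_functional \<phi> (x \<oplus>\<^bsub>enveloping A\<^esub> y) = extend_functional \<phi> x + extend_functional \<phi> y"
      unfolding a(2) b(2) enveloping_add[OF a(1) b(1)] by (rule LIMSEQ_unique)
  qed
  show "continuous_functional (enveloping A) (extend_functional \<phi>)"
    unfolding continuous_functional_def
  proof (intro exI ballI)
    fix x assume "x \<in> carrier (enveloping A)"
    then obtain a where a: "a \<in> cauchy_seqs A" "x = seq_class A a" by (rule enveloping_carrierE)
    show "cmod (extend_functional \<phi> x) \<le> K * nrm (enveloping A) x"
      unfolding a(2)
    proof (rule tendsto_le[OF sequentially_bot])
      show "(\<lambda>i. K * mx (a i)) \<longlonglongrightarrow> K * nrm (enveloping A) (seq_class A a)"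
        by (intro tendsto_mult_left enveloping_nrm a)
      show "(\<lambda>i. cmod (\<phi> (a i))) \<longlonglongrightarrow> cmod (extend_functional \<phi> (seq_class A a))"
        by (intro tendsto_norm E a)
    qed (use bd cauchy_carrier[OF a(1)] in auto)
  qed
qed

lemma extend_functional_map:
  assumes "linear_functional A \<phi>" "\<And>x. x \<in> carrier A \<Longrightarrow> cmod (\<phi> x) \<le> K * mx x" "x \<in> carrier A"
  shows "extend_functional \<phi> (enveloping_map A x) = \<phi> x"
  using extend_functional[OF assms(1,2) cauchy_const[OF assms(3)]] by (simp add: enveloping_map_def LIMSEQ_const_iff)

lemma enveloping_map_linear:
  assumes "linear_functional (enveloping A) \<psi>"
  shows "linear_functional A (\<lambda>x. \<psi> (enveloping_map A x))"
  unfolding linear_functional_def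
proof (intro ballI conjI allI)
  fix x assume x: "x \<in> carrier A"
  show "\<psi> (enveloping_map A (c \<odot> x)) = c * \<psi> (enveloping_map A x)" for c
  proof -
    have "\<psi> (c \<odot>\<^bsub>enveloping A\<^esub> enveloping_map A x) = c * \<psi> (enveloping_map A x)"
      using assms enveloping_map_carrier[OF x] by (simp add: linear_functional_def)
    then show ?thesis by (simp only: enveloping_map_def enveloping_smult[OF cauchy_const[OF x]])
  qed
  fix y assume y: "y \<in> carrier A"
  show "\<psi> (enveloping_map A (x \<oplus> y)) = \<psi> (enveloping_map A x) + \<psi> (enveloping_map A y)"
  proof -
    have "\<psi> (enveloping_map A x \<oplus>\<^bsub>enveloping A\<^esub> enveloping_map A y) = \<psi> (enveloping_map A x) + \<psi> (enveloping_map A y)"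
      using assms enveloping_map_carrier[OF x] enveloping_map_carrier[OF y] by (simp add: linear_functional_def)
    then show ?thesis by (simp only: enveloping_map_def enveloping_add[OF cauchy_const[OF x] cauchy_const[OF y]])
  qed
qed

text \<open>Density of \<open>A\<close> in its completion: the class of \<open>a\<close> is the
  limit of the classes of the constant sequences \<open>a n\<close>, and a continuous functional
  follows this limit.\<close>

lemma continuous_functional_eq:
  assumes \<psi>: "linear_functional (enveloping A) \<psi>" "continuous_functional (enveloping A) \<psi>"
    and \<xi>: "linear_functional (enveloping A) \<xi>" "continuous_functional (enveloping A) \<xi>"
    and eq: "\<And>x. x \<in> carrier A \<Longrightarrow> \<psi> (enveloping_map A x) = \<xi> (enveloping_map A x)"
    and x: "x \<in> carrier (enveloping A)"
  shows "\<psi> x = \<xi> x"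
proof -
  obtain a where a: "a \<in> cauchy_seqs A" "x = seq_class A a" using x by (rule enveloping_carrierE)
  have lim: "(\<lambda>n. \<theta> (enveloping_map A (a n))) \<longlonglongrightarrow> \<theta> x"
    if \<theta>: "linear_functional (enveloping A) \<theta>" "continuous_functional (enveloping A) \<theta>" for \<theta>
  proof -
    obtain K where K: "\<And>x. x \<in> carrier (enveloping A) \<Longrightarrow> cmod (\<theta> x) \<le> K * nrm (enveloping A) x"
      using \<theta>(2) by (auto simp: continuous_functional_def)
    \<comment> \<open>\<open>d n\<close> is the difference between the constant class of
      \<open>a n\<close> and \<open>x\<close>. Its norm is a limit over \<open>i\<close> of
      seminorms of \<open>a n \<ominus> a i\<close>, which the Cauchy condition makes small.\<close>
    define d where "d n = seq_class A (\<lambda>i. a n \<oplus> (- 1) \<odot> a i)" for n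
    have dc: "(\<lambda>i. a n \<oplus> (- 1) \<odot> a i) \<in> cauchy_seqs A" for n
      by (intro cauchy_add cauchy_smult cauchy_const a cauchy_carrier)
    have "\<theta> (enveloping_map A (a n)) - \<theta> x = \<theta> (d n)" for n
    proof -
      have "d n = enveloping_map A (a n) \<oplus>\<^bsub>enveloping A\<^esub> (- 1) \<odot>\<^bsub>enveloping A\<^esub> x"
        by (simp add: d_def a(2) enveloping_smult[OF a(1)] enveloping_map_def
            enveloping_add[OF cauchy_const[OF cauchy_carrier[OF a(1)]] cauchy_smult[OF a(1)]])
      moreover have "(- 1) \<odot>\<^bsub>enveloping A\<^esub> x \<in> carrier (enveloping A)"
        by (simp add: a(2) enveloping_smult[OF a(1)] seq_class_carrier[OF cauchy_smult[OF a(1)]])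
      ultimately show ?thesis
        using \<theta>(1) x enveloping_map_carrier[OF cauchy_carrier[OF a(1)]] by (simp add: linear_functional_def)
    qed
    then have bound: "cmod (\<theta> (enveloping_map A (a n)) - \<theta> x) \<le> K * nrm (enveloping A) (d n)" for n
      using K[of "d n"] by (simp add: d_def seq_class_carrier[OF dc])
    have "(\<lambda>n. nrm (enveloping A) (d n)) \<longlonglongrightarrow> 0"
    proof (rule LIMSEQ_I)
      fix e :: real assume e: "e > 0"
      have "\<forall>\<epsilon>>0. \<exists>N. \<forall>i\<ge>N. \<forall>j\<ge>N. mx (a i \<ominus> a j) < \<epsilon>"
        using a(1) by (simp add: cauchy_seqs_def max_dist_def)
      then obtain N where N: "\<forall>i\<ge>N. \<forall>j\<ge>N. mx (a i \<ominus> a j) < e / 2"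
        using half_gt_zero[OF e] by blast
      have "norm (nrm (enveloping A) (d n) - 0) < e" if "n \<ge> N" for n
      proof -
        note l = enveloping_nrm[OF dc, of n, folded d_def]
        have "nrm (enveloping A) (d n) \<le> e / 2"
        proof (rule LIMSEQ_le_const2[OF l], intro exI allI impI)
          fix i assume "N \<le> i"
          then have "mx (a n \<ominus> a i) < e / 2" using N that by blast
          then show "mx (a n \<oplus> (- 1) \<odot> a i) \<le> e / 2" by (simp add: minus_smult cauchy_carrier[OF a(1)])
        qed
        moreover have "0 \<le> nrm (enveloping A) (d n)"
          by (rule LIMSEQ_le_const[OF l]) (intro exI[of _ 0] allI impI mxD(1) add.m_closed smult_closed cauchy_carrier[OF a(1)])
        ultimately show ?thesis using e by simp
      qed
      then show "\<exists>N. \<forall>n\<ge>N. norm (nrm (enveloping A) (d n) - 0) < e" by blast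
    qed
    then have "(\<lambda>n. K * nrm (enveloping A) (d n)) \<longlonglongrightarrow> 0" by (rule tendsto_mult_right_zero)
    then have "(\<lambda>n. \<theta> (enveloping_map A (a n)) - \<theta> x) \<longlonglongrightarrow> 0"
      by (rule Lim_null_comparison[rotated]) (simp add: bound)
    then show ?thesis by (simp add: LIM_zero_iff)
  qed
  have "(\<lambda>n. \<psi> (enveloping_map A (a n))) \<longlonglongrightarrow> \<xi> x"
    using lim[OF \<xi>] by (simp add: eq[OF cauchy_carrier[OF a(1)]])
  then show ?thesis by (rule LIMSEQ_unique[OF lim[OF \<psi>]])
qed

end

section \<open>Positive functionals\<close>

text \<open>\<open>n2\<close> is the seminorm of the GNS construction for
  \<open>\<tau>\<close>.\<close>

locale positive_star_algebra = normed_star_algebra A for A :: "'b star_algebra" (structure) +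
  fixes \<tau> :: "'b \<Rightarrow> complex" and n2 :: "'b \<Rightarrow> real"
  defines "n2 \<equiv> \<lambda>x. sqrt (Re (\<tau> (star A x \<otimes> x)))"
  assumes \<tau>_linear: "linear_functional A \<tau>"
    and \<tau>_star: "x \<in> carrier A \<Longrightarrow> \<tau> (star A x) = cnj (\<tau> x)"
    and \<tau>_pos: "x \<in> carrier A \<Longrightarrow> 0 \<le> Re (\<tau> (star A x \<otimes> x))"
    and \<tau>_one: "\<tau> \<one> = 1"
begin

lemma \<tau>_add: "x \<in> carrier A \<Longrightarrow> y \<in> carrier A \<Longrightarrow> \<tau> (x \<oplus> y) = \<tau> x + \<tau> y"
  and \<tau>_smult: "x \<in> carrier A \<Longrightarrow> \<tau> (c \<odot> x) = c * \<tau> x"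
  using \<tau>_linear by (simp_all add: linear_functional_def)

lemma add_minus_cancel: "x \<in> carrier A \<Longrightarrow> y \<in> carrier A \<Longrightarrow> y \<oplus> (x \<ominus> y) = x"
  using a_lcomm[of y x "\<ominus> y"] by (simp add: a_minus_def r_neg)

lemma star_one: "star A \<one> = \<one>"
  by (metis one_closed r_one l_one star_closed star_mult star_star)

lemma n2_nonneg: "x \<in> carrier A \<Longrightarrow> 0 \<le> n2 x"
  by (simp add: n2_def \<tau>_pos)

lemma n2_square: "x \<in> carrier A \<Longrightarrow> (n2 x)\<^sup>2 = Re (\<tau> (star A x \<otimes> x))"
  by (simp add: n2_def \<tau>_pos)

lemma \<tau>_hermitian: "x \<in> carrier A \<Longrightarrow> y \<in> carrier A \<Longrightarrow> \<tau> (star A x \<otimes> y) = cnj (\<tau> (star A y \<otimes> x))"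
  using \<tau>_star[of "star A y \<otimes> x"] by (simp add: star_mult)

lemma \<tau>_square: "x \<in> carrier A \<Longrightarrow> \<tau> (star A x \<otimes> x) = of_real ((n2 x)\<^sup>2)"
  using \<tau>_hermitian[of x x] by (simp add: n2_square complex_eq_iff)

lemma n2_square_add:
  assumes x: "x \<in> carrier A" and y: "y \<in> carrier A"
  shows "(n2 (x \<oplus> c \<odot> y))\<^sup>2 = (n2 x)\<^sup>2 + 2 * Re (cnj c * \<tau> (star A y \<otimes> x)) + (cmod c)\<^sup>2 * (n2 y)\<^sup>2"
proof -
  have "star A (x \<oplus> c \<odot> y) \<otimes> (x \<oplus> c \<odot> y) =
    (star A x \<otimes> x \<oplus> cnj c \<odot> (star A y \<otimes> x)) \<oplus> (c \<odot> (star A x \<otimes> y) \<oplus> (c * cnj c) \<odot> (star A y \<otimes> y))"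
    using x y by (simp add: star_add star_smult l_distr r_distr smult_mult_left smult_mult_right smult_smult smult_add_right)
  then have "\<tau> (star A (x \<oplus> c \<odot> y) \<otimes> (x \<oplus> c \<odot> y)) =
    of_real ((n2 x)\<^sup>2) + cnj c * \<tau> (star A y \<otimes> x) + (c * cnj (\<tau> (star A y \<otimes> x)) + c * cnj c * of_real ((n2 y)\<^sup>2))"
    using x y by (simp add: \<tau>_add \<tau>_smult \<tau>_square \<tau>_hermitian[of x y])
  moreover have "Re (c * cnj (\<tau> (star A y \<otimes> x))) = Re (cnj c * \<tau> (star A y \<otimes> x))"
    by (simp add: algebra_simps)
  moreover have "Re (c * cnj c * of_real ((n2 y)\<^sup>2)) = (cmod c)\<^sup>2 * (n2 y)\<^sup>2"
    by (simp add: complex_norm_square[symmetric] cmod_power2 power2_eq_square algebra_simps)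
  ultimately show ?thesis using x y by (simp add: n2_square)
qed

lemma cauchy_schwarz:
  assumes x: "x \<in> carrier A" and y: "y \<in> carrier A"
  shows "cmod (\<tau> (star A y \<otimes> x)) \<le> n2 y * n2 x"
proof -
  define c where "c = \<tau> (star A y \<otimes> x)"
  \<comment> \<open>Moving \<open>x\<close> in the direction \<open>- t c y\<close>, with
    \<open>c\<close> the value to be estimated, makes the mixed term real, and a quadratic
    polynomial in \<open>t\<close> remains.\<close>
  have q: "0 \<le> (n2 x)\<^sup>2 - 2 * t * (cmod c)\<^sup>2 + t\<^sup>2 * (cmod c)\<^sup>2 * (n2 y)\<^sup>2" for t :: real
  proof -
    have "Re (cnj (of_real (- t) * c) * c) = - t * (cmod c)\<^sup>2"
      unfolding cmod_power2 by (simp add: power2_eq_square algebra_simps)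
    moreover have "(cmod (of_real (- t) * c))\<^sup>2 = t\<^sup>2 * (cmod c)\<^sup>2" by (simp add: norm_mult power_mult_distrib)
    ultimately have "(n2 (x \<oplus> (of_real (- t) * c) \<odot> y))\<^sup>2 = (n2 x)\<^sup>2 + 2 * (- t * (cmod c)\<^sup>2) + t\<^sup>2 * (cmod c)\<^sup>2 * (n2 y)\<^sup>2"
      using n2_square_add[OF x y, of "of_real (- t) * c"] unfolding c_def[symmetric] by simp
    moreover have "0 \<le> (n2 (x \<oplus> (of_real (- t) * c) \<odot> y))\<^sup>2" by simp
    ultimately show ?thesis by linarith
  qed
  show ?thesis
  proof (cases "n2 y = 0")
    case True
    have "c = 0"
    proof (rule ccontr)
      assume "c \<noteq> 0"
      then have p: "(cmod c)\<^sup>2 > 0" by simp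
      \<comment> \<open>Without its quadratic term the polynomial is affine with negative slope, and
        this \<open>t\<close> takes it below zero.\<close>
      have "2 * ((n2 x)\<^sup>2 + 1) \<le> (n2 x)\<^sup>2"
        using q[of "((n2 x)\<^sup>2 + 1) / (cmod c)\<^sup>2"] p by (simp add: True)
      moreover have "2 * (X + 1) \<le> X \<Longrightarrow> 0 \<le> X \<Longrightarrow> False" for X :: real by simp
      ultimately show False using zero_le_power2 by blast
    qed
    then show ?thesis by (simp add: c_def True)
  next
    case False
    then have p: "(n2 y)\<^sup>2 > 0" by simp
    \<comment> \<open>The polynomial is taken at its minimum,
      \<open>t = 1 / (n2 y)^2\<close>.\<close>
    have "(1 / (n2 y)\<^sup>2)\<^sup>2 * (cmod c)\<^sup>2 * (n2 y)\<^sup>2 = (cmod c)\<^sup>2 / (n2 y)\<^sup>2"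
      using False by (simp add: power2_eq_square)
    then have "(cmod c)\<^sup>2 / (n2 y)\<^sup>2 \<le> (n2 x)\<^sup>2" using q[of "1 / (n2 y)\<^sup>2"] by simp
    then have "(cmod c)\<^sup>2 \<le> (n2 y * n2 x)\<^sup>2" using p by (simp add: power_mult_distrib field_simps)
    then show ?thesis unfolding c_def by (rule power2_le_imp_le) (simp add: n2_nonneg x y)
  qed
qed

lemma n2_smult: "x \<in> carrier A \<Longrightarrow> n2 (c \<odot> x) = cmod c * n2 x"
proof -
  assume x: "x \<in> carrier A"
  have "\<tau> (star A (c \<odot> x) \<otimes> (c \<odot> x)) = c * cnj c * of_real ((n2 x)\<^sup>2)"
    using x by (simp add: star_smult smult_mult_left smult_mult_right \<tau>_smult \<tau>_square)
  also have "\<dots> = of_real ((cmod c * n2 x)\<^sup>2)"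
    by (simp only: power_mult_distrib of_real_mult complex_norm_square)
  finally have "(n2 (c \<odot> x))\<^sup>2 = (cmod c * n2 x)\<^sup>2"
    using x by (simp only: n2_square smult_closed Re_complex_of_real)
  then show ?thesis using n2_nonneg x by (simp add: power2_eq_iff_nonneg)
qed

lemma n2_triangle:
  assumes x: "x \<in> carrier A" and y: "y \<in> carrier A"
  shows "n2 (x \<oplus> y) \<le> n2 x + n2 y"
proof -
  have "(n2 (x \<oplus> y))\<^sup>2 = (n2 x)\<^sup>2 + 2 * Re (\<tau> (star A y \<otimes> x)) + (n2 y)\<^sup>2"
    using n2_square_add[OF x y, of 1] y by simp
  also have "\<dots> \<le> (n2 x)\<^sup>2 + 2 * (n2 y * n2 x) + (n2 y)\<^sup>2"
    using cauchy_schwarz[OF x y] complex_Re_le_cmod[of "\<tau> (star A y \<otimes> x)"] by linarith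
  also have "\<dots> = (n2 x + n2 y)\<^sup>2" by (simp add: power2_sum)
  finally show ?thesis by (rule power2_le_imp_le) (simp add: n2_nonneg x y)
qed

lemma n2_zero: "n2 \<zero> = 0"
  using n2_smult[of \<zero> 0] by (simp add: smult_zero)

lemma n2_one: "n2 \<one> = 1"
  by (simp add: n2_def star_one \<tau>_one)

end

text \<open>\<open>right_bounded\<close> is the form in which the trace property enters: for a trace
  \<open>n2\<close> is invariant under the star, which turns a bound on left multiplication into one
  on right multiplication.\<close>

locale tracial_star_algebra = positive_star_algebra A \<tau> n2
  for A :: "'b star_algebra" (structure) and \<tau> n2 +
  assumes left_bounded: "x \<in> carrier A \<Longrightarrow> y \<in> carrier A \<Longrightarrow> n2 (x \<otimes> y) \<le> nrm A x * n2 y"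
    and right_bounded: "x \<in> carrier A \<Longrightarrow> y \<in> carrier A \<Longrightarrow> n2 (x \<otimes> y) \<le> nrm A y * n2 x"
begin

text \<open>The norm of the left regular representation on the completion of \<open>A\<close> for the inner product of \<open>\<tau>\<close>.\<close>

definition red where
  "red x = (SUP y\<in>{y \<in> carrier A. n2 y \<le> 1}. n2 (x \<otimes> y))"

lemma red_bdd: "x \<in> carrier A \<Longrightarrow> bdd_above ((\<lambda>y. n2 (x \<otimes> y)) ` {y \<in> carrier A. n2 y \<le> 1})"
proof (rule bdd_aboveI2)
  fix y assume x: "x \<in> carrier A" and y: "y \<in> {y \<in> carrier A. n2 y \<le> 1}"
  have "nrm A x * n2 y \<le> nrm A x * 1" using x y by (intro mult_left_mono nrm_nonneg) auto
  then show "n2 (x \<otimes> y) \<le> nrm A x" using left_bounded[of x y] x y by simp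
qed

lemma red_upper: "x \<in> carrier A \<Longrightarrow> y \<in> carrier A \<Longrightarrow> n2 y \<le> 1 \<Longrightarrow> n2 (x \<otimes> y) \<le> red x"
  unfolding red_def by (rule cSUP_upper) (auto simp: red_bdd)

lemma red_least: "(\<And>y. y \<in> carrier A \<Longrightarrow> n2 y \<le> 1 \<Longrightarrow> n2 (x \<otimes> y) \<le> K) \<Longrightarrow> red x \<le> K"
  unfolding red_def by (rule cSUP_least) (use n2_zero in auto)

lemma red_nonneg: "x \<in> carrier A \<Longrightarrow> 0 \<le> red x"
  using red_upper[of x \<zero>] by (simp add: n2_zero)

lemma red_bound:
  assumes x: "x \<in> carrier A" and y: "y \<in> carrier A"
  shows "n2 (x \<otimes> y) \<le> red x * n2 y"
proof (cases "n2 y = 0")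
  \<comment> \<open>A vector of length zero cannot be normalised, but \<open>left_bounded\<close>
    shows that its product with \<open>x\<close> has length zero as well.\<close>
  case True
  then show ?thesis using left_bounded[OF x y] by simp
next
  case False
  then have p: "n2 y > 0" using n2_nonneg[OF y] by simp
  let ?c = "complex_of_real (inverse (n2 y))"
  have "n2 (x \<otimes> (?c \<odot> y)) \<le> red x"
    by (rule red_upper) (use x y p in \<open>auto simp: n2_smult norm_inverse\<close>)
  moreover have "n2 (x \<otimes> (?c \<odot> y)) = inverse (n2 y) * n2 (x \<otimes> y)"
    using x y p by (simp add: smult_mult_right n2_smult norm_inverse)
  ultimately have "inverse (n2 y) * n2 (x \<otimes> y) \<le> red x" by simp
  then show ?thesis using p by (simp add: divide_simps mult.commute)
qed

text \<open>For the C*-identity, the square of \<open>n2 (x \<otimes> y)\<close> is the inner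
  product of \<open>y\<close> with \<open>star A x \<otimes> x \<otimes> y\<close>, which
  Cauchy-Schwarz bounds by \<open>red (star A x \<otimes> x)\<close> on the unit ball. This also
  gives invariance under the star, and with it the opposite inequality.\<close>

lemma cstar_seminorm_red: "cstar_seminorm A red"
  unfolding cstar_seminorm_def
proof (intro ballI conjI allI)
  fix x assume x: "x \<in> carrier A"
  show "0 \<le> red x" by (rule red_nonneg[OF x])
  show "red x \<le> nrm A x"
  proof (rule red_least)
    fix y assume y: "y \<in> carrier A" "n2 y \<le> 1"
    have "nrm A x * n2 y \<le> nrm A x * 1" using x y by (intro mult_left_mono nrm_nonneg) auto
    then show "n2 (x \<otimes> y) \<le> nrm A x" using left_bounded[of x y] x y by simp
  qed
  have smult_le: "red (c \<odot> x) \<le> cmod c * red x" if "x \<in> carrier A" for c x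
  proof (rule red_least)
    fix y assume y: "y \<in> carrier A" "n2 y \<le> 1"
    show "n2 ((c \<odot> x) \<otimes> y) \<le> cmod c * red x"
      using red_upper[OF that y] that y by (simp add: smult_mult_left n2_smult mult_left_mono)
  qed
  show "red (c \<odot> x) = cmod c * red x" for c
  proof (cases "c = 0")
    case True
    then show ?thesis using smult_le[OF x, of c] red_nonneg[of "c \<odot> x"] x by simp
  next
    case False
    have "red x \<le> cmod (inverse c) * red (c \<odot> x)"
      using smult_le[of "c \<odot> x" "inverse c"] x False by (simp add: smult_smult)
    then have "cmod c * red x \<le> red (c \<odot> x)" using False by (simp add: norm_inverse norm_divide divide_simps mult.commute)
    then show ?thesis using smult_le[OF x, of c] by simp
  qed
  have mult_le: "red (x \<otimes> y) \<le> red x * red y" if x: "x \<in> carrier A" and y: "y \<in> carrier A" for x y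
  proof (rule red_least)
    fix w assume w: "w \<in> carrier A" "n2 w \<le> 1"
    have "n2 (x \<otimes> (y \<otimes> w)) \<le> red x * n2 (y \<otimes> w)" by (rule red_bound) (use x y w in auto)
    also have "\<dots> \<le> red x * red y" by (intro mult_left_mono red_upper red_nonneg x y w)
    finally show "n2 (x \<otimes> y \<otimes> w) \<le> red x * red y" using x y w by (simp add: m_assoc)
  qed
  have sq: "(red x)\<^sup>2 \<le> red (star A x \<otimes> x)" if x: "x \<in> carrier A" for x
  proof -
    have "red x \<le> sqrt (red (star A x \<otimes> x))"
    proof (rule red_least)
      fix y assume y: "y \<in> carrier A" "n2 y \<le> 1"
      have "(n2 (x \<otimes> y))\<^sup>2 = Re (\<tau> (star A y \<otimes> (star A x \<otimes> x \<otimes> y)))"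
        using x y by (simp add: n2_square star_mult m_assoc)
      also have "\<dots> \<le> n2 y * n2 (star A x \<otimes> x \<otimes> y)"
        using cauchy_schwarz[of "star A x \<otimes> x \<otimes> y" y] x y
          complex_Re_le_cmod[of "\<tau> (star A y \<otimes> (star A x \<otimes> x \<otimes> y))"] by simp
      also have "\<dots> \<le> 1 * red (star A x \<otimes> x)"
        using x y by (intro mult_mono red_upper n2_nonneg) auto
      finally show "n2 (x \<otimes> y) \<le> sqrt (red (star A x \<otimes> x))" by (simp add: real_le_rsqrt)
    qed
    then show ?thesis using red_nonneg[of "star A x \<otimes> x"] red_nonneg[OF x] x
      by (metis m_closed real_sqrt_pow2 power_mono star_closed)
  qed
  have star_le: "red x \<le> red (star A x)" if x: "x \<in> carrier A" for x
  proof (cases "red x = 0")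
    case True
    then show ?thesis using red_nonneg[of "star A x"] x by simp
  next
    case False
    then have "red x > 0" using red_nonneg[OF x] by simp
    moreover have "red x * red x \<le> red (star A x) * red x"
      using sq[OF x] mult_le[OF star_closed[OF x] x] by (simp add: power2_eq_square)
    ultimately show ?thesis by simp
  qed
  show "red (star A x \<otimes> x) = (red x)\<^sup>2"
    using sq[OF x] mult_le[OF star_closed[OF x] x] star_le[OF star_closed[OF x]] star_le[OF x] x
    by (simp add: power2_eq_square)
  fix y assume y: "y \<in> carrier A"
  show "red (x \<otimes> y) \<le> red x * red y" by (rule mult_le[OF x y])
  show "red (x \<oplus> y) \<le> red x + red y"
  proof (rule red_least)
    fix w assume w: "w \<in> carrier A" "n2 w \<le> 1"
    have "n2 ((x \<oplus> y) \<otimes> w) \<le> n2 (x \<otimes> w) + n2 (y \<otimes> w)"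
      using n2_triangle[of "x \<otimes> w" "y \<otimes> w"] x y w by (simp add: l_distr)
    then show "n2 ((x \<oplus> y) \<otimes> w) \<le> red x + red y"
      using red_upper[OF x w] red_upper[OF y w] by simp
  qed
qed

lemma n2_le_red: "x \<in> carrier A \<Longrightarrow> n2 x \<le> red x"
  using red_upper[of x \<one>] by (simp add: n2_one)

lemma n2_le_mx: "x \<in> carrier A \<Longrightarrow> n2 x \<le> mx x"
  using n2_le_red[of x] max_seminorm_upper[OF cstar_seminorm_red, of x] by simp

lemma \<tau>_mult_le:
  assumes "h \<in> carrier A" "x \<in> carrier A"
  shows "cmod (\<tau> (h \<otimes> x)) \<le> mx h * mx x"
proof -
  have "cmod (\<tau> (star A \<one> \<otimes> (h \<otimes> x))) \<le> n2 \<one> * n2 (h \<otimes> x)"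
    by (rule cauchy_schwarz) (use assms in auto)
  also have "\<dots> \<le> mx (h \<otimes> x)" using assms by (simp add: n2_one n2_le_mx)
  also have "\<dots> \<le> mx h * mx x" by (rule mxD(6)) (use assms in auto)
  finally show ?thesis using assms by (simp add: star_one)
qed

lemma \<tau>_le: "x \<in> carrier A \<Longrightarrow> cmod (\<tau> x) \<le> 1 * mx x"
  using cauchy_schwarz[of x \<one>] n2_le_mx[of x] by (simp add: star_one n2_one)

lemma \<tau>_mult_linear: "h \<in> carrier A \<Longrightarrow> linear_functional A (\<lambda>x. \<tau> (h \<otimes> x))"
  by (simp add: linear_functional_def r_distr smult_mult_right \<tau>_add \<tau>_smult)

lemma state_extend: "state (enveloping A) (extend_functional \<tau>)"
  unfolding state_def
proof (intro conjI ballI)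
  show "linear_functional (enveloping A) (extend_functional \<tau>)"
    by (rule extend_functional_linear(1)[OF \<tau>_linear \<tau>_le])
  have "\<one>\<^bsub>enveloping A\<^esub> = enveloping_map A \<one>" by (simp add: enveloping_def enveloping_map_def)
  then show "extend_functional \<tau> \<one>\<^bsub>enveloping A\<^esub> = 1"
    using extend_functional_map[OF \<tau>_linear \<tau>_le one_closed] by (simp add: \<tau>_one)
next
  fix x assume "x \<in> carrier (enveloping A)"
  then obtain a where a: "a \<in> cauchy_seqs A" "x = seq_class A a" by (rule enveloping_carrierE)
  have lim: "(\<lambda>i. \<tau> (star A (a i) \<otimes> a i)) \<longlonglongrightarrow> extend_functional \<tau> (star (enveloping A) x \<otimes>\<^bsub>enveloping A\<^esub> x)"
    unfolding a(2) enveloping_star[OF a(1)] enveloping_mult[OF cauchy_star[OF a(1)] a(1)]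
    by (rule extend_functional[OF \<tau>_linear \<tau>_le cauchy_mult[OF cauchy_star[OF a(1)] a(1)]])
  have "\<tau> (star A (a i) \<otimes> a i) \<in> \<real>\<^sub>\<ge>\<^sub>0" for i
    by (simp only: \<tau>_square cauchy_carrier[OF a(1)] nonneg_Reals_of_real_iff zero_le_power2)
  then show "extend_functional \<tau> (star (enveloping A) x \<otimes>\<^bsub>enveloping A\<^esub> x) \<in> \<real>\<^sub>\<ge>\<^sub>0"
    by (rule closed_sequentially[OF closed_nonneg_Reals_complex _ lim])
qed

end

text \<open>Since \<open>red\<close> is a C*-seminorm, the opposite inequality holds too: the
  assumption says that the enveloping algebra is the reduced one.\<close>

locale reduced_star_algebra = tracial_star_algebra A \<tau> n2
  for A :: "'b star_algebra" (structure) and \<tau> n2 +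
  assumes mx_le_red: "x \<in> carrier A \<Longrightarrow> mx x \<le> red x"
begin

text \<open>For \<open>y\<close> in the unit ball split \<open>a i \<otimes> y\<close> into
  \<open>a j \<otimes> y\<close> and a remainder. The remainder is small uniformly in
  \<open>y\<close> by the Cauchy condition. The bound \<open>nrm A y * n2 (a j)\<close> for the
  other part is not uniform in \<open>y\<close>, so \<open>j\<close> tends to infinity for fixed
  \<open>y\<close> before the supremum over \<open>y\<close> is taken.\<close>

lemma null_if_n2:
  assumes a: "a \<in> cauchy_seqs A" and lim: "(\<lambda>i. n2 (a i)) \<longlonglongrightarrow> 0"
  shows "null a"
  unfolding null_def
proof (rule LIMSEQ_I)
  note c = cauchy_carrier[OF a]
  fix e :: real assume e: "e > 0"
  have "\<forall>\<epsilon>>0. \<exists>N. \<forall>i\<ge>N. \<forall>j\<ge>N. mx (a i \<ominus> a j) < \<epsilon>"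
    using a by (simp add: cauchy_seqs_def max_dist_def)
  then obtain N where N: "\<forall>i\<ge>N. \<forall>j\<ge>N. mx (a i \<ominus> a j) < e / 2" using half_gt_zero[OF e] by blast
  have "norm (mx (a i) - 0) < e" if i: "i \<ge> N" for i
  proof -
    have "red (a i) \<le> e / 2"
    proof (rule red_least)
      fix y assume y: "y \<in> carrier A" "n2 y \<le> 1"
      have bound: "n2 (a i \<otimes> y) \<le> nrm A y * n2 (a j) + e / 2" if "j \<ge> N" for j
      proof -
        have "a i = a j \<oplus> (a i \<ominus> a j)" using c by (simp add: add_minus_cancel)
        then have "a i \<otimes> y = a j \<otimes> y \<oplus> (a i \<ominus> a j) \<otimes> y" using c y(1) by (metis l_distr minus_closed)
        then have "n2 (a i \<otimes> y) \<le> n2 (a j \<otimes> y) + n2 ((a i \<ominus> a j) \<otimes> y)"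
          using n2_triangle[of "a j \<otimes> y" "(a i \<ominus> a j) \<otimes> y"] c y by simp
        moreover have "n2 ((a i \<ominus> a j) \<otimes> y) \<le> red (a i \<ominus> a j)" by (rule red_upper) (use c y in auto)
        moreover have "red (a i \<ominus> a j) \<le> mx (a i \<ominus> a j)"
          by (rule max_seminorm_upper[OF cstar_seminorm_red]) (use c in auto)
        moreover have "mx (a i \<ominus> a j) < e / 2" using N i that by blast
        ultimately show ?thesis using right_bounded[OF c y(1), of j] by linarith
      qed
      have "(\<lambda>j. nrm A y * n2 (a j) + e / 2) \<longlonglongrightarrow> nrm A y * 0 + e / 2" by (intro tendsto_intros lim)
      then have "n2 (a i \<otimes> y) \<le> nrm A y * 0 + e / 2" by (rule LIMSEQ_le_const) (use bound in blast)
      then show "n2 (a i \<otimes> y) \<le> e / 2" by simp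
    qed
    then show ?thesis using mx_le_red[OF c, of i] mxD(1)[OF c, of i] e by simp
  qed
  then show "\<exists>N. \<forall>i\<ge>N. norm (mx (a i) - 0) < e" by blast
qed

text \<open>Replace the left factor in \<open>\<tau> (star A (d i) \<otimes> d i)\<close> by
  \<open>star A (d N)\<close> for a fixed late \<open>N\<close>. The main term tends to zero by the
  assumption with \<open>h = star A (d N)\<close>; the error is small by Cauchy-Schwarz and
  boundedness. Hence the 2-norms tend to zero.\<close>

lemma null_if_weakly_null:
  assumes d: "d \<in> cauchy_seqs A" and lim: "\<And>h. h \<in> carrier A \<Longrightarrow> (\<lambda>i. \<tau> (h \<otimes> d i)) \<longlonglongrightarrow> 0"
  shows "null d"
proof (rule null_if_n2[OF d])
  note c = cauchy_carrier[OF d]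
  obtain K where K: "K > 0" "\<And>i. mx (d i) \<le> K" using cauchy_bounded[OF d] by blast
  have "(\<lambda>i. (n2 (d i))\<^sup>2) \<longlonglongrightarrow> 0"
  proof (rule LIMSEQ_I)
    fix e :: real assume e: "e > 0"
    then have "e / (2 * K) > 0" using K(1) by simp
    moreover have "\<forall>\<epsilon>>0. \<exists>N. \<forall>i\<ge>N. \<forall>j\<ge>N. mx (d i \<ominus> d j) < \<epsilon>"
      using d by (simp add: cauchy_seqs_def max_dist_def)
    ultimately obtain N where N: "\<forall>i\<ge>N. \<forall>j\<ge>N. mx (d i \<ominus> d j) < e / (2 * K)" by blast
    obtain N' where N': "\<forall>i\<ge>N'. cmod (\<tau> (star A (d N) \<otimes> d i) - 0) < e / 2"
      using LIMSEQ_D[OF lim[OF star_closed[OF c]] half_gt_zero[OF e], of N] by blast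
    have "norm ((n2 (d i))\<^sup>2 - 0) < e" if i: "i \<ge> max N N'" for i
    proof -
      have "d i = d N \<oplus> (d i \<ominus> d N)" using c by (simp add: add_minus_cancel)
      then have "star A (d i) = star A (d N) \<oplus> star A (d i \<ominus> d N)" using c by (metis star_add minus_closed)
      then have "\<tau> (star A (d i) \<otimes> d i) = \<tau> (star A (d N) \<otimes> d i) + \<tau> (star A (d i \<ominus> d N) \<otimes> d i)"
        using c by (simp add: l_distr \<tau>_add)
      then have "cmod (\<tau> (star A (d i) \<otimes> d i)) \<le> cmod (\<tau> (star A (d N) \<otimes> d i)) + cmod (\<tau> (star A (d i \<ominus> d N) \<otimes> d i))"
        by (metis norm_triangle_ineq)
      moreover have "cmod (\<tau> (star A (d i \<ominus> d N) \<otimes> d i)) \<le> e / 2"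
      proof -
        have "cmod (\<tau> (star A (d i \<ominus> d N) \<otimes> d i)) \<le> n2 (d i \<ominus> d N) * n2 (d i)"
          by (rule cauchy_schwarz) (use c in auto)
        also have "\<dots> \<le> (e / (2 * K)) * K"
        proof (rule mult_mono)
          show "n2 (d i \<ominus> d N) \<le> e / (2 * K)"
            using n2_le_mx[of "d i \<ominus> d N"] N i c by (meson less_imp_le max.boundedE minus_closed order_refl order_trans)
          show "n2 (d i) \<le> K" using n2_le_mx[OF c, of i] K(2)[of i] by simp
        qed (use e K c n2_nonneg in auto)
        finally show ?thesis using K(1) by simp
      qed
      moreover have "cmod (\<tau> (star A (d N) \<otimes> d i)) < e / 2" using N' i by simp
      ultimately show ?thesis using c by (simp add: \<tau>_square norm_power)
    qed
    then show "\<exists>N. \<forall>i\<ge>N. norm ((n2 (d i))\<^sup>2 - 0) < e" by blast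
  qed
  then have "(\<lambda>i. sqrt ((n2 (d i))\<^sup>2)) \<longlonglongrightarrow> sqrt 0" by (rule tendsto_real_sqrt)
  then show "(\<lambda>i. n2 (d i)) \<longlonglongrightarrow> 0" using n2_nonneg[OF c] by simp
qed

lemma faithful_extend: "faithful_state (enveloping A) (extend_functional \<tau>)"
  unfolding faithful_state_def
proof (intro conjI ballI impI state_extend)
  fix x assume "x \<in> carrier (enveloping A)"
    and z: "extend_functional \<tau> (star (enveloping A) x \<otimes>\<^bsub>enveloping A\<^esub> x) = 0"
  then obtain a where a: "a \<in> cauchy_seqs A" "x = seq_class A a" by (meson enveloping_carrierE)
  have "(\<lambda>i. \<tau> (star A (a i) \<otimes> a i)) \<longlonglongrightarrow> extend_functional \<tau> (star (enveloping A) x \<otimes>\<^bsub>enveloping A\<^esub> x)"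
    unfolding a(2) enveloping_star[OF a(1)] enveloping_mult[OF cauchy_star[OF a(1)] a(1)]
    by (rule extend_functional[OF \<tau>_linear \<tau>_le cauchy_mult[OF cauchy_star[OF a(1)] a(1)]])
  then have "(\<lambda>i. complex_of_real ((n2 (a i))\<^sup>2)) \<longlonglongrightarrow> of_real 0"
    by (simp add: z \<tau>_square cauchy_carrier[OF a(1)])
  then have "(\<lambda>i. (n2 (a i))\<^sup>2) \<longlonglongrightarrow> 0" unfolding tendsto_of_real_iff .
  then have "(\<lambda>i. sqrt ((n2 (a i))\<^sup>2)) \<longlonglongrightarrow> sqrt 0" by (rule tendsto_real_sqrt)
  then have "(\<lambda>i. n2 (a i)) \<longlonglongrightarrow> 0" using n2_nonneg[OF cauchy_carrier[OF a(1)]] by simp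
  then have "null a" by (rule null_if_n2[OF a(1)])
  then have "null (\<lambda>i. a i \<ominus> \<zero>)" using cauchy_carrier[OF a(1)] by (simp add: a_minus_def)
  then have "seq_class A a = seq_class A (\<lambda>i. \<zero>)" by (intro seq_class_eqI a cauchy_const) auto
  then show "x = \<zero>\<^bsub>enveloping A\<^esub>" by (simp add: a(2) enveloping_def)
qed

text \<open>Turns equality of elements of the completion into equalities of complex numbers. The
  difference of two representatives is weakly null, hence null.\<close>

lemma enveloping_separation:
  assumes x: "x \<in> carrier (enveloping A)" and y: "y \<in> carrier (enveloping A)"
    and eq: "\<And>h. h \<in> carrier A \<Longrightarrow> extend_functional (\<lambda>a. \<tau> (h \<otimes> a)) x = extend_functional (\<lambda>a. \<tau> (h \<otimes> a)) y"
  shows "x = y"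
proof -
  obtain a where a: "a \<in> cauchy_seqs A" "x = seq_class A a" using x by (rule enveloping_carrierE)
  obtain b where b: "b \<in> cauchy_seqs A" "y = seq_class A b" using y by (rule enveloping_carrierE)
  note c = cauchy_carrier[OF a(1)] cauchy_carrier[OF b(1)]
  have d: "(\<lambda>i. a i \<oplus> (- 1) \<odot> b i) \<in> cauchy_seqs A" by (intro cauchy_add cauchy_smult a b)
  have "null (\<lambda>i. a i \<oplus> (- 1) \<odot> b i)"
  proof (rule null_if_weakly_null[OF d])
    fix h assume h: "h \<in> carrier A"
    note E = extend_functional[OF \<tau>_mult_linear[OF h] \<tau>_mult_le[OF h]]
    have "(\<lambda>i. \<tau> (h \<otimes> a i) - \<tau> (h \<otimes> b i)) \<longlonglongrightarrow>
      extend_functional (\<lambda>a. \<tau> (h \<otimes> a)) x - extend_functional (\<lambda>a. \<tau> (h \<otimes> a)) y"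
      unfolding a(2) b(2) by (intro tendsto_diff E a b)
    then show "(\<lambda>i. \<tau> (h \<otimes> (a i \<oplus> (- 1) \<odot> b i))) \<longlonglongrightarrow> 0"
      using h c by (simp add: eq r_distr smult_mult_right \<tau>_add \<tau>_smult)
  qed
  then have "null (\<lambda>i. a i \<ominus> b i)" using c by (simp add: minus_smult)
  then show ?thesis unfolding a(2) b(2) by (rule seq_class_eqI[OF a(1) b(1)])
qed

end

section \<open>Twisted group algebras\<close>

lemma circle_exp_add: "circle_exp (x + y) = circle_exp x * circle_exp y"
  by transfer (simp add: cis_mult distrib_left)

lemma circle_exp_zero [simp]: "circle_exp 0 = 1"
  by transfer simp

lemma norm_circle_exp [simp]: "cmod (circle_exp x) = 1"
  by transfer simp

lemma circle_exp_minus: "circle_exp (- x) = cnj (circle_exp x)"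
  by transfer (simp add: cis_cnj)

text \<open>Antisymmetry alone gives only \<open>2 \<sigma>(g, g) = 0\<close>, but \<open>W(g)\<^sup>* W(g) = 1\<close> needs \<open>\<sigma>(g, g) = 0\<close>.\<close>

locale alternating_bicharacter = comm_group G for G :: "'a monoid" (structure) +
  fixes \<sigma> :: "'a \<Rightarrow> 'a \<Rightarrow> circle"
  assumes \<sigma>_left: "g \<in> carrier G \<Longrightarrow> h \<in> carrier G \<Longrightarrow> k \<in> carrier G \<Longrightarrow> \<sigma> (g \<otimes> h) k = \<sigma> g k + \<sigma> h k"
    and \<sigma>_right: "g \<in> carrier G \<Longrightarrow> h \<in> carrier G \<Longrightarrow> k \<in> carrier G \<Longrightarrow> \<sigma> k (g \<otimes> h) = \<sigma> k g + \<sigma> k h"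
    and \<sigma>_alt: "g \<in> carrier G \<Longrightarrow> \<sigma> g g = 0"
begin

section \<open>The multiplier of the bicharacter\<close>

definition c :: "'a \<Rightarrow> 'a \<Rightarrow> complex" where "c g h = circle_exp (\<sigma> g h)"

lemma norm_c [simp]: "cmod (c g h) = 1"
  by (simp add: c_def)

lemma c_left: "g \<in> carrier G \<Longrightarrow> h \<in> carrier G \<Longrightarrow> k \<in> carrier G \<Longrightarrow> c (g \<otimes> h) k = c g k * c h k"
  by (simp add: c_def \<sigma>_left circle_exp_add)

lemma c_right: "g \<in> carrier G \<Longrightarrow> h \<in> carrier G \<Longrightarrow> k \<in> carrier G \<Longrightarrow> c k (g \<otimes> h) = c k g * c k h"
  by (simp add: c_def \<sigma>_right circle_exp_add)

lemma c_alt [simp]: "g \<in> carrier G \<Longrightarrow> c g g = 1"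
  by (simp add: c_def \<sigma>_alt)

lemma \<sigma>_one: "g \<in> carrier G \<Longrightarrow> \<sigma> \<one> g = 0" "g \<in> carrier G \<Longrightarrow> \<sigma> g \<one> = 0"
  using \<sigma>_left[of \<one> \<one> g] \<sigma>_right[of \<one> \<one> g] by simp_all

lemma \<sigma>_inv: "g \<in> carrier G \<Longrightarrow> h \<in> carrier G \<Longrightarrow> \<sigma> (inv g) h = - \<sigma> g h"
  "g \<in> carrier G \<Longrightarrow> h \<in> carrier G \<Longrightarrow> \<sigma> g (inv h) = - \<sigma> g h"
  using \<sigma>_left[of g "inv g" h] \<sigma>_right[of h "inv h" g] by (simp_all add: \<sigma>_one eq_neg_iff_add_eq_0 add.commute)

text \<open>Expand \<open>\<sigma> (g \<otimes> h) (g \<otimes> h) = 0\<close>; the diagonal terms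
  vanish.\<close>

lemma \<sigma>_swap:
  assumes g: "g \<in> carrier G" and h: "h \<in> carrier G"
  shows "\<sigma> h g = - \<sigma> g h"
proof -
  have "\<sigma> (g \<otimes> h) (g \<otimes> h) = \<sigma> h g + \<sigma> g h"
    using g h by (subst \<sigma>_left) (simp_all add: \<sigma>_right \<sigma>_alt add.commute)
  then show ?thesis using \<sigma>_alt[of "g \<otimes> h"] g h by (simp add: eq_neg_iff_add_eq_0)
qed

lemma c_one [simp]: "g \<in> carrier G \<Longrightarrow> c \<one> g = 1" "g \<in> carrier G \<Longrightarrow> c g \<one> = 1"
  by (simp_all add: c_def \<sigma>_one)

lemma c_inv: "g \<in> carrier G \<Longrightarrow> h \<in> carrier G \<Longrightarrow> c (inv g) h = cnj (c g h)"
  "g \<in> carrier G \<Longrightarrow> h \<in> carrier G \<Longrightarrow> c g (inv h) = cnj (c g h)"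
  by (simp_all add: c_def \<sigma>_inv circle_exp_minus)

lemma c_swap: "g \<in> carrier G \<Longrightarrow> h \<in> carrier G \<Longrightarrow> c h g = cnj (c g h)"
  by (simp add: c_def \<sigma>_swap[of g h] circle_exp_minus)

text \<open>As \<open>c\<close> is trivial on the diagonal, the twist in a convolution depends only
  on \<open>g\<close> and on the point \<open>x\<close> of evaluation.\<close>

lemma c_inv_mult: "g \<in> carrier G \<Longrightarrow> x \<in> carrier G \<Longrightarrow> c g (inv g \<otimes> x) = c g x"
  by (simp add: c_right c_inv)

abbreviation W where "W \<equiv> weyl_l1 G \<sigma>"

section \<open>The convolution algebra of summable functions\<close>

lemma mem_W: "f \<in> carrier W \<longleftrightarrow> (\<forall>g. g \<notin> carrier G \<longrightarrow> f g = 0) \<and> (\<lambda>g. cmod (f g)) summable_on carrier G"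
  by (simp add: weyl_l1_def)

lemma W_outside: "f \<in> carrier W \<Longrightarrow> g \<notin> carrier G \<Longrightarrow> f g = 0"
  by (simp add: mem_W)

lemma W_summable: "f \<in> carrier W \<Longrightarrow> (\<lambda>g. cmod (f g)) summable_on carrier G"
  by (simp add: mem_W)

lemma W_mult: "f \<otimes>\<^bsub>W\<^esub> h = (\<lambda>x. if x \<in> carrier G
    then \<Sum>\<^sub>\<infinity>g\<in>carrier G. c g x * f g * h (inv g \<otimes> x) else 0)"
proof -
  have "(\<Sum>\<^sub>\<infinity>g\<in>carrier G. circle_exp (\<sigma> g (inv g \<otimes> x)) * f g * h (inv g \<otimes> x))
     = (\<Sum>\<^sub>\<infinity>g\<in>carrier G. c g x * f g * h (inv g \<otimes> x))" if "x \<in> carrier G" for x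
    by (rule infsum_cong) (simp add: c_inv_mult[OF _ that, unfolded c_def] c_def)
  then show ?thesis by (auto simp: weyl_l1_def)
qed

lemma W_simps: "f \<oplus>\<^bsub>W\<^esub> h = (\<lambda>x. f x + h x)" "a \<odot>\<^bsub>W\<^esub> f = (\<lambda>x. a * f x)" "\<one>\<^bsub>W\<^esub> = delta_fun \<one>"
  "\<zero>\<^bsub>W\<^esub> = (\<lambda>x. 0)" "star W f = (\<lambda>x. if x \<in> carrier G then cnj (f (inv x)) else 0)"
  "nrm W f = (\<Sum>\<^sub>\<infinity>g\<in>carrier G. cmod (f g))"
  by (simp_all add: weyl_l1_def)

lemma W_nrm_nonneg: "0 \<le> nrm W f"
  unfolding W_simps by (rule infsum_nonneg) simp

lemma W_add:
  assumes f: "f \<in> carrier W" and h: "h \<in> carrier W"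
  shows "f \<oplus>\<^bsub>W\<^esub> h \<in> carrier W" "nrm W (f \<oplus>\<^bsub>W\<^esub> h) \<le> nrm W f + nrm W h"
proof -
  have s: "(\<lambda>g. cmod (f g) + cmod (h g)) summable_on carrier G"
    by (intro summable_on_add W_summable f h)
  have s': "(\<lambda>g. cmod (f g + h g)) summable_on carrier G"
    by (rule Infinite_Sum.abs_summable_on_comparison_test'[OF s]) (rule norm_triangle_ineq)
  show "f \<oplus>\<^bsub>W\<^esub> h \<in> carrier W" using s' f h by (simp add: W_simps mem_W)
  have "nrm W (f \<oplus>\<^bsub>W\<^esub> h) \<le> (\<Sum>\<^sub>\<infinity>g\<in>carrier G. cmod (f g) + cmod (h g))"
    unfolding W_simps by (rule infsum_mono[OF s' s]) (rule norm_triangle_ineq)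
  then show "nrm W (f \<oplus>\<^bsub>W\<^esub> h) \<le> nrm W f + nrm W h"
    unfolding W_simps using W_summable[OF f] W_summable[OF h] by (simp add: infsum_add)
qed

lemma W_smult:
  assumes f: "f \<in> carrier W"
  shows "a \<odot>\<^bsub>W\<^esub> f \<in> carrier W" "nrm W (a \<odot>\<^bsub>W\<^esub> f) = cmod a * nrm W f"
  using f W_summable[OF f] by (simp_all add: W_simps mem_W norm_mult infsum_cmult_right summable_on_cmult_right)

lemma W_zero: "\<zero>\<^bsub>W\<^esub> \<in> carrier W"
  by (simp add: W_simps mem_W)

lemma bij_inv: "bij_betw (\<lambda>x. inv x) (carrier G) (carrier G)"
  by (rule bij_betw_byWitness[where f' = "\<lambda>x. inv x"]) auto

lemma bij_mult: "g \<in> carrier G \<Longrightarrow> bij_betw (\<lambda>x. g \<otimes> x) (carrier G) (carrier G)"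
  by (rule bij_betw_byWitness[where f' = "\<lambda>x. inv g \<otimes> x"]) (auto simp flip: m_assoc)

lemma W_star:
  assumes f: "f \<in> carrier W"
  shows "star W f \<in> carrier W" "nrm W (star W f) = nrm W f"
proof -
  have e: "cmod (star W f x) = cmod (f (inv x))" if "x \<in> carrier G" for x using that by (simp add: W_simps)
  have "(\<lambda>x. cmod (f (inv x))) summable_on carrier G"
    using W_summable[OF f] by (subst summable_on_reindex_bij_betw[OF bij_inv, of "\<lambda>x. cmod (f x)"])
  then have "(\<lambda>x. cmod (star W f x)) summable_on carrier G"
    using summable_on_cong[of "carrier G" "\<lambda>x. cmod (star W f x)" "\<lambda>x. cmod (f (inv x))"] e by blast
  then show "star W f \<in> carrier W" by (auto simp: mem_W W_simps)
  have "nrm W (star W f) = (\<Sum>\<^sub>\<infinity>x\<in>carrier G. cmod (f (inv x)))"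
    unfolding W_simps(6) by (rule infsum_cong) (rule e)
  also have "\<dots> = nrm W f"
    unfolding W_simps(6) by (rule infsum_reindex_bij_betw[OF bij_inv, of "\<lambda>x. cmod (f x)"])
  finally show "nrm W (star W f) = nrm W f" .
qed

lemma delta_carrier: "g \<in> carrier G \<Longrightarrow> delta_fun g \<in> carrier W"
proof -
  assume g: "g \<in> carrier G"
  have "(\<lambda>x. cmod (delta_fun g x)) summable_on {g}" by (rule summable_on_finite) simp
  then have "(\<lambda>x. cmod (delta_fun g x)) summable_on carrier G"
    by (rule iffD1[OF summable_on_cong_neutral, rotated -1]) (use g in \<open>auto simp: delta_fun_def\<close>)
  then show ?thesis using g by (auto simp: mem_W delta_fun_def)
qed

text \<open>For fixed \<open>g\<close> the sum over \<open>x\<close> is translation invariant, so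
  the absolute double series factors. Exchanging the sums then gives pointwise convergence of the
  convolution and the bound on its 1-norm.\<close>

lemma conv_has_sum:
  assumes f: "f \<in> carrier W" and h: "h \<in> carrier W"
  shows "(\<lambda>(g, x). cmod (f g) * cmod (h (inv g \<otimes> x))) summable_on carrier G \<times> carrier G"
    "(\<Sum>\<^sub>\<infinity>(g, x)\<in>carrier G \<times> carrier G. cmod (f g) * cmod (h (inv g \<otimes> x))) = nrm W f * nrm W h"
proof -
  have row: "((\<lambda>x. cmod (f g) * cmod (h (inv g \<otimes> x))) has_sum cmod (f g) * nrm W h) (carrier G)" if g: "g \<in> carrier G" for g
  proof (rule has_sum_cmult_right)
    have "((\<lambda>x. cmod (h x)) has_sum nrm W h) (carrier G)"
      unfolding W_simps by (rule has_sum_infsum[OF W_summable[OF h]])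
    then show "((\<lambda>x. cmod (h (inv g \<otimes> x))) has_sum nrm W h) (carrier G)"
      using has_sum_reindex_bij_betw[OF bij_mult[OF inv_closed[OF g]], of "\<lambda>x. cmod (h x)"] by simp
  qed
  have col: "((\<lambda>g. cmod (f g) * nrm W h) has_sum nrm W f * nrm W h) (carrier G)"
    unfolding W_simps(6)[of f] by (intro has_sum_cmult_left has_sum_infsum[OF W_summable[OF f]])
  show s: "(\<lambda>(g, x). cmod (f g) * cmod (h (inv g \<otimes> x))) summable_on carrier G \<times> carrier G"
    by (rule summable_on_SigmaI[where g = "\<lambda>g. cmod (f g) * nrm W h"])
      (use row col in \<open>auto intro: has_sum_imp_summable\<close>)
  have "((\<lambda>(g, x). cmod (f g) * cmod (h (inv g \<otimes> x))) has_sum nrm W f * nrm W h) (carrier G \<times> carrier G)"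
    by (rule has_sum_SigmaI[OF _ col s]) (use row in auto)
  then show "(\<Sum>\<^sub>\<infinity>(g, x)\<in>carrier G \<times> carrier G. cmod (f g) * cmod (h (inv g \<otimes> x))) = nrm W f * nrm W h"
    by (rule infsumI)
qed

lemma conv_summable:
  assumes f: "f \<in> carrier W" and h: "h \<in> carrier W" and x: "x \<in> carrier G"
  shows "(\<lambda>g. cmod (f g) * cmod (h (inv g \<otimes> x))) summable_on carrier G"
    "(\<lambda>g. c g x * f g * h (inv g \<otimes> x)) summable_on carrier G"
proof -
  have "(\<lambda>(x, g). cmod (f g) * cmod (h (inv g \<otimes> x))) summable_on carrier G \<times> carrier G"
    using conv_has_sum(1)[OF f h] summable_on_swap[of "\<lambda>(x, g). cmod (f g) * cmod (h (inv g \<otimes> x))" "carrier G" "carrier G"]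
    by (simp add: case_prod_unfold)
  then show s: "(\<lambda>g. cmod (f g) * cmod (h (inv g \<otimes> x))) summable_on carrier G"
    using x by (rule summable_on_SigmaD1)
  have "(\<lambda>g. cmod (c g x * f g * h (inv g \<otimes> x))) summable_on carrier G"
    using s by (simp add: norm_mult)
  then show "(\<lambda>g. c g x * f g * h (inv g \<otimes> x)) summable_on carrier G" by (rule abs_summable_summable)
qed

lemma W_mult_closed:
  assumes f: "f \<in> carrier W" and h: "h \<in> carrier W"
  shows "f \<otimes>\<^bsub>W\<^esub> h \<in> carrier W" "nrm W (f \<otimes>\<^bsub>W\<^esub> h) \<le> nrm W f * nrm W h"
proof -
  define N where "N x = (\<Sum>\<^sub>\<infinity>g\<in>carrier G. cmod (f g) * cmod (h (inv g \<otimes> x)))" for x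
  have sw: "(\<lambda>(x, g). cmod (f g) * cmod (h (inv g \<otimes> x))) summable_on carrier G \<times> carrier G"
    using conv_has_sum(1)[OF f h] summable_on_swap[of "\<lambda>(x, g). cmod (f g) * cmod (h (inv g \<otimes> x))" "carrier G" "carrier G"]
    by (simp add: case_prod_unfold)
  have N: "N summable_on carrier G"
    unfolding N_def[abs_def] using summable_on_Sigma_banach[OF sw] by simp
  have "infsum N (carrier G) = (\<Sum>\<^sub>\<infinity>g\<in>carrier G. \<Sum>\<^sub>\<infinity>x\<in>carrier G. cmod (f g) * cmod (h (inv g \<otimes> x)))"
    unfolding N_def[abs_def] by (rule infsum_swap_banach[OF sw])
  also have "\<dots> = nrm W f * nrm W h"
    using infsum_Sigma'_banach[OF conv_has_sum(1)[OF f h]] conv_has_sum(2)[OF f h] by simp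
  finally have sumN: "infsum N (carrier G) = nrm W f * nrm W h" .
  have le: "cmod ((f \<otimes>\<^bsub>W\<^esub> h) x) \<le> N x" if x: "x \<in> carrier G" for x
  proof -
    have "cmod (\<Sum>\<^sub>\<infinity>g\<in>carrier G. c g x * f g * h (inv g \<otimes> x)) \<le> (\<Sum>\<^sub>\<infinity>g\<in>carrier G. cmod (c g x * f g * h (inv g \<otimes> x)))"
      by (rule norm_infsum_bound) (use conv_summable(1)[OF f h x] in \<open>simp add: norm_mult\<close>)
    then show ?thesis using x by (simp add: W_mult N_def norm_mult)
  qed
  have s: "(\<lambda>x. cmod ((f \<otimes>\<^bsub>W\<^esub> h) x)) summable_on carrier G"
    by (rule Infinite_Sum.abs_summable_on_comparison_test'[OF N le])
  then show "f \<otimes>\<^bsub>W\<^esub> h \<in> carrier W" unfolding mem_W by (simp add: W_mult)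
  have "nrm W (f \<otimes>\<^bsub>W\<^esub> h) \<le> infsum N (carrier G)" unfolding W_simps by (rule infsum_mono[OF s N le])
  then show "nrm W (f \<otimes>\<^bsub>W\<^esub> h) \<le> nrm W f * nrm W h" by (simp add: sumN)
qed

section \<open>Approximation by finitely supported functions\<close>

definition trunc :: "'a set \<Rightarrow> ('a \<Rightarrow> complex) \<Rightarrow> 'a \<Rightarrow> complex" where
  "trunc F f = (\<lambda>g. if g \<in> F then f g else 0)"

lemma trunc_carrier: "f \<in> carrier W \<Longrightarrow> trunc F f \<in> carrier W"
proof -
  assume f: "f \<in> carrier W"
  have "(\<lambda>g. cmod (trunc F f g)) summable_on carrier G"
    by (rule Infinite_Sum.abs_summable_on_comparison_test'[OF W_summable[OF f]]) (simp add: trunc_def)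
  then show ?thesis using f by (simp add: mem_W trunc_def)
qed

lemma trunc_split: "f = trunc F f \<oplus>\<^bsub>W\<^esub> trunc (- F) f"
  by (auto simp: trunc_def W_simps)

lemma nrm_trunc_compl:
  assumes f: "f \<in> carrier W" and F: "finite F" "F \<subseteq> carrier G"
  shows "nrm W (trunc (- F) f) = nrm W f - (\<Sum>g\<in>F. cmod (f g))"
proof -
  have "nrm W (trunc (- F) f) = (\<Sum>\<^sub>\<infinity>g\<in>carrier G - F. cmod (f g))"
    unfolding W_simps by (rule infsum_cong_neutral) (auto simp: trunc_def)
  also have "\<dots> = nrm W f - (\<Sum>g\<in>F. cmod (f g))"
    using infsum_Diff[OF W_summable[OF f] summable_on_finite[OF F(1), of "\<lambda>g. cmod (f g)"] F(2)] F(1) by (simp add: W_simps)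
  finally show ?thesis .
qed

lemma trunc_approx:
  assumes f: "f \<in> carrier W" and e: "e > 0"
  obtains F where "finite F" "F \<subseteq> carrier G" "nrm W (trunc (- F) f) \<le> e"
proof -
  obtain F where F: "finite F" "F \<subseteq> carrier G" "dist (\<Sum>g\<in>F. cmod (f g)) (nrm W f) \<le> e"
    using infsum_finite_approximation[OF W_summable[OF f] e] unfolding W_simps by blast
  then have "nrm W (trunc (- F) f) \<le> e" using nrm_trunc_compl[OF f F(1,2)] by (simp add: dist_real_def)
  then show ?thesis using that F by blast
qed

lemma functional_trunc:
  assumes lin: "linear_functional W \<phi>" and f: "f \<in> carrier W" and F: "finite F" "F \<subseteq> carrier G"
  shows "\<phi> (trunc F f) = (\<Sum>g\<in>F. f g * \<phi> (delta_fun g))"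
  using F
proof (induction F rule: finite_induct)
  case empty
  have "\<phi> (0 \<odot>\<^bsub>W\<^esub> f) = 0 * \<phi> f" using lin f unfolding linear_functional_def by blast
  moreover have "0 \<odot>\<^bsub>W\<^esub> f = trunc {} f" by (simp add: W_simps trunc_def)
  ultimately show ?case by simp
next
  case (insert g F)
  have d: "delta_fun g \<in> carrier W" using insert by (simp add: delta_carrier)
  have e: "trunc (insert g F) f = trunc F f \<oplus>\<^bsub>W\<^esub> f g \<odot>\<^bsub>W\<^esub> delta_fun g"
    using insert(2) by (auto simp: trunc_def W_simps delta_fun_def fun_eq_iff)
  have "\<phi> (trunc (insert g F) f) = \<phi> (trunc F f) + \<phi> (f g \<odot>\<^bsub>W\<^esub> delta_fun g)"
    unfolding e using lin trunc_carrier[OF f] W_smult(1)[OF d] unfolding linear_functional_def by blast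
  also have "\<phi> (f g \<odot>\<^bsub>W\<^esub> delta_fun g) = f g * \<phi> (delta_fun g)"
    using lin d unfolding linear_functional_def by blast
  finally show ?case using insert by simp
qed

text \<open>\<open>K\<close> only controls the tail, which can be made arbitrarily small, and the
  bound \<open>B\<close> on generators is what survives. With \<open>B = 0\<close> this says that a
  bounded functional vanishing on generators is zero.\<close>

lemma functional_bound:
  assumes lin: "linear_functional W \<phi>" and K: "\<And>f. f \<in> carrier W \<Longrightarrow> cmod (\<phi> f) \<le> K * nrm W f"
    and B: "\<And>g. g \<in> carrier G \<Longrightarrow> cmod (\<phi> (delta_fun g)) \<le> B" and f: "f \<in> carrier W"
  shows "cmod (\<phi> f) \<le> B * nrm W f"
proof (rule field_le_epsilon)
  fix e :: real assume e: "e > 0"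
  then have "e / (\<bar>K\<bar> + 1) > 0" by (simp add: add_nonneg_pos)
  then obtain F where F: "finite F" "F \<subseteq> carrier G" "nrm W (trunc (- F) f) \<le> e / (\<bar>K\<bar> + 1)"
    using trunc_approx[OF f] by blast
  have B0: "0 \<le> B" using B[OF one_closed] norm_ge_zero order_trans by blast
  have "\<phi> f = \<phi> (trunc F f \<oplus>\<^bsub>W\<^esub> trunc (- F) f)" using trunc_split[of f F] by simp
  also have "\<dots> = \<phi> (trunc F f) + \<phi> (trunc (- F) f)"
    using lin trunc_carrier[OF f] unfolding linear_functional_def by blast
  finally have "cmod (\<phi> f) \<le> cmod (\<phi> (trunc F f)) + cmod (\<phi> (trunc (- F) f))" by (simp add: norm_triangle_ineq)
  moreover have "cmod (\<phi> (trunc F f)) \<le> B * nrm W f"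
  proof -
    have "cmod (\<phi> (trunc F f)) \<le> (\<Sum>g\<in>F. cmod (f g) * B)"
      unfolding functional_trunc[OF lin f F(1,2)]
      by (rule sum_norm_le) (use B F in \<open>auto simp: norm_mult intro!: mult_left_mono\<close>)
    also have "\<dots> = B * (\<Sum>g\<in>F. cmod (f g))" by (simp add: sum_distrib_left mult.commute)
    also have "\<dots> \<le> B * nrm W f"
      using nrm_trunc_compl[OF f F(1,2)] W_nrm_nonneg[of "trunc (- F) f"] B0 by (intro mult_left_mono) auto
    finally show ?thesis .
  qed
  moreover have "cmod (\<phi> (trunc (- F) f)) \<le> e"
  proof -
    have "cmod (\<phi> (trunc (- F) f)) \<le> K * nrm W (trunc (- F) f)" by (rule K[OF trunc_carrier[OF f]])
    also have "\<dots> \<le> (\<bar>K\<bar> + 1) * nrm W (trunc (- F) f)" by (rule mult_right_mono) (auto simp: W_nrm_nonneg)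
    also have "\<dots> \<le> (\<bar>K\<bar> + 1) * (e / (\<bar>K\<bar> + 1))" by (rule mult_left_mono[OF F(3)]) simp
    also have "\<dots> = e" by (simp add: add_nonneg_eq_0_iff)
    finally show ?thesis .
  qed
  ultimately show "cmod (\<phi> f) \<le> B * nrm W f + e" by linarith
qed

lemma point_le_nrm: "f \<in> carrier W \<Longrightarrow> cmod (f x) \<le> nrm W f"
proof (cases "x \<in> carrier G")
  case True
  assume f: "f \<in> carrier W"
  have "(\<Sum>g\<in>{x}. cmod (f g)) \<le> (\<Sum>\<^sub>\<infinity>g\<in>carrier G. cmod (f g))"
    by (rule finite_sum_le_infsum[OF W_summable[OF f]]) (use True in auto)
  then show ?thesis by (simp add: W_simps)
qed (simp add: W_outside W_nrm_nonneg)

text \<open>Bounded linear operators for the 1-norm. Algebraic laws such as associativity are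
  equalities of such operators in one argument, so they can be verified on generators.\<close>

definition bop :: "(('a \<Rightarrow> complex) \<Rightarrow> 'a \<Rightarrow> complex) \<Rightarrow> bool" where
  "bop L \<longleftrightarrow> (\<forall>f\<in>carrier W. L f \<in> carrier W \<and> (\<forall>a. L (a \<odot>\<^bsub>W\<^esub> f) = a \<odot>\<^bsub>W\<^esub> L f) \<and>
     (\<forall>h\<in>carrier W. L (f \<oplus>\<^bsub>W\<^esub> h) = L f \<oplus>\<^bsub>W\<^esub> L h)) \<and> (\<exists>K\<ge>0. \<forall>f\<in>carrier W. nrm W (L f) \<le> K * nrm W f)"

lemma bopI:
  assumes "\<And>f. f \<in> carrier W \<Longrightarrow> L f \<in> carrier W"
    and "\<And>f a. f \<in> carrier W \<Longrightarrow> L (a \<odot>\<^bsub>W\<^esub> f) = a \<odot>\<^bsub>W\<^esub> L f"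
    and "\<And>f h. f \<in> carrier W \<Longrightarrow> h \<in> carrier W \<Longrightarrow> L (f \<oplus>\<^bsub>W\<^esub> h) = L f \<oplus>\<^bsub>W\<^esub> L h"
    and "0 \<le> K" "\<And>f. f \<in> carrier W \<Longrightarrow> nrm W (L f) \<le> K * nrm W f"
  shows "bop L"
  unfolding bop_def using assms by blast

text \<open>Each coordinate of \<open>L f - L' f\<close> is a bounded functional of \<open>f\<close>
  that vanishes on generators.\<close>

lemma bop_eqI:
  assumes L: "bop L" and L': "bop L'" and eq: "\<And>g. g \<in> carrier G \<Longrightarrow> L (delta_fun g) = L' (delta_fun g)"
    and f: "f \<in> carrier W"
  shows "L f = L' f"
proof
  fix x
  obtain K where K: "\<forall>f\<in>carrier W. nrm W (L f) \<le> K * nrm W f" using L unfolding bop_def by blast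
  obtain K' where K': "\<forall>f\<in>carrier W. nrm W (L' f) \<le> K' * nrm W f" using L' unfolding bop_def by blast
  have "cmod (L f x - L' f x) \<le> 0 * nrm W f"
  proof (rule functional_bound[where \<phi> = "\<lambda>f. L f x - L' f x" and K = "K + K'", OF _ _ _ f])
    show "linear_functional W (\<lambda>f. L f x - L' f x)"
      unfolding linear_functional_def
    proof (intro ballI conjI allI)
      fix f assume f: "f \<in> carrier W"
      show "L (a \<odot>\<^bsub>W\<^esub> f) x - L' (a \<odot>\<^bsub>W\<^esub> f) x = a * (L f x - L' f x)" for a
      proof -
        have "L (a \<odot>\<^bsub>W\<^esub> f) = a \<odot>\<^bsub>W\<^esub> L f" "L' (a \<odot>\<^bsub>W\<^esub> f) = a \<odot>\<^bsub>W\<^esub> L' f"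
          using L L' f unfolding bop_def by blast+
        then show ?thesis by (simp add: W_simps algebra_simps)
      qed
      fix h assume h: "h \<in> carrier W"
      have "L (f \<oplus>\<^bsub>W\<^esub> h) = L f \<oplus>\<^bsub>W\<^esub> L h" "L' (f \<oplus>\<^bsub>W\<^esub> h) = L' f \<oplus>\<^bsub>W\<^esub> L' h"
        using L L' f h unfolding bop_def by blast+
      then show "L (f \<oplus>\<^bsub>W\<^esub> h) x - L' (f \<oplus>\<^bsub>W\<^esub> h) x = L f x - L' f x + (L h x - L' h x)"
        by (simp add: W_simps)
    qed
    show "cmod (L f x - L' f x) \<le> (K + K') * nrm W f" if f: "f \<in> carrier W" for f
    proof -
      have "L f \<in> carrier W" "L' f \<in> carrier W" using L L' f unfolding bop_def by blast+
      then have "cmod (L f x) \<le> nrm W (L f)" "cmod (L' f x) \<le> nrm W (L' f)" by (simp_all add: point_le_nrm)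
      moreover have "nrm W (L f) \<le> K * nrm W f" "nrm W (L' f) \<le> K' * nrm W f" using K K' f by blast+
      ultimately show ?thesis using norm_triangle_ineq4[of "L f x" "L' f x"] by (simp add: distrib_right)
    qed
  qed (simp add: eq)
  then show "L f x = L' f x" by simp
qed

lemma bop_comp: "bop L \<Longrightarrow> bop L' \<Longrightarrow> bop (\<lambda>f. L (L' f))"
proof -
  assume L: "bop L" and L': "bop L'"
  obtain K where K: "0 \<le> K" "\<forall>f\<in>carrier W. nrm W (L f) \<le> K * nrm W f" using L unfolding bop_def by blast
  obtain K' where K': "0 \<le> K'" "\<forall>f\<in>carrier W. nrm W (L' f) \<le> K' * nrm W f" using L' unfolding bop_def by blast
  show ?thesis
  proof (rule bopI[where K = "K * K'"])
    fix f assume f: "f \<in> carrier W"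
    have "nrm W (L (L' f)) \<le> K * nrm W (L' f)" using K L' f unfolding bop_def by blast
    also have "\<dots> \<le> K * (K' * nrm W f)" using K K' f by (simp add: mult_left_mono)
    finally show "nrm W (L (L' f)) \<le> K * K' * nrm W f" by (simp add: mult.assoc)
  qed (use L L' K K' in \<open>auto simp: bop_def\<close>)
qed

lemma W_l_distr:
  assumes "f \<in> carrier W" "f' \<in> carrier W" "h \<in> carrier W"
  shows "(f \<oplus>\<^bsub>W\<^esub> f') \<otimes>\<^bsub>W\<^esub> h = f \<otimes>\<^bsub>W\<^esub> h \<oplus>\<^bsub>W\<^esub> f' \<otimes>\<^bsub>W\<^esub> h"
proof -
  have "(\<Sum>\<^sub>\<infinity>g\<in>carrier G. c g x * (f g + f' g) * h (inv g \<otimes> x)) =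
    (\<Sum>\<^sub>\<infinity>g\<in>carrier G. c g x * f g * h (inv g \<otimes> x)) + (\<Sum>\<^sub>\<infinity>g\<in>carrier G. c g x * f' g * h (inv g \<otimes> x))"
    if x: "x \<in> carrier G" for x
    using infsum_add[OF conv_summable(2)[OF assms(1,3) x] conv_summable(2)[OF assms(2,3) x]] by (simp add: algebra_simps)
  then show ?thesis unfolding W_mult W_simps(1) by auto
qed

lemma W_r_distr:
  assumes "f \<in> carrier W" "h \<in> carrier W" "h' \<in> carrier W"
  shows "f \<otimes>\<^bsub>W\<^esub> (h \<oplus>\<^bsub>W\<^esub> h') = f \<otimes>\<^bsub>W\<^esub> h \<oplus>\<^bsub>W\<^esub> f \<otimes>\<^bsub>W\<^esub> h'"
proof -
  have "(\<Sum>\<^sub>\<infinity>g\<in>carrier G. c g x * f g * (h (inv g \<otimes> x) + h' (inv g \<otimes> x))) =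
    (\<Sum>\<^sub>\<infinity>g\<in>carrier G. c g x * f g * h (inv g \<otimes> x)) + (\<Sum>\<^sub>\<infinity>g\<in>carrier G. c g x * f g * h' (inv g \<otimes> x))"
    if x: "x \<in> carrier G" for x
    using infsum_add[OF conv_summable(2)[OF assms(1,2) x] conv_summable(2)[OF assms(1,3) x]] by (simp add: algebra_simps)
  then show ?thesis unfolding W_mult W_simps(1) by auto
qed

lemma W_smult_left: "(a \<odot>\<^bsub>W\<^esub> f) \<otimes>\<^bsub>W\<^esub> h = a \<odot>\<^bsub>W\<^esub> (f \<otimes>\<^bsub>W\<^esub> h)"
proof -
  have "(\<Sum>\<^sub>\<infinity>g\<in>carrier G. c g x * (a * f g) * h (inv g \<otimes> x)) = a * (\<Sum>\<^sub>\<infinity>g\<in>carrier G. c g x * f g * h (inv g \<otimes> x))" for x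
    by (subst infsum_cmult_right'[symmetric]) (simp add: mult_ac)
  then show ?thesis by (auto simp: W_mult W_simps)
qed

lemma W_smult_right: "f \<otimes>\<^bsub>W\<^esub> (a \<odot>\<^bsub>W\<^esub> h) = a \<odot>\<^bsub>W\<^esub> (f \<otimes>\<^bsub>W\<^esub> h)"
proof -
  have "(\<Sum>\<^sub>\<infinity>g\<in>carrier G. c g x * f g * (a * h (inv g \<otimes> x))) = a * (\<Sum>\<^sub>\<infinity>g\<in>carrier G. c g x * f g * h (inv g \<otimes> x))" for x
    by (subst infsum_cmult_right'[symmetric]) (simp add: mult_ac)
  then show ?thesis by (auto simp: W_mult W_simps)
qed

lemma bop_mult_right: "h \<in> carrier W \<Longrightarrow> bop (\<lambda>f. f \<otimes>\<^bsub>W\<^esub> h)"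
  by (rule bopI[where K = "nrm W h"])
    (use W_mult_closed[of _ h] in \<open>auto simp: W_l_distr W_smult_left W_nrm_nonneg mult.commute\<close>)

lemma bop_mult_left: "f \<in> carrier W \<Longrightarrow> bop (\<lambda>h. f \<otimes>\<^bsub>W\<^esub> h)"
  by (rule bopI[where K = "nrm W f"])
    (use W_mult_closed[of f] in \<open>auto simp: W_r_distr W_smult_right W_nrm_nonneg\<close>)

lemma delta_mult:
  assumes g: "g \<in> carrier G"
  shows "delta_fun g \<otimes>\<^bsub>W\<^esub> k = (\<lambda>x. if x \<in> carrier G then c g x * k (inv g \<otimes> x) else 0)"
proof -
  have "(\<Sum>\<^sub>\<infinity>h\<in>carrier G. c h x * delta_fun g h * k (inv h \<otimes> x)) = (\<Sum>\<^sub>\<infinity>h\<in>{g}. c h x * delta_fun g h * k (inv h \<otimes> x))" for x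
    by (rule infsum_cong_neutral) (use g in \<open>auto simp: delta_fun_def\<close>)
  then show ?thesis unfolding W_mult by (auto simp: delta_fun_def)
qed

lemma mult_delta:
  assumes g: "g \<in> carrier G"
  shows "k \<otimes>\<^bsub>W\<^esub> delta_fun g = (\<lambda>x. if x \<in> carrier G then c (x \<otimes> inv g) x * k (x \<otimes> inv g) else 0)"
proof -
  have "(\<Sum>\<^sub>\<infinity>h\<in>carrier G. c h x * k h * delta_fun g (inv h \<otimes> x)) = (\<Sum>\<^sub>\<infinity>h\<in>{x \<otimes> inv g}. c h x * k h * delta_fun g (inv h \<otimes> x))"
    if x: "x \<in> carrier G" for x
  proof (rule infsum_cong_neutral)
    fix h assume h: "h \<in> carrier G - {x \<otimes> inv g}"
    have "inv h \<otimes> x \<noteq> g"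
    proof
      assume "inv h \<otimes> x = g"
      then have "h = x \<otimes> inv g" using h x g by (metis DiffD1 inv_closed inv_solve_left inv_solve_right m_comm)
      then show False using h by simp
    qed
    then show "c h x * k h * delta_fun g (inv h \<otimes> x) = 0" by (simp add: delta_fun_def)
  qed (use x g in auto)
  moreover have "inv (x \<otimes> inv g) \<otimes> x = g" if x: "x \<in> carrier G" for x
    using x g by (simp add: inv_mult m_ac)
  ultimately show ?thesis unfolding W_mult by (auto simp: delta_fun_def)
qed

lemma delta_delta:
  assumes g: "g \<in> carrier G" and h: "h \<in> carrier G"
  shows "delta_fun g \<otimes>\<^bsub>W\<^esub> delta_fun h = c g h \<odot>\<^bsub>W\<^esub> delta_fun (g \<otimes> h)"
proof
  fix x
  have "inv g \<otimes> x = h \<longleftrightarrow> x = g \<otimes> h" if "x \<in> carrier G"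
    using that g h by (metis inv_solve_left)
  then show "(delta_fun g \<otimes>\<^bsub>W\<^esub> delta_fun h) x = (c g h \<odot>\<^bsub>W\<^esub> delta_fun (g \<otimes> h)) x"
    unfolding delta_mult[OF g] using g h by (auto simp: W_simps delta_fun_def c_right)
qed

text \<open>The cocycle identity of a bicharacter: after expansion it remains that
  \<open>c h (inv g)\<close> equals \<open>c g h\<close>, which is \<open>c_swap\<close>.\<close>

lemma delta_assoc:
  assumes g: "g \<in> carrier G" and h: "h \<in> carrier G"
  shows "(delta_fun g \<otimes>\<^bsub>W\<^esub> delta_fun h) \<otimes>\<^bsub>W\<^esub> k = delta_fun g \<otimes>\<^bsub>W\<^esub> (delta_fun h \<otimes>\<^bsub>W\<^esub> k)"
proof
  fix x
  have "c g h * (c (g \<otimes> h) x * k (inv (g \<otimes> h) \<otimes> x)) = c g x * (c h (inv g \<otimes> x) * k (inv h \<otimes> (inv g \<otimes> x)))"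
    if x: "x \<in> carrier G"
    using x g h by (simp add: c_left c_right c_inv inv_mult m_ac c_swap[OF h g])
  then show "((delta_fun g \<otimes>\<^bsub>W\<^esub> delta_fun h) \<otimes>\<^bsub>W\<^esub> k) x = (delta_fun g \<otimes>\<^bsub>W\<^esub> (delta_fun h \<otimes>\<^bsub>W\<^esub> k)) x"
    using g h unfolding delta_delta[OF g h] W_smult_left unfolding delta_mult[OF g] delta_mult[OF h] delta_mult[OF m_closed[OF g h]]
    by (simp add: W_simps)
qed

text \<open>Density is used in \<open>f\<close> and then in \<open>h\<close>; the third factor can
  stay arbitrary because \<open>delta_assoc\<close> is a pointwise computation in it.\<close>

lemma W_assoc:
  assumes f: "f \<in> carrier W" and h: "h \<in> carrier W" and k: "k \<in> carrier W"
  shows "(f \<otimes>\<^bsub>W\<^esub> h) \<otimes>\<^bsub>W\<^esub> k = f \<otimes>\<^bsub>W\<^esub> (h \<otimes>\<^bsub>W\<^esub> k)"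
proof (rule bop_eqI[where L = "\<lambda>f. (f \<otimes>\<^bsub>W\<^esub> h) \<otimes>\<^bsub>W\<^esub> k" and L' = "\<lambda>f. f \<otimes>\<^bsub>W\<^esub> (h \<otimes>\<^bsub>W\<^esub> k)", OF _ _ _ f])
  show "bop (\<lambda>f. f \<otimes>\<^bsub>W\<^esub> h \<otimes>\<^bsub>W\<^esub> k)" by (rule bop_comp[OF bop_mult_right[OF k] bop_mult_right[OF h]])
  show "bop (\<lambda>f. f \<otimes>\<^bsub>W\<^esub> (h \<otimes>\<^bsub>W\<^esub> k))" by (rule bop_mult_right[OF W_mult_closed(1)[OF h k]])
  fix g assume g: "g \<in> carrier G"
  note d = delta_carrier[OF g]
  show "(delta_fun g \<otimes>\<^bsub>W\<^esub> h) \<otimes>\<^bsub>W\<^esub> k = delta_fun g \<otimes>\<^bsub>W\<^esub> (h \<otimes>\<^bsub>W\<^esub> k)"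
  proof (rule bop_eqI[where L = "\<lambda>h. (delta_fun g \<otimes>\<^bsub>W\<^esub> h) \<otimes>\<^bsub>W\<^esub> k" and L' = "\<lambda>h. delta_fun g \<otimes>\<^bsub>W\<^esub> (h \<otimes>\<^bsub>W\<^esub> k)", OF _ _ _ h])
    show "bop (\<lambda>h. (delta_fun g \<otimes>\<^bsub>W\<^esub> h) \<otimes>\<^bsub>W\<^esub> k)" by (rule bop_comp[OF bop_mult_right[OF k] bop_mult_left[OF d]])
    show "bop (\<lambda>h. delta_fun g \<otimes>\<^bsub>W\<^esub> (h \<otimes>\<^bsub>W\<^esub> k))" by (rule bop_comp[OF bop_mult_left[OF d] bop_mult_right[OF k]])
  qed (rule delta_assoc[OF g])
qed

lemma W_one_left: "k \<in> carrier W \<Longrightarrow> delta_fun \<one> \<otimes>\<^bsub>W\<^esub> k = k"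
  by (auto simp: delta_mult W_outside)

lemma W_one_right: "k \<in> carrier W \<Longrightarrow> k \<otimes>\<^bsub>W\<^esub> delta_fun \<one> = k"
  by (auto simp: mult_delta W_outside)

lemma W_star_star: "f \<in> carrier W \<Longrightarrow> star W (star W f) = f"
  by (auto simp: W_simps W_outside)

lemma W_star_add: "star W (f \<oplus>\<^bsub>W\<^esub> h) = star W f \<oplus>\<^bsub>W\<^esub> star W h"
  by (auto simp: W_simps)

lemma W_star_smult: "star W (a \<odot>\<^bsub>W\<^esub> f) = cnj a \<odot>\<^bsub>W\<^esub> star W f"
  by (auto simp: W_simps)

lemma star_delta: "g \<in> carrier G \<Longrightarrow> star W (delta_fun g) = delta_fun (inv g)"
  by (auto simp: W_simps delta_fun_def fun_eq_iff)

lemma W_star_mult: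
  assumes f: "f \<in> carrier W" and h: "h \<in> carrier W"
  shows "star W (f \<otimes>\<^bsub>W\<^esub> h) = star W h \<otimes>\<^bsub>W\<^esub> star W f"
proof -
  \<comment> \<open>A second star makes the right-hand side linear in \<open>f\<close> instead of
    conjugate-linear, so that it is an operator in the sense of \<open>bop\<close>.\<close>
  have "f \<otimes>\<^bsub>W\<^esub> h = star W (star W h \<otimes>\<^bsub>W\<^esub> star W f)"
  proof (rule bop_eqI[where L = "\<lambda>f. f \<otimes>\<^bsub>W\<^esub> h" and L' = "\<lambda>f. star W (star W h \<otimes>\<^bsub>W\<^esub> star W f)", OF _ _ _ f])
    show "bop (\<lambda>f. f \<otimes>\<^bsub>W\<^esub> h)" by (rule bop_mult_right[OF h])
    show "bop (\<lambda>f. star W (star W h \<otimes>\<^bsub>W\<^esub> star W f))"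
    proof (rule bopI[where K = "nrm W h"])
      fix f assume f: "f \<in> carrier W"
      note s = W_star(1)[OF h] W_star(1)[OF f]
      show "star W (star W h \<otimes>\<^bsub>W\<^esub> star W f) \<in> carrier W" by (intro W_star(1) W_mult_closed(1) s)
      show "star W (star W h \<otimes>\<^bsub>W\<^esub> star W (a \<odot>\<^bsub>W\<^esub> f)) = a \<odot>\<^bsub>W\<^esub> star W (star W h \<otimes>\<^bsub>W\<^esub> star W f)" for a
        by (simp add: W_star_smult W_smult_right)
      show "nrm W (star W (star W h \<otimes>\<^bsub>W\<^esub> star W f)) \<le> nrm W h * nrm W f"
        using W_mult_closed[OF s] by (simp add: W_star(2) W_mult_closed(1)[OF s] h f)
      fix k assume k: "k \<in> carrier W"
      show "star W (star W h \<otimes>\<^bsub>W\<^esub> star W (f \<oplus>\<^bsub>W\<^esub> k)) = star W (star W h \<otimes>\<^bsub>W\<^esub> star W f) \<oplus>\<^bsub>W\<^esub> star W (star W h \<otimes>\<^bsub>W\<^esub> star W k)"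
        by (simp add: W_star_add W_r_distr[OF s W_star(1)[OF k]])
    qed (rule W_nrm_nonneg)
    fix g assume g: "g \<in> carrier G"
    show "delta_fun g \<otimes>\<^bsub>W\<^esub> h = star W (star W h \<otimes>\<^bsub>W\<^esub> star W (delta_fun g))"
    proof
      fix x
      have "c g x * h (inv g \<otimes> x) = cnj (c (inv x \<otimes> g) (inv x) * cnj (h (inv (inv x \<otimes> g))))" if "x \<in> carrier G"
        using that g by (simp add: c_left c_right c_inv inv_mult m_comm)
      then show "(delta_fun g \<otimes>\<^bsub>W\<^esub> h) x = star W (star W h \<otimes>\<^bsub>W\<^esub> star W (delta_fun g)) x"
        unfolding star_delta[OF g] delta_mult[OF g] mult_delta[OF inv_closed[OF g]] using g by (simp add: W_simps)
    qed
  qed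
  then show ?thesis by (simp add: W_star_star W_mult_closed(1) W_star(1) f h)
qed

sublocale A: normed_star_algebra W
proof -
  have ag: "abelian_group W"
  proof (rule abelian_groupI)
    fix f assume f: "f \<in> carrier W"
    show "\<exists>h\<in>carrier W. h \<oplus>\<^bsub>W\<^esub> f = \<zero>\<^bsub>W\<^esub>"
      by (rule bexI[OF _ W_smult(1)[OF f, of "- 1"]]) (simp add: W_simps)
  qed (auto simp: W_add(1) W_zero, auto simp: W_simps add_ac)
  have mon: "Group.monoid W"
    by (rule Group.monoidI) (auto simp: W_mult_closed(1) W_assoc, auto simp: W_simps delta_carrier W_one_left W_one_right)
  have "ring W" by (rule ringI[OF ag mon]) (auto simp: W_l_distr W_r_distr)
  then show "normed_star_algebra W"
  proof (rule normed_star_algebra.intro, unfold_locales)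
    fix a b :: complex and x assume x: "x \<in> carrier W"
    show "(a + b) \<odot>\<^bsub>W\<^esub> x = a \<odot>\<^bsub>W\<^esub> x \<oplus>\<^bsub>W\<^esub> b \<odot>\<^bsub>W\<^esub> x" "a \<odot>\<^bsub>W\<^esub> (b \<odot>\<^bsub>W\<^esub> x) = (a * b) \<odot>\<^bsub>W\<^esub> x" "1 \<odot>\<^bsub>W\<^esub> x = x"
      by (auto simp: W_simps algebra_simps)
    fix y assume y: "y \<in> carrier W"
    show "a \<odot>\<^bsub>W\<^esub> (x \<oplus>\<^bsub>W\<^esub> y) = a \<odot>\<^bsub>W\<^esub> x \<oplus>\<^bsub>W\<^esub> a \<odot>\<^bsub>W\<^esub> y" by (auto simp: W_simps algebra_simps)
  qed (auto simp: W_smult W_smult_left W_smult_right W_star W_star_star W_star_mult W_star_add W_star_smult W_nrm_nonneg)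
qed

end

text \<open>If the ratio \<open>x / y\<close> exceeded 1, its logarithm would be positive and yet
  bounded by a multiple of \<open>(n + 1) / 2^(n + 1)\<close> for all \<open>n\<close>, which tends
  to zero.\<close>

lemma le_of_power_le_subexponential:
  fixes x y :: real
  assumes x: "0 \<le> x" and y: "0 \<le> y"
    and le: "\<And>n. x ^ (2 ^ Suc n) \<le> sqrt (real ((2 ^ n + 1) ^ d)) * y ^ (2 ^ Suc n)"
  shows "x \<le> y"
proof (rule ccontr)
  assume "\<not> x \<le> y"
  then have xy: "y < x" by simp
  have y0: "y > 0"
  proof (rule ccontr)
    assume "\<not> 0 < y"
    then have "x ^ 2 \<le> 0" using le[of 0] y by simp
    then show False using xy y by simp
  qed
  define q where "q = x / y"
  have q: "q > 1" unfolding q_def using xy y0 by simp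
  \<comment> \<open>The estimates \<open>sqrt r \<le> r\<close> for \<open>r \<ge> 1\<close> and
    \<open>2^n + 1 \<le> 2^(n + 1)\<close> are wasteful but leave a pure power of 2, whose logarithm
    is explicit.\<close>
  have bound: "q ^ (2 ^ Suc n) \<le> 2 ^ (Suc n * d)" for n
  proof -
    have sq: "sqrt r \<le> r" if "1 \<le> r" for r :: real
      using that by (intro real_le_lsqrt) (simp_all add: power2_eq_square)
    have "q ^ (2 ^ Suc n) \<le> sqrt (real ((2 ^ n + 1) ^ d))" (is "_ \<le> ?s")
      using le[of n] y0 by (simp add: q_def power_divide pos_divide_le_eq del: power_Suc)
    also have "?s \<le> real ((2 ^ n + 1) ^ d)"
      by (rule sq) (simp add: one_le_power)
    also have "\<dots> \<le> real ((2 ^ Suc n) ^ d)"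
    proof -
      have "(2 ^ n + 1) ^ d \<le> ((2::nat) ^ Suc n) ^ d" by (rule power_mono) simp_all
      then show ?thesis by (rule of_nat_mono)
    qed
    also have "\<dots> = 2 ^ (Suc n * d)" by (simp only: power_mult of_nat_power of_nat_numeral)
    finally show ?thesis .
  qed
  have log: "ln q \<le> real d * ln 2 * (real (Suc n) / 2 ^ Suc n)" for n
  proof -
    have "ln (q ^ (2 ^ Suc n)) \<le> ln (2 ^ (Suc n * d) :: real)"
      by (rule ln_mono) (use bound[of n] q in \<open>auto simp del: power_Suc\<close>)
    then have "2 ^ Suc n * ln q \<le> real (Suc n * d) * ln 2"
      using q by (simp only: ln_realpow zero_less_numeral less_trans[OF zero_less_one] of_nat_power of_nat_numeral)
    then show ?thesis by (simp add: field_simps)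
  qed
  have "(\<lambda>n. real n / 2 ^ n) \<longlonglongrightarrow> 0" by (rule lim_n_over_pown) simp
  then have "(\<lambda>n. real (Suc n) / 2 ^ Suc n) \<longlonglongrightarrow> 0" by (rule LIMSEQ_Suc)
  then have "(\<lambda>n. real d * ln 2 * (real (Suc n) / 2 ^ Suc n)) \<longlonglongrightarrow> real d * ln 2 * 0" by (intro tendsto_intros)
  then have "ln q \<le> real d * ln 2 * 0" by (rule LIMSEQ_le_const) (use log in blast)
  then show False using q by simp
qed

context alternating_bicharacter
begin

section \<open>The trace and the left regular representation\<close>

definition tr :: "('a \<Rightarrow> complex) \<Rightarrow> complex" where "tr f = f \<one>"

lemma sq_summable: "f \<in> carrier W \<Longrightarrow> (\<lambda>g. (cmod (f g))\<^sup>2) summable_on carrier G"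
proof -
  assume f: "f \<in> carrier W"
  show ?thesis
  proof (rule summable_on_comparison_test)
    show "(\<lambda>g. nrm W f * cmod (f g)) summable_on carrier G"
      by (rule summable_on_cmult_right[OF W_summable[OF f]])
    show "(cmod (f g))\<^sup>2 \<le> nrm W f * cmod (f g)" for g
      unfolding power2_eq_square by (rule mult_right_mono[OF point_le_nrm[OF f]]) simp
  qed simp
qed

lemma tr_star_mult:
  assumes f: "f \<in> carrier W"
  shows "tr (star W f \<otimes>\<^bsub>W\<^esub> f) = of_real (\<Sum>\<^sub>\<infinity>g\<in>carrier G. (cmod (f g))\<^sup>2)"
proof -
  have "tr (star W f \<otimes>\<^bsub>W\<^esub> f) = (\<Sum>\<^sub>\<infinity>g\<in>carrier G. complex_of_real ((cmod (f (inv g)))\<^sup>2))"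
    unfolding W_mult tr_def
    by (simp, rule infsum_cong) (simp add: W_simps complex_norm_square[symmetric] mult.commute)
  also have "\<dots> = (\<Sum>\<^sub>\<infinity>g\<in>carrier G. complex_of_real ((cmod (f g))\<^sup>2))"
    by (rule infsum_reindex_bij_betw[OF bij_inv, of "\<lambda>g. complex_of_real ((cmod (f g))\<^sup>2)"])
  also have "\<dots> = of_real (\<Sum>\<^sub>\<infinity>g\<in>carrier G. (cmod (f g))\<^sup>2)"
    by (rule infsumI, subst has_sum_of_real_iff, rule has_sum_infsum[OF sq_summable[OF f]])
  finally show ?thesis .
qed

text \<open>Written in the form prescribed for \<open>n2\<close>; \<open>l2_eq\<close> identifies it
  with the norm of square-summable functions.\<close>

definition l2 :: "('a \<Rightarrow> complex) \<Rightarrow> real" where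
  "l2 = (\<lambda>f. sqrt (Re (tr (star W f \<otimes>\<^bsub>W\<^esub> f))))"

lemma l2_eq: "f \<in> carrier W \<Longrightarrow> l2 f = sqrt (\<Sum>\<^sub>\<infinity>g\<in>carrier G. (cmod (f g))\<^sup>2)"
  by (simp add: l2_def tr_star_mult)

sublocale P: positive_star_algebra W tr l2
proof unfold_locales
  show "l2 \<equiv> \<lambda>f. sqrt (Re (tr (star W f \<otimes>\<^bsub>W\<^esub> f)))" by (rule eq_reflection) (rule l2_def)
  show "linear_functional W tr" by (simp add: linear_functional_def tr_def W_simps)
  show "tr \<one>\<^bsub>W\<^esub> = 1" by (simp add: tr_def W_simps delta_fun_def)
  fix f assume f: "f \<in> carrier W"
  show "tr (star W f) = cnj (tr f)" by (simp add: tr_def W_simps)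
  show "0 \<le> Re (tr (star W f \<otimes>\<^bsub>W\<^esub> f))" unfolding tr_star_mult[OF f] by (simp add: infsum_nonneg)
qed

text \<open>Multiplication by a generator permutes coordinates and multiplies them by numbers of
  modulus one.\<close>

lemma l2_delta_mult:
  assumes g: "g \<in> carrier G" and f: "f \<in> carrier W"
  shows "l2 (delta_fun g \<otimes>\<^bsub>W\<^esub> f) = l2 f"
proof -
  have "(\<Sum>\<^sub>\<infinity>x\<in>carrier G. (cmod ((delta_fun g \<otimes>\<^bsub>W\<^esub> f) x))\<^sup>2) = (\<Sum>\<^sub>\<infinity>x\<in>carrier G. (cmod (f (inv g \<otimes> x)))\<^sup>2)"
    unfolding delta_mult[OF g] by (rule infsum_cong) (simp add: norm_mult)
  also have "\<dots> = (\<Sum>\<^sub>\<infinity>x\<in>carrier G. (cmod (f x))\<^sup>2)"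
    by (rule infsum_reindex_bij_betw[OF bij_mult[OF inv_closed[OF g]], of "\<lambda>x. (cmod (f x))\<^sup>2"])
  finally show ?thesis by (simp add: l2_eq f W_mult_closed(1) delta_carrier g)
qed

lemma l2_mult_delta:
  assumes g: "g \<in> carrier G" and f: "f \<in> carrier W"
  shows "l2 (f \<otimes>\<^bsub>W\<^esub> delta_fun g) = l2 f"
proof -
  have "(\<Sum>\<^sub>\<infinity>x\<in>carrier G. (cmod ((f \<otimes>\<^bsub>W\<^esub> delta_fun g) x))\<^sup>2) = (\<Sum>\<^sub>\<infinity>x\<in>carrier G. (cmod (f (inv g \<otimes> x)))\<^sup>2)"
    unfolding mult_delta[OF g] by (rule infsum_cong) (use g in \<open>simp add: norm_mult m_comm\<close>)
  also have "\<dots> = (\<Sum>\<^sub>\<infinity>x\<in>carrier G. (cmod (f x))\<^sup>2)"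
    by (rule infsum_reindex_bij_betw[OF bij_mult[OF inv_closed[OF g]], of "\<lambda>x. (cmod (f x))\<^sup>2"])
  finally show ?thesis by (simp add: l2_eq f W_mult_closed(1) delta_carrier g)
qed

lemma tr_le_nrm: "f \<in> carrier W \<Longrightarrow> cmod (tr f) \<le> nrm W f"
  by (simp add: tr_def point_le_nrm)

text \<open>Minkowski's inequality by duality: the functional that pairs \<open>L h\<close> with the
  fixed vector \<open>L f\<close> is bounded by \<open>l2 (L f) * K\<close> on generators, hence by
  this times the 1-norm. At \<open>h = f\<close> it is the square of \<open>l2 (L f)\<close>, and
  one factor cancels.\<close>

lemma l2_bound:
  assumes L: "bop L" and iso: "\<And>g. g \<in> carrier G \<Longrightarrow> l2 (L (delta_fun g)) = K" and f: "f \<in> carrier W"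
  shows "l2 (L f) \<le> nrm W f * K"
proof -
  have Lc: "L h \<in> carrier W" if "h \<in> carrier W" for h using L that unfolding bop_def by blast
  obtain B where B: "B \<ge> 0" "\<And>h. h \<in> carrier W \<Longrightarrow> nrm W (L h) \<le> B * nrm W h" using L unfolding bop_def by blast
  let ?\<phi> = "\<lambda>h. tr (star W (L f) \<otimes>\<^bsub>W\<^esub> L h)"
  note s = W_star(1)[OF Lc[OF f]]
  have "cmod (?\<phi> f) \<le> (l2 (L f) * K) * nrm W f"
  proof (rule functional_bound[where \<phi> = ?\<phi>, OF _ _ _ f])
    show "linear_functional W ?\<phi>" unfolding linear_functional_def
    proof (intro ballI conjI allI)
      fix h assume h: "h \<in> carrier W"
      have "L (a \<odot>\<^bsub>W\<^esub> h) = a \<odot>\<^bsub>W\<^esub> L h" for a using L h unfolding bop_def by blast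
      then show "?\<phi> (a \<odot>\<^bsub>W\<^esub> h) = a * ?\<phi> h" for a by (simp add: W_smult_right) (simp add: tr_def W_simps)
      fix k assume k: "k \<in> carrier W"
      have "L (h \<oplus>\<^bsub>W\<^esub> k) = L h \<oplus>\<^bsub>W\<^esub> L k" using L h k unfolding bop_def by blast
      then show "?\<phi> (h \<oplus>\<^bsub>W\<^esub> k) = ?\<phi> h + ?\<phi> k"
        by (simp add: W_r_distr[OF s Lc[OF h] Lc[OF k]]) (simp add: tr_def W_simps)
    qed
    show "cmod (?\<phi> h) \<le> (nrm W (star W (L f)) * B) * nrm W h" if h: "h \<in> carrier W" for h
    proof -
      have "cmod (?\<phi> h) \<le> nrm W (star W (L f)) * nrm W (L h)"
        using tr_le_nrm[OF W_mult_closed(1)[OF s Lc[OF h]]] W_mult_closed(2)[OF s Lc[OF h]] by simp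
      also have "\<dots> \<le> nrm W (star W (L f)) * (B * nrm W h)" by (intro mult_left_mono B h W_nrm_nonneg)
      finally show ?thesis by (simp add: mult.assoc)
    qed
    show "cmod (?\<phi> (delta_fun g)) \<le> l2 (L f) * K" if g: "g \<in> carrier G" for g
      using P.cauchy_schwarz[OF Lc[OF delta_carrier[OF g]] Lc[OF f]] by (simp add: iso[OF g])
  qed
  then have sq: "l2 (L f) * l2 (L f) \<le> l2 (L f) * (nrm W f * K)"
    by (simp add: P.\<tau>_square[OF Lc[OF f]] norm_mult power2_eq_square mult_ac)
  have K: "0 \<le> K" using P.n2_nonneg[OF Lc[OF delta_carrier[OF one_closed]]] iso[OF one_closed] by simp
  show ?thesis
  proof (cases "l2 (L f) = 0")
    case True
    then show ?thesis using K W_nrm_nonneg[of f] by simp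
  next
    case False
    then have "l2 (L f) > 0" using P.n2_nonneg[OF Lc[OF f]] by simp
    then show ?thesis using sq by simp
  qed
qed

text \<open>Both bounds are instances of \<open>l2_bound\<close> in one factor with the other fixed;
  a generator on either side preserves the 2-norm, so \<open>K\<close> is the 2-norm of the fixed
  factor.\<close>

sublocale T: tracial_star_algebra W tr l2
proof (rule tracial_star_algebra.intro[OF P.positive_star_algebra_axioms], rule tracial_star_algebra_axioms.intro)
  fix f h assume f: "f \<in> carrier W" and h: "h \<in> carrier W"
  show "sqrt (Re (tr (star W (f \<otimes>\<^bsub>W\<^esub> h) \<otimes>\<^bsub>W\<^esub> (f \<otimes>\<^bsub>W\<^esub> h)))) \<le> nrm W f * sqrt (Re (tr (star W h \<otimes>\<^bsub>W\<^esub> h)))"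
    using l2_bound[OF bop_mult_right[OF h] l2_delta_mult[OF _ h] f] by (simp only: l2_def)
  show "sqrt (Re (tr (star W (f \<otimes>\<^bsub>W\<^esub> h) \<otimes>\<^bsub>W\<^esub> (f \<otimes>\<^bsub>W\<^esub> h)))) \<le> nrm W h * sqrt (Re (tr (star W f \<otimes>\<^bsub>W\<^esub> f)))"
    using l2_bound[OF bop_mult_left[OF f] l2_mult_delta[OF _ f] h] by (simp only: l2_def)
qed (rule eq_reflection, rule l2_def)

text \<open>Products of powers of elements of \<open>S\<close> with exponents at most \<open>N\<close>: their number grows only
  polynomially in \<open>N\<close>, since \<open>G\<close> is abelian.\<close>

definition box :: "'a set \<Rightarrow> nat \<Rightarrow> 'a set" where
  "box S N = (\<lambda>e. finprod G (\<lambda>s. s [^] e s) S) ` (S \<rightarrow>\<^sub>E {..N})"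

lemma box_card:
  assumes "finite S"
  shows "finite (box S N)" "card (box S N) \<le> (N + 1) ^ card S"
proof -
  have fin: "finite (S \<rightarrow>\<^sub>E {..N})" using assms by (intro finite_PiE) auto
  then show "finite (box S N)" by (simp add: box_def)
  have "card (box S N) \<le> card (S \<rightarrow>\<^sub>E {..N})" unfolding box_def by (rule card_image_le[OF fin])
  also have "\<dots> = (N + 1) ^ card S" using assms by (simp add: card_funcsetE)
  finally show "card (box S N) \<le> (N + 1) ^ card S" .
qed

lemma box_carrier: "S \<subseteq> carrier G \<Longrightarrow> box S N \<subseteq> carrier G"
  by (auto simp: box_def intro!: finprod_closed)

text \<open>Commutativity lets the exponents add coordinate by coordinate. This is what keeps the
  growth polynomial.\<close>

lemma box_mult:
  assumes S: "S \<subseteq> carrier G" and g: "g \<in> box S N" and h: "h \<in> box S M"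
  shows "g \<otimes> h \<in> box S (N + M)"
proof -
  obtain e where e: "e \<in> S \<rightarrow>\<^sub>E {..N}" "g = finprod G (\<lambda>s. s [^] e s) S" using g by (auto simp: box_def)
  obtain d where d: "d \<in> S \<rightarrow>\<^sub>E {..M}" "h = finprod G (\<lambda>s. s [^] d s) S" using h by (auto simp: box_def)
  define b where "b = (\<lambda>s\<in>S. e s + d s)"
  have "b \<in> S \<rightarrow>\<^sub>E {..N + M}" using e d by (auto simp: b_def PiE_iff intro: add_mono)
  moreover have "g \<otimes> h = finprod G (\<lambda>s. s [^] b s) S"
  proof -
    have "g \<otimes> h = finprod G (\<lambda>s. s [^] e s \<otimes> s [^] d s) S"
      unfolding e(2) d(2) using S by (subst finprod_multf) auto
    also have "\<dots> = finprod G (\<lambda>s. s [^] b s) S"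
      by (rule finprod_cong') (use S in \<open>auto simp: b_def nat_pow_mult\<close>)
    finally show ?thesis .
  qed
  ultimately show ?thesis unfolding box_def by blast
qed

lemma subset_box_one:
  assumes S: "S \<subseteq> carrier G" "finite S"
  shows "S \<subseteq> box S 1"
proof
  fix s assume s: "s \<in> S"
  define e where "e = (\<lambda>t\<in>S. if t = s then 1 else (0::nat))"
  have "finprod G (\<lambda>t. t [^] e t) S = finprod G (\<lambda>t. if t = s then t else \<one>) S"
    by (rule finprod_cong') (use S in \<open>auto simp: e_def\<close>)
  also have "\<dots> = s" by (rule finprod_singleton_swap[OF s S(2), of "\<lambda>t. t"]) (use S in auto)
  finally have "s = finprod G (\<lambda>t. t [^] e t) S" by simp
  moreover have "e \<in> S \<rightarrow>\<^sub>E {..1}" by (auto simp: e_def)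
  ultimately show "s \<in> box S 1" unfolding box_def by blast
qed

lemma mult_support:
  assumes "(f \<otimes>\<^bsub>W\<^esub> h) x \<noteq> 0"
  obtains g k where "f g \<noteq> 0" "h k \<noteq> 0" "g \<in> carrier G" "k \<in> carrier G" "x = g \<otimes> k"
proof -
  have x: "x \<in> carrier G" using assms by (auto simp: W_mult split: if_splits)
  have "\<exists>g\<in>carrier G. c g x * f g * h (inv g \<otimes> x) \<noteq> 0"
  proof (rule ccontr)
    assume "\<not> ?thesis"
    then have "(\<Sum>\<^sub>\<infinity>g\<in>carrier G. c g x * f g * h (inv g \<otimes> x)) = 0" by (intro infsum_0) blast
    then show False using assms x by (simp add: W_mult)
  qed
  then obtain g where g: "g \<in> carrier G" "f g \<noteq> 0" "h (inv g \<otimes> x) \<noteq> 0" by auto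
  then show ?thesis using x by (intro that[of g "inv g \<otimes> x"]) (auto simp flip: m_assoc)
qed

text \<open>Cauchy-Schwarz against the constant 1 on the finite set \<open>F\<close>.\<close>

lemma nrm_le_l2:
  assumes f: "f \<in> carrier W" and F: "finite F" "F \<subseteq> carrier G" "\<And>g. f g \<noteq> 0 \<Longrightarrow> g \<in> F"
  shows "nrm W f \<le> sqrt (real (card F)) * l2 f"
proof -
  have n: "nrm W f = (\<Sum>g\<in>F. cmod (f g))"
  proof -
    have "nrm W f = (\<Sum>\<^sub>\<infinity>g\<in>F. cmod (f g))" unfolding W_simps by (rule infsum_cong_neutral) (use F in auto)
    then show ?thesis using F(1) by simp
  qed
  have l: "(l2 f)\<^sup>2 = (\<Sum>g\<in>F. (cmod (f g))\<^sup>2)"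
  proof -
    have "(\<Sum>\<^sub>\<infinity>g\<in>carrier G. (cmod (f g))\<^sup>2) = (\<Sum>\<^sub>\<infinity>g\<in>F. (cmod (f g))\<^sup>2)" by (rule infsum_cong_neutral) (use F in auto)
    then show ?thesis using F(1) by (simp add: l2_eq f sum_nonneg)
  qed
  have "(nrm W f)\<^sup>2 \<le> (sqrt (real (card F)) * l2 f)\<^sup>2"
    using sum_squared_le_sum_of_squares[of "\<lambda>g. cmod (f g)" F] unfolding n power_mult_distrib l by (simp add: mult.commute)
  then show ?thesis by (rule power2_le_imp_le) (simp add: P.n2_nonneg f)
qed

text \<open>The power of \<open>b\<close> with exponent \<open>2^n\<close>. Repeated squaring is
  used because for selfadjoint elements the C*-identity computes the seminorm of a square
  exactly.\<close>

definition squaring :: "('a \<Rightarrow> complex) \<Rightarrow> nat \<Rightarrow> 'a \<Rightarrow> complex" where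
  "squaring b n = ((\<lambda>y. y \<otimes>\<^bsub>W\<^esub> y) ^^ n) b"

lemma squaring_simps: "squaring b 0 = b" "squaring b (Suc n) = squaring b n \<otimes>\<^bsub>W\<^esub> squaring b n"
  by (simp_all add: squaring_def)

lemma squaring_selfadjoint:
  assumes "b \<in> carrier W" "star W b = b"
  shows "squaring b n \<in> carrier W \<and> star W (squaring b n) = squaring b n"
  by (induction n) (use assms in \<open>auto simp: squaring_simps W_mult_closed(1) W_star_mult\<close>)

lemma squaring_seminorm:
  assumes \<rho>: "cstar_seminorm W \<rho>" and b: "b \<in> carrier W" "star W b = b"
  shows "\<rho> (squaring b n) = \<rho> b ^ (2 ^ n)"
proof (induction n)
  case (Suc n)
  have "\<rho> (squaring b (Suc n)) = \<rho> (star W (squaring b n) \<otimes>\<^bsub>W\<^esub> squaring b n)"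
    using squaring_selfadjoint[OF b] by (simp add: squaring_simps)
  also have "\<dots> = (\<rho> (squaring b n))\<^sup>2" by (rule A.cstar_seminormD(3)[OF \<rho>]) (use squaring_selfadjoint[OF b] in blast)
  also have "\<dots> = \<rho> b ^ (2 ^ Suc n)" unfolding Suc by (simp add: power_mult[symmetric] mult.commute)
  finally show ?case .
qed (simp add: squaring_simps)

lemma squaring_support:
  assumes "S \<subseteq> carrier G" "finite S" "\<And>g. b g \<noteq> 0 \<Longrightarrow> g \<in> S"
  shows "squaring b n g \<noteq> 0 \<Longrightarrow> g \<in> box S (2 ^ n)"
proof (induction n arbitrary: g)
  case 0
  then show ?case using subset_box_one[OF assms(1,2)] assms(3) by (auto simp: squaring_simps)
next
  case (Suc n)
  obtain h k where "squaring b n h \<noteq> 0" "squaring b n k \<noteq> 0" "g = h \<otimes> k"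
    using Suc(2) unfolding squaring_simps by (rule mult_support)
  then have "g \<in> box S (2 ^ n + 2 ^ n)" using box_mult[OF assms(1) Suc(1) Suc(1)] by simp
  then show ?case by (simp add: mult_2)
qed

text \<open>For finitely supported \<open>f\<close> and \<open>b = f\<^sup>* f\<close>, any \<open>C\<^sup>*\<close>-seminorm of \<open>b\<^bsup>2^n\<^esup>\<close> is bounded by its 1-norm, hence by its
  2-norm times a factor of polynomial growth in \<open>2^n\<close>; taking \<open>2^n\<close>-th roots removes this factor.\<close>

lemma max_le_red_finite:
  assumes f: "f \<in> carrier W" and fin: "finite {g. f g \<noteq> 0}"
  shows "A.mx f \<le> T.red f"
proof -
  define b where "b = star W f \<otimes>\<^bsub>W\<^esub> f"
  have b: "b \<in> carrier W" "star W b = b"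
    unfolding b_def using f by (simp_all add: W_mult_closed(1) W_star(1) W_star_mult W_star_star)
  \<comment> \<open>The product \<open>star W f \<otimes> f\<close> is supported on quotients of
    points of the support of \<open>f\<close>.\<close>
  define S where "S = (\<lambda>(g, k). inv g \<otimes> k) ` ({g. f g \<noteq> 0} \<times> {g. f g \<noteq> 0})"
  have supp: "f g \<noteq> 0 \<Longrightarrow> g \<in> carrier G" for g using W_outside[OF f] by blast
  have S: "S \<subseteq> carrier G" "finite S" unfolding S_def using fin supp by auto
  have bS: "g \<in> S" if "b g \<noteq> 0" for g
  proof -
    obtain h k where hk: "star W f h \<noteq> 0" "f k \<noteq> 0" "h \<in> carrier G" "k \<in> carrier G" "g = h \<otimes> k"
      using \<open>b g \<noteq> 0\<close> unfolding b_def by (rule mult_support)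
    then have "f (inv h) \<noteq> 0" by (simp add: W_simps)
    moreover have "g = (\<lambda>(g, k). inv g \<otimes> k) (inv h, k)" using hk by simp
    ultimately show ?thesis unfolding S_def using hk by blast
  qed
  note mx = A.cstar_seminorm_max and red = T.cstar_seminorm_red
  show ?thesis
  proof (rule le_of_power_le_subexponential)
    show "0 \<le> A.mx f" by (rule A.mxD(1)[OF f])
    show "0 \<le> T.red f" by (rule T.red_nonneg[OF f])
    fix n
    let ?p = "squaring b n"
    have p: "?p \<in> carrier W" using squaring_selfadjoint[OF b] by blast
    \<comment> \<open>One more doubling of the exponent comes from \<open>b\<close> being
      \<open>star W f \<otimes> f\<close>. The identity is used for the largest seminorm at the
      start of the chain of estimates and for \<open>red\<close> at its end.\<close>
    have pow: "\<rho> ?p = \<rho> f ^ (2 ^ Suc n)" if "cstar_seminorm W \<rho>" for \<rho>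
      unfolding squaring_seminorm[OF that b] unfolding b_def A.cstar_seminormD(3)[OF that f]
      by (simp add: power_mult[symmetric])
    have "A.mx f ^ (2 ^ Suc n) \<le> nrm W ?p" unfolding pow[OF mx, symmetric] by (rule A.mxD(2)[OF p])
    also have "\<dots> \<le> sqrt (real (card (box S (2 ^ n)))) * l2 ?p"
      by (rule nrm_le_l2[OF p box_card(1)[OF S(2)] box_carrier[OF S(1)]]) (rule squaring_support[OF S bS])
    also have "\<dots> \<le> sqrt (real ((2 ^ n + 1) ^ card S)) * T.red ?p"
      by (intro mult_mono real_sqrt_le_mono of_nat_mono box_card(2) S T.n2_le_red p) (simp_all add: P.n2_nonneg p)
    finally show "A.mx f ^ (2 ^ Suc n) \<le> sqrt (real ((2 ^ n + 1) ^ card S)) * T.red f ^ (2 ^ Suc n)"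
      unfolding pow[OF red] .
  qed
qed

text \<open>Cutting off a tail changes either seminorm by at most the 1-norm of the tail, so the
  inequality extends from finitely supported functions to all of \<open>W\<close>.\<close>

sublocale R: reduced_star_algebra W tr l2
proof (rule reduced_star_algebra.intro[OF T.tracial_star_algebra_axioms], rule reduced_star_algebra_axioms.intro)
  fix f assume f: "f \<in> carrier W"
  show "A.mx f \<le> T.red f"
  proof (rule field_le_epsilon)
    fix e :: real assume e: "e > 0"
    obtain F where F: "finite F" "F \<subseteq> carrier G" "nrm W (trunc (- F) f) \<le> e / 2"
      using trunc_approx[OF f half_gt_zero[OF e]] by blast
    let ?a = "trunc F f" and ?b = "trunc (- F) f"
    have ab: "?a \<in> carrier W" "?b \<in> carrier W" by (rule trunc_carrier[OF f])+
    have "A.mx f \<le> A.mx ?a + A.mx ?b" using A.mxD(5)[OF ab] trunc_split[of f F] by simp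
    moreover have "A.mx ?b \<le> e / 2" using A.mxD(2)[OF ab(2)] F(3) by simp
    moreover have "A.mx ?a \<le> T.red ?a"
      by (rule max_le_red_finite[OF ab(1)]) (rule finite_subset[OF _ F(1)], auto simp: trunc_def)
    moreover have "T.red ?a \<le> T.red f + e / 2"
    proof -
      note red = A.cstar_seminormD[OF T.cstar_seminorm_red]
      have "?a = f \<oplus>\<^bsub>W\<^esub> (- 1) \<odot>\<^bsub>W\<^esub> ?b" by (auto simp: trunc_def W_simps)
      then have "T.red ?a \<le> T.red f + T.red ((- 1) \<odot>\<^bsub>W\<^esub> ?b)" using red(5)[OF f W_smult(1)[OF ab(2), of "- 1"]] by simp
      also have "T.red ((- 1) \<odot>\<^bsub>W\<^esub> ?b) \<le> nrm W ?b" using red(4)[OF ab(2), of "- 1"] red(2)[OF ab(2)] by simp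
      finally show ?thesis using F(3) by simp
    qed
    ultimately show "A.mx f \<le> T.red f + e" by linarith
  qed
qed (rule eq_reflection, rule l2_def)

text \<open>Combines the two density steps: from the completion to summable functions by continuity,
  and from there to generators by \<open>functional_bound\<close>.\<close>

lemma weyl_functional_eq:
  assumes \<psi>: "linear_functional (weyl G \<sigma>) \<psi>" "continuous_functional (weyl G \<sigma>) \<psi>"
    and \<xi>: "linear_functional (weyl G \<sigma>) \<xi>" "continuous_functional (weyl G \<sigma>) \<xi>"
    and eq: "\<And>g. g \<in> carrier G \<Longrightarrow> \<psi> (weyl_gen G \<sigma> g) = \<xi> (weyl_gen G \<sigma> g)"
    and x: "x \<in> carrier (weyl G \<sigma>)"
  shows "\<psi> x = \<xi> x"
proof (rule A.continuous_functional_eq[OF \<psi>[unfolded weyl_def] \<xi>[unfolded weyl_def] _ x[unfolded weyl_def]])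
  fix f assume f: "f \<in> carrier W"
  obtain K where K: "\<And>x. x \<in> carrier (enveloping W) \<Longrightarrow> cmod (\<psi> x) \<le> K * nrm (enveloping W) x"
    using \<psi>(2) unfolding continuous_functional_def weyl_def by blast
  obtain L where L: "\<And>x. x \<in> carrier (enveloping W) \<Longrightarrow> cmod (\<xi> x) \<le> L * nrm (enveloping W) x"
    using \<xi>(2) unfolding continuous_functional_def weyl_def by blast
  let ?\<phi> = "\<lambda>f. \<psi> (enveloping_map W f) - \<xi> (enveloping_map W f)"
  \<comment> \<open>The factor 0 is the bound on generators, where the two functionals
    agree.\<close>
  have "cmod (?\<phi> f) \<le> 0 * nrm W f"
  proof (rule functional_bound[where \<phi> = ?\<phi>, OF _ _ _ f])
    show "linear_functional W ?\<phi>"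
      using A.enveloping_map_linear[OF \<psi>(1)[unfolded weyl_def]] A.enveloping_map_linear[OF \<xi>(1)[unfolded weyl_def]]
      by (simp add: linear_functional_def algebra_simps)
    show "cmod (?\<phi> h) \<le> (\<bar>K\<bar> + \<bar>L\<bar>) * nrm W h" if h: "h \<in> carrier W" for h
    proof -
      have "cmod (\<theta> (enveloping_map W h)) \<le> \<bar>B\<bar> * nrm W h"
        if "\<And>x. x \<in> carrier (enveloping W) \<Longrightarrow> cmod (\<theta> x) \<le> B * nrm (enveloping W) x" for \<theta> and B :: real
      proof -
        have "cmod (\<theta> (enveloping_map W h)) \<le> B * A.mx h"
          using that[OF A.enveloping_map_carrier[OF h]] by (simp add: A.nrm_enveloping_map[OF h])
        also have "\<dots> \<le> \<bar>B\<bar> * A.mx h" by (rule mult_right_mono) (auto simp: A.mxD(1)[OF h])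
        also have "\<dots> \<le> \<bar>B\<bar> * nrm W h" by (rule mult_left_mono[OF A.mxD(2)[OF h]]) simp
        finally show ?thesis .
      qed
      from this[OF K] this[OF L] show ?thesis
        using norm_triangle_ineq4[of "\<psi> (enveloping_map W h)" "\<xi> (enveloping_map W h)"] by (simp add: distrib_right)
    qed
  qed (use eq in \<open>simp add: weyl_gen_def\<close>)
  then show "\<psi> (enveloping_map W f) = \<xi> (enveloping_map W f)" by simp
qed

definition canonical_state where
  "canonical_state = A.extend_functional tr"

lemma canonical_state:
  shows "canonical_state \<in> extensional (carrier (weyl G \<sigma>))" "linear_functional (weyl G \<sigma>) canonical_state"
    "continuous_functional (weyl G \<sigma>) canonical_state"
    "g \<in> carrier G \<Longrightarrow> canonical_state (weyl_gen G \<sigma> g) = (if g = \<one> then 1 else 0)"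
proof -
  show "canonical_state \<in> extensional (carrier (weyl G \<sigma>))"
    by (simp add: canonical_state_def A.extend_functional_def weyl_def)
  show "linear_functional (weyl G \<sigma>) canonical_state" "continuous_functional (weyl G \<sigma>) canonical_state"
    unfolding canonical_state_def weyl_def by (rule A.extend_functional_linear[OF P.\<tau>_linear T.\<tau>_le]; assumption)+
  assume g: "g \<in> carrier G"
  have "canonical_state (weyl_gen G \<sigma> g) = tr (delta_fun g)"
    unfolding canonical_state_def weyl_gen_def
    by (rule A.extend_functional_map[OF P.\<tau>_linear T.\<tau>_le delta_carrier[OF g]])
  then show "canonical_state (weyl_gen G \<sigma> g) = (if g = \<one> then 1 else 0)" by (simp add: tr_def delta_fun_def)
qed

lemma canonical_state_faithful: "faithful_state (weyl G \<sigma>) canonical_state"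
  unfolding weyl_def canonical_state_def by (rule R.faithful_extend)

end

section \<open>Isomorphisms\<close>

text \<open>The inverse is a parameter, which makes the situation symmetric: every statement about
  \<open>T\<close> is available for \<open>T'\<close> through
  \<open>inverse_isometry\<close>.\<close>

locale star_isometry = A: normed_star_algebra A + B: normed_star_algebra B
  for A :: "'a star_algebra" and B :: "'b star_algebra" +
  fixes T :: "'a \<Rightarrow> 'b" and T' :: "'b \<Rightarrow> 'a"
  assumes T_closed: "x \<in> carrier A \<Longrightarrow> T x \<in> carrier B" and T'_closed: "y \<in> carrier B \<Longrightarrow> T' y \<in> carrier A"
    and T'_T: "x \<in> carrier A \<Longrightarrow> T' (T x) = x" and T_T': "y \<in> carrier B \<Longrightarrow> T (T' y) = y"
    and T_add: "x \<in> carrier A \<Longrightarrow> z \<in> carrier A \<Longrightarrow> T (x \<oplus>\<^bsub>A\<^esub> z) = T x \<oplus>\<^bsub>B\<^esub> T z"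
    and T_mult: "x \<in> carrier A \<Longrightarrow> z \<in> carrier A \<Longrightarrow> T (x \<otimes>\<^bsub>A\<^esub> z) = T x \<otimes>\<^bsub>B\<^esub> T z"
    and T_smult: "x \<in> carrier A \<Longrightarrow> T (c \<odot>\<^bsub>A\<^esub> x) = c \<odot>\<^bsub>B\<^esub> T x"
    and T_star: "x \<in> carrier A \<Longrightarrow> T (star A x) = star B (T x)"
    and T_one: "T \<one>\<^bsub>A\<^esub> = \<one>\<^bsub>B\<^esub>"
    and T_nrm: "x \<in> carrier A \<Longrightarrow> nrm B (T x) = nrm A x"
begin

lemma inverse_isometry: "star_isometry B A T' T"
proof (unfold_locales)
  fix x z assume x: "x \<in> carrier B" and z: "z \<in> carrier B"
  have inj: "a = b" if "a \<in> carrier A" "b \<in> carrier A" "T a = T b" for a b using that T'_T by metis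
  show "T' (x \<oplus>\<^bsub>B\<^esub> z) = T' x \<oplus>\<^bsub>A\<^esub> T' z"
    by (rule inj) (use x z in \<open>simp_all add: T'_closed T_T' T_add\<close>)
  show "T' (x \<otimes>\<^bsub>B\<^esub> z) = T' x \<otimes>\<^bsub>A\<^esub> T' z"
    by (rule inj) (use x z in \<open>simp_all add: T'_closed T_T' T_mult\<close>)
  show "T' (c \<odot>\<^bsub>B\<^esub> x) = c \<odot>\<^bsub>A\<^esub> T' x" for c
    by (rule inj) (use x in \<open>simp_all add: T'_closed T_T' T_smult\<close>)
  show "T' (star B x) = star A (T' x)"
    by (rule inj) (use x in \<open>simp_all add: T'_closed T_T' T_star\<close>)
  show "nrm A (T' x) = nrm B x" using T_nrm[of "T' x"] x by (simp add: T'_closed T_T')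
next
  show "T' \<one>\<^bsub>B\<^esub> = \<one>\<^bsub>A\<^esub>" using T'_T[of "\<one>\<^bsub>A\<^esub>"] by (simp add: T_one)
qed (simp_all add: T_closed T'_closed T_T' T'_T)

lemma cstar_seminorm_pullback:
  assumes "cstar_seminorm B \<rho>" shows "cstar_seminorm A (\<lambda>x. \<rho> (T x))"
  using assms unfolding cstar_seminorm_def
  by (auto simp: T_closed T_star[symmetric] T_mult[symmetric] T_add[symmetric] T_smult[symmetric] T_nrm[symmetric])
     (simp_all add: T_closed T_star T_mult T_add T_smult T_nrm)

text \<open>Each C*-seminorm of \<open>B\<close> pulls back to one of \<open>A\<close>, which
  competes in the supremum there. The same argument for \<open>T'\<close> gives equality.\<close>

lemma max_seminorm_le: "x \<in> carrier A \<Longrightarrow> B.mx (T x) \<le> A.mx x"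
  by (rule B.max_seminorm_least[OF T_closed]) (auto intro: A.max_seminorm_upper[OF cstar_seminorm_pullback])

lemma max_seminorm_eq: "x \<in> carrier A \<Longrightarrow> B.mx (T x) = A.mx x"
  using max_seminorm_le[of x] star_isometry.max_seminorm_le[OF inverse_isometry, of "T x"] by (simp add: T_closed T'_T)

lemma T_minus: "x \<in> carrier A \<Longrightarrow> z \<in> carrier A \<Longrightarrow> T (x \<ominus>\<^bsub>A\<^esub> z) = T x \<ominus>\<^bsub>B\<^esub> T z"
  by (simp add: A.minus_smult B.minus_smult T_closed T_add T_smult)

lemma cauchy_image: "a \<in> cauchy_seqs A \<Longrightarrow> (\<lambda>i. T (a i)) \<in> cauchy_seqs B"
proof -
  assume a: "a \<in> cauchy_seqs A"
  note c = A.cauchy_carrier[OF a]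
  have "max_dist B (T (a i)) (T (a j)) = max_dist A (a i) (a j)" for i j
    using max_seminorm_eq[of "a i \<ominus>\<^bsub>A\<^esub> a j"] c by (simp add: max_dist_def T_minus)
  then show ?thesis using a T_closed[OF c] unfolding cauchy_seqs_def by auto
qed

lemma seq_class_image:
  assumes a: "a \<in> cauchy_seqs A" and b: "b \<in> cauchy_seqs A" and eq: "seq_class A a = seq_class A b"
  shows "seq_class B (\<lambda>i. T (a i)) = seq_class B (\<lambda>i. T (b i))"
proof (rule B.seq_class_eqI[OF cauchy_image[OF a] cauchy_image[OF b]])
  have "B.mx (T (a i) \<ominus>\<^bsub>B\<^esub> T (b i)) = A.mx (a i \<ominus>\<^bsub>A\<^esub> b i)" for i
    using max_seminorm_eq[of "a i \<ominus>\<^bsub>A\<^esub> b i"] A.cauchy_carrier[OF a] A.cauchy_carrier[OF b] by (simp add: T_minus)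
  then show "B.null (\<lambda>i. T (a i) \<ominus>\<^bsub>B\<^esub> T (b i))"
    using A.seq_class_eqD[OF a eq] by (simp add: A.null_def B.null_def)
qed

definition lift :: "(nat \<Rightarrow> 'a) set \<Rightarrow> (nat \<Rightarrow> 'b) set" where
  "lift = (\<lambda>x\<in>carrier (enveloping A). seq_class B (\<lambda>i. T ((SOME a. a \<in> x) i)))"

lemma lift_eq:
  assumes a: "a \<in> cauchy_seqs A" shows "lift (seq_class A a) = seq_class B (\<lambda>i. T (a i))"
proof -
  define b where "b = (SOME b. b \<in> seq_class A a)"
  have "b \<in> seq_class A a" unfolding b_def
    by (rule someI[of "\<lambda>b. b \<in> seq_class A a", OF A.seq_class_self[OF a]])
  then have b: "b \<in> cauchy_seqs A" "seq_class A b = seq_class A a"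
    using A.seq_class_eqI[OF _ a] by (auto simp: A.mem_seq_class)
  then show ?thesis
    using seq_class_image[OF b(1) a b(2)] by (simp add: lift_def A.seq_class_carrier[OF a] b_def)
qed

lemma lift_bij: "bij_betw lift (carrier (enveloping A)) (carrier (enveloping B))"
proof (rule bij_betwI')
  fix x y assume "x \<in> carrier (enveloping A)" "y \<in> carrier (enveloping A)"
  then obtain a b where a: "a \<in> cauchy_seqs A" "x = seq_class A a" and b: "b \<in> cauchy_seqs A" "y = seq_class A b"
    by (meson A.enveloping_carrierE)
  note T' = T'_T[OF A.cauchy_carrier[OF a(1)]] T'_T[OF A.cauchy_carrier[OF b(1)]]
  have "x = y" if "lift x = lift y"
    using star_isometry.seq_class_image[OF inverse_isometry cauchy_image[OF a(1)] cauchy_image[OF b(1)]] that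
    unfolding a(2) b(2) lift_eq[OF a(1)] lift_eq[OF b(1)] T' by blast
  then show "(lift x = lift y) = (x = y)" by blast
next
  fix x assume "x \<in> carrier (enveloping A)"
  then obtain a where a: "a \<in> cauchy_seqs A" "x = seq_class A a" by (rule A.enveloping_carrierE)
  show "lift x \<in> carrier (enveloping B)"
    by (simp add: a(2) lift_eq[OF a(1)] B.seq_class_carrier[OF cauchy_image[OF a(1)]])
next
  fix y assume "y \<in> carrier (enveloping B)"
  then obtain b where b: "b \<in> cauchy_seqs B" "y = seq_class B b" by (rule B.enveloping_carrierE)
  have c: "(\<lambda>i. T' (b i)) \<in> cauchy_seqs A" by (rule star_isometry.cauchy_image[OF inverse_isometry b(1)])
  have "lift (seq_class A (\<lambda>i. T' (b i))) = y"
    by (simp add: b(2) lift_eq[OF c] T_T' B.cauchy_carrier[OF b(1)])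
  then show "\<exists>x\<in>carrier (enveloping A). y = lift x" using A.seq_class_carrier[OF c] by blast
qed

lemma lift_cstar_iso: "cstar_iso (enveloping A) (enveloping B) lift"
  unfolding cstar_iso_def
proof (intro conjI ballI allI)
  show "bij_betw lift (carrier (enveloping A)) (carrier (enveloping B))"
    by (rule lift_bij)
  have "\<one>\<^bsub>enveloping A\<^esub> = seq_class A (\<lambda>i. \<one>\<^bsub>A\<^esub>)" "\<one>\<^bsub>enveloping B\<^esub> = seq_class B (\<lambda>i. \<one>\<^bsub>B\<^esub>)"
    by (simp_all add: enveloping_def)
  then show "lift \<one>\<^bsub>enveloping A\<^esub> = \<one>\<^bsub>enveloping B\<^esub>"
    by (simp add: lift_eq[OF A.cauchy_const[OF A.one_closed]] T_one)
  fix x assume "x \<in> carrier (enveloping A)"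
  then obtain a where a: "a \<in> cauchy_seqs A" and x: "x = seq_class A a" by (rule A.enveloping_carrierE)
  note ac = A.cauchy_carrier[OF a] and Ta = cauchy_image[OF a]
  show "lift (star (enveloping A) x) = star (enveloping B) (lift x)"
    by (simp add: x A.enveloping_star[OF a] lift_eq[OF A.cauchy_star[OF a]] lift_eq[OF a] B.enveloping_star[OF Ta] T_star ac)
  show "nrm (enveloping B) (lift x) = nrm (enveloping A) x"
    using A.enveloping_nrm[OF a] B.enveloping_nrm[OF Ta] LIMSEQ_unique
    by (simp add: x lift_eq[OF a] max_seminorm_eq ac)
  show "lift (c \<odot>\<^bsub>enveloping A\<^esub> x) = c \<odot>\<^bsub>enveloping B\<^esub> lift x" for c
    by (simp add: x A.enveloping_smult[OF a] lift_eq[OF A.cauchy_smult[OF a]] lift_eq[OF a] B.enveloping_smult[OF Ta] T_smult ac)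
  fix y assume "y \<in> carrier (enveloping A)"
  then obtain b where b: "b \<in> cauchy_seqs A" and y: "y = seq_class A b" by (rule A.enveloping_carrierE)
  note bc = A.cauchy_carrier[OF b] and Tb = cauchy_image[OF b]
  show "lift (x \<oplus>\<^bsub>enveloping A\<^esub> y) = lift x \<oplus>\<^bsub>enveloping B\<^esub> lift y"
    by (simp add: x y A.enveloping_add[OF a b] lift_eq[OF A.cauchy_add[OF a b]] lift_eq[OF a] lift_eq[OF b]
        B.enveloping_add[OF Ta Tb] T_add ac bc)
  show "lift (x \<otimes>\<^bsub>enveloping A\<^esub> y) = lift x \<otimes>\<^bsub>enveloping B\<^esub> lift y"
    by (simp add: x y A.enveloping_mult[OF a b] lift_eq[OF A.cauchy_mult[OF a b]] lift_eq[OF a] lift_eq[OF b]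
        B.enveloping_mult[OF Ta Tb] T_mult ac bc)
qed

lemma lift_map: "x \<in> carrier A \<Longrightarrow> lift (enveloping_map A x) = enveloping_map B (T x)"
  unfolding enveloping_map_def by (rule lift_eq[OF A.cauchy_const])

end

lemma cstar_iso_functional:
  assumes \<Phi>: "cstar_iso A B \<Phi>" and \<psi>: "linear_functional B \<psi>" "continuous_functional B \<psi>"
  shows "linear_functional A (\<lambda>x. \<psi> (\<Phi> x))" "continuous_functional A (\<lambda>x. \<psi> (\<Phi> x))"
proof -
  have c: "\<Phi> x \<in> carrier B" if "x \<in> carrier A" for x using \<Phi> that unfolding cstar_iso_def bij_betw_def by blast
  show "linear_functional A (\<lambda>x. \<psi> (\<Phi> x))" using \<Phi> \<psi>(1) c unfolding cstar_iso_def linear_functional_def by simp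
  obtain K where K: "\<And>y. y \<in> carrier B \<Longrightarrow> cmod (\<psi> y) \<le> K * nrm B y" using \<psi>(2) unfolding continuous_functional_def by blast
  have "cmod (\<psi> (\<Phi> x)) \<le> K * nrm A x" if "x \<in> carrier A" for x
    using K[OF c[OF that]] \<Phi> that unfolding cstar_iso_def by simp
  then show "continuous_functional A (\<lambda>x. \<psi> (\<Phi> x))" unfolding continuous_functional_def by blast
qed

section \<open>Weyl isomorphisms from isomorphisms of groups\<close>

locale bicharacter_isomorphism = X: alternating_bicharacter G \<sigma> + Y: alternating_bicharacter H \<sigma>'
  for G :: "'a monoid" and \<sigma> and H :: "'b monoid" and \<sigma>' +
  fixes \<zeta> :: "'a \<Rightarrow> 'b"
  assumes \<zeta>: "\<zeta> \<in> iso G H"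
    and \<sigma>'_\<zeta>: "g \<in> carrier G \<Longrightarrow> h \<in> carrier G \<Longrightarrow> \<sigma>' (\<zeta> g) (\<zeta> h) = \<sigma> g h"
begin

abbreviation \<eta> where "\<eta> \<equiv> inv_into (carrier G) \<zeta>"

lemma \<zeta>_bij: "bij_betw \<zeta> (carrier G) (carrier H)"
  using \<zeta> by (simp add: iso_def)

lemma \<zeta>_closed: "g \<in> carrier G \<Longrightarrow> \<zeta> g \<in> carrier H"
  using \<zeta>_bij bij_betwE by blast

lemma \<eta>_closed: "y \<in> carrier H \<Longrightarrow> \<eta> y \<in> carrier G"
  using bij_betwE[OF bij_betw_inv_into[OF \<zeta>_bij]] by blast

lemma \<eta>_\<zeta>: "g \<in> carrier G \<Longrightarrow> \<eta> (\<zeta> g) = g"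
  by (rule bij_betw_inv_into_left[OF \<zeta>_bij])

lemma \<zeta>_\<eta>: "y \<in> carrier H \<Longrightarrow> \<zeta> (\<eta> y) = y"
  by (rule bij_betw_inv_into_right[OF \<zeta>_bij])

lemma \<zeta>_mult: "g \<in> carrier G \<Longrightarrow> h \<in> carrier G \<Longrightarrow> \<zeta> (g \<otimes>\<^bsub>G\<^esub> h) = \<zeta> g \<otimes>\<^bsub>H\<^esub> \<zeta> h"
  using \<zeta> by (simp add: iso_def hom_mult)

lemma \<zeta>_hom: "group_hom G H \<zeta>"
  using \<zeta> by (simp add: group_hom_def group_hom_axioms_def iso_def X.is_group Y.is_group)

lemma \<zeta>_one: "\<zeta> \<one>\<^bsub>G\<^esub> = \<one>\<^bsub>H\<^esub>" and \<zeta>_inv: "g \<in> carrier G \<Longrightarrow> \<zeta> (inv\<^bsub>G\<^esub> g) = inv\<^bsub>H\<^esub> (\<zeta> g)"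
  using group_hom.hom_one[OF \<zeta>_hom] group_hom.hom_inv[OF \<zeta>_hom] by auto

definition push :: "('a \<Rightarrow> complex) \<Rightarrow> 'b \<Rightarrow> complex" where
  "push f = (\<lambda>y. if y \<in> carrier H then f (\<eta> y) else 0)"

definition pull :: "('b \<Rightarrow> complex) \<Rightarrow> 'a \<Rightarrow> complex" where
  "pull f = (\<lambda>x. if x \<in> carrier G then f (\<zeta> x) else 0)"

lemma push_\<zeta>: "g \<in> carrier G \<Longrightarrow> push f (\<zeta> g) = f g"
  by (simp add: push_def \<zeta>_closed \<eta>_\<zeta>)

lemma push_delta: "g \<in> carrier G \<Longrightarrow> push (delta_fun g) = delta_fun (\<zeta> g)"
  by (auto simp: push_def delta_fun_def fun_eq_iff \<zeta>_closed \<eta>_\<zeta> \<zeta>_\<eta>)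

lemma push_eqI:
  assumes "\<And>y. y \<notin> carrier H \<Longrightarrow> k y = 0" "\<And>g. g \<in> carrier G \<Longrightarrow> k (\<zeta> g) = f g"
  shows "push f = k"
proof
  fix y
  show "push f y = k y"
    using assms(1)[of y] assms(2)[of "\<eta> y"] by (auto simp: push_def \<eta>_closed \<zeta>_\<eta>)
qed

lemma push_carrier:
  assumes f: "f \<in> carrier X.W"
  shows "push f \<in> carrier Y.W" "nrm Y.W (push f) = nrm X.W f"
proof -
  have "((\<lambda>g. cmod (push f (\<zeta> g))) has_sum nrm X.W f) (carrier G) \<longleftrightarrow> ((\<lambda>y. cmod (push f y)) has_sum nrm X.W f) (carrier H)"
    by (rule has_sum_reindex_bij_betw[OF \<zeta>_bij])
  moreover have "((\<lambda>g. cmod (push f (\<zeta> g))) has_sum nrm X.W f) (carrier G)"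
    using has_sum_infsum[OF X.W_summable[OF f]] unfolding X.W_simps
    by (subst has_sum_cong[where g = "\<lambda>g. cmod (f g)"]) (simp_all add: push_\<zeta>)
  ultimately have s: "((\<lambda>y. cmod (push f y)) has_sum nrm X.W f) (carrier H)" by blast
  then show "push f \<in> carrier Y.W" unfolding Y.mem_W by (auto simp: push_def intro: has_sum_imp_summable)
  show "nrm Y.W (push f) = nrm X.W f" unfolding Y.W_simps(6) using s by (rule infsumI)
qed

lemma pull_carrier:
  assumes f: "f \<in> carrier Y.W" shows "pull f \<in> carrier X.W"
proof -
  have "(\<lambda>g. cmod (f (\<zeta> g))) summable_on carrier G"
    using Y.W_summable[OF f] summable_on_reindex_bij_betw[OF \<zeta>_bij, of "\<lambda>y. cmod (f y)"] by simp
  then have "(\<lambda>g. cmod (pull f g)) summable_on carrier G"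
    by (subst summable_on_cong[where g = "\<lambda>g. cmod (f (\<zeta> g))"]) (simp_all add: pull_def)
  then show ?thesis by (simp add: X.mem_W pull_def)
qed

lemma push_mult: "push (f \<otimes>\<^bsub>X.W\<^esub> h) = push f \<otimes>\<^bsub>Y.W\<^esub> push h"
proof (rule push_eqI)
  fix x assume x: "x \<in> carrier G"
  have "(push f \<otimes>\<^bsub>Y.W\<^esub> push h) (\<zeta> x) = (\<Sum>\<^sub>\<infinity>y\<in>carrier H. Y.c y (\<zeta> x) * push f y * push h (inv\<^bsub>H\<^esub> y \<otimes>\<^bsub>H\<^esub> \<zeta> x))"
    by (simp add: Y.W_mult \<zeta>_closed x)
  also have "\<dots> = (\<Sum>\<^sub>\<infinity>g\<in>carrier G. Y.c (\<zeta> g) (\<zeta> x) * push f (\<zeta> g) * push h (inv\<^bsub>H\<^esub> (\<zeta> g) \<otimes>\<^bsub>H\<^esub> \<zeta> x))"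
    by (rule infsum_reindex_bij_betw[OF \<zeta>_bij, symmetric])
  also have "\<dots> = (\<Sum>\<^sub>\<infinity>g\<in>carrier G. X.c g x * f g * h (inv\<^bsub>G\<^esub> g \<otimes>\<^bsub>G\<^esub> x))"
  proof (rule infsum_cong)
    fix g assume g: "g \<in> carrier G"
    have "inv\<^bsub>H\<^esub> (\<zeta> g) \<otimes>\<^bsub>H\<^esub> \<zeta> x = \<zeta> (inv\<^bsub>G\<^esub> g \<otimes>\<^bsub>G\<^esub> x)" using g x by (simp add: \<zeta>_mult \<zeta>_inv)
    then show "Y.c (\<zeta> g) (\<zeta> x) * push f (\<zeta> g) * push h (inv\<^bsub>H\<^esub> (\<zeta> g) \<otimes>\<^bsub>H\<^esub> \<zeta> x) = X.c g x * f g * h (inv\<^bsub>G\<^esub> g \<otimes>\<^bsub>G\<^esub> x)"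
      using g x by (simp add: push_\<zeta> X.c_def Y.c_def \<sigma>'_\<zeta>)
  qed
  finally show "(push f \<otimes>\<^bsub>Y.W\<^esub> push h) (\<zeta> x) = (f \<otimes>\<^bsub>X.W\<^esub> h) x" using x by (simp add: X.W_mult)
qed (simp add: Y.W_mult)

sublocale I: star_isometry X.W Y.W push pull
proof unfold_locales
  fix f assume f: "f \<in> carrier X.W"
  show "push f \<in> carrier Y.W" "nrm Y.W (push f) = nrm X.W f" by (rule push_carrier[OF f])+
  show "pull (push f) = f" using X.W_outside[OF f] by (auto simp: pull_def push_\<zeta>)
  show "push (a \<odot>\<^bsub>X.W\<^esub> f) = a \<odot>\<^bsub>Y.W\<^esub> push f" for a by (auto simp: X.W_simps Y.W_simps push_def)
  show "push (star X.W f) = star Y.W (push f)"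
    by (rule push_eqI) (simp_all add: X.W_simps Y.W_simps \<zeta>_closed \<zeta>_inv[symmetric] push_\<zeta>)
  fix h assume h: "h \<in> carrier X.W"
  show "push (f \<oplus>\<^bsub>X.W\<^esub> h) = push f \<oplus>\<^bsub>Y.W\<^esub> push h" by (auto simp: X.W_simps Y.W_simps push_def)
  show "push (f \<otimes>\<^bsub>X.W\<^esub> h) = push f \<otimes>\<^bsub>Y.W\<^esub> push h" by (rule push_mult)
next
  fix f assume f: "f \<in> carrier Y.W"
  show "pull f \<in> carrier X.W" by (rule pull_carrier[OF f])
  show "push (pull f) = f" by (rule push_eqI) (simp_all add: pull_def Y.W_outside[OF f])
next
  show "push \<one>\<^bsub>X.W\<^esub> = \<one>\<^bsub>Y.W\<^esub>" by (simp add: X.W_simps Y.W_simps push_delta \<zeta>_one)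
qed

definition weyl_lift where "weyl_lift = I.lift"

lemma weyl_lift:
  "weyl_lift \<in> extensional (carrier (weyl G \<sigma>))" "cstar_iso (weyl G \<sigma>) (weyl H \<sigma>') weyl_lift"
  "g \<in> carrier G \<Longrightarrow> weyl_lift (weyl_gen G \<sigma> g) = weyl_gen H \<sigma>' (\<zeta> g)"
proof -
  show "weyl_lift \<in> extensional (carrier (weyl G \<sigma>))" by (simp add: weyl_lift_def I.lift_def weyl_def)
  show "cstar_iso (weyl G \<sigma>) (weyl H \<sigma>') weyl_lift" unfolding weyl_lift_def weyl_def by (rule I.lift_cstar_iso)
  assume g: "g \<in> carrier G"
  show "weyl_lift (weyl_gen G \<sigma> g) = weyl_gen H \<sigma>' (\<zeta> g)"
    unfolding weyl_lift_def weyl_gen_def by (simp add: I.lift_map X.delta_carrier g push_delta)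
qed

text \<open>A C*-isomorphism is isometric by definition, so composing it with a continuous
  functional gives a continuous one, fixed by its values on generators. The functionals built from
  the trace on the target separate points.\<close>

lemma weyl_iso_unique:
  assumes \<Phi>: "\<Phi> \<in> extensional (carrier (weyl G \<sigma>))" "cstar_iso (weyl G \<sigma>) (weyl H \<sigma>') \<Phi>"
      "\<And>g. g \<in> carrier G \<Longrightarrow> \<Phi> (weyl_gen G \<sigma> g) = weyl_gen H \<sigma>' (\<zeta> g)"
  shows "\<Phi> = weyl_lift"
proof (rule extensionalityI[OF \<Phi>(1) weyl_lift(1)])
  fix x assume x: "x \<in> carrier (weyl G \<sigma>)"
  have c: "\<Psi> x \<in> carrier (enveloping Y.W)" if "cstar_iso (weyl G \<sigma>) (weyl H \<sigma>') \<Psi>" for \<Psi>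
    using that x unfolding cstar_iso_def bij_betw_def weyl_def by blast
  show "\<Phi> x = weyl_lift x"
  proof (rule Y.R.enveloping_separation[OF c[OF \<Phi>(2)] c[OF weyl_lift(2)]])
    fix h assume h: "h \<in> carrier Y.W"
    let ?\<psi> = "Y.A.extend_functional (\<lambda>a. Y.tr (h \<otimes>\<^bsub>Y.W\<^esub> a))"
    have \<psi>: "linear_functional (weyl H \<sigma>') ?\<psi>" "continuous_functional (weyl H \<sigma>') ?\<psi>"
      unfolding weyl_def by (rule Y.A.extend_functional_linear[OF Y.T.\<tau>_mult_linear[OF h] Y.T.\<tau>_mult_le[OF h]]; assumption)+
    show "?\<psi> (\<Phi> x) = ?\<psi> (weyl_lift x)"
      by (rule X.weyl_functional_eq[OF cstar_iso_functional[OF \<Phi>(2) \<psi>] cstar_iso_functional[OF weyl_lift(2) \<psi>] _ x])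
        (simp add: \<Phi>(3) weyl_lift(3))
  qed
qed

text \<open>Both sides are continuous functionals, and on generators they agree because only the
  unit is sent to the unit.\<close>

lemma canonical_state_lift:
  assumes "x \<in> carrier (weyl G \<sigma>)"
  shows "Y.canonical_state (weyl_lift x) = X.canonical_state x"
proof (rule X.weyl_functional_eq[OF cstar_iso_functional[OF weyl_lift(2) Y.canonical_state(2,3)] X.canonical_state(2,3) _ assms])
  fix g assume g: "g \<in> carrier G"
  have "\<zeta> g = \<one>\<^bsub>H\<^esub> \<longleftrightarrow> g = \<one>\<^bsub>G\<^esub>" using \<eta>_\<zeta>[OF g] \<eta>_\<zeta>[OF X.one_closed] \<zeta>_one by metis
  then show "Y.canonical_state (weyl_lift (weyl_gen G \<sigma> g)) = X.canonical_state (weyl_gen G \<sigma> g)"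
    by (simp add: weyl_lift(3)[OF g] X.canonical_state(4)[OF g] Y.canonical_state(4)[OF \<zeta>_closed[OF g]])
qed

end

section \<open>The symplectic groups of torsion classes\<close>

lemma comm_group_DirProd:
  assumes "comm_group G" "comm_group H" shows "comm_group (G \<times>\<times> H)"
proof -
  interpret G: comm_group G by fact
  interpret H: comm_group H by fact
  show ?thesis
    by (rule group.group_comm_groupI[OF DirProd_group[OF G.is_group H.is_group]]) (auto simp: G.m_comm H.m_comm)
qed

lemma comm_group_Top_tor: "comm_group (Top_tor M k)"
  unfolding Top_tor_def by (intro comm_group_DirProd comm_group_torsion_cohomology)

lemma sigma_tor_degenerate:
  fixes M :: "('a, 'm::{finite,linorder}) spacetime_data"
  assumes "fundamental_class M S \<notin> carrier (homology_group (int CARD('m) - 1) (subtopology (mtop M) S))"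
  shows "sigma_tor M S k x y = 0"
  by (simp add: sigma_tor_def linking_degenerate[OF assms] split_beta)

context oriented_slice
begin

lemma Top_tor_mem: "x \<in> carrier (Top_tor M k) \<longleftrightarrow> fst x \<in> carrier (tors (int k)) \<and> snd x \<in> carrier (tors (int CARD('m) - int k))"
  by (cases x) (simp add: Top_tor_def)

text \<open>Biadditivity is that of the linking pairing. On the diagonal the two linking numbers in
  \<open>sigma_tor\<close> are literally equal, so the form is alternating and not merely
  antisymmetric.\<close>

lemma sigma_tor_bicharacter: "alternating_bicharacter (Top_tor M k) (sigma_tor M S k)"
proof (rule alternating_bicharacter.intro[OF comm_group_Top_tor], rule alternating_bicharacter_axioms.intro)
  let ?L = "linking M S (int CARD('m) - int k)"
  have left: "?L (u \<otimes>\<^bsub>tors (int CARD('m) - int k)\<^esub> v) w = ?L u w + ?L v w"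
    if "u \<in> carrier (tors (int CARD('m) - int k))" "v \<in> carrier (tors (int CARD('m) - int k))" "w \<in> carrier (tors (int k))" for u v w
    by (rule linking_mult_left) (use that in simp_all)
  have right: "?L w (u \<otimes>\<^bsub>tors (int k)\<^esub> v) = ?L w u + ?L w v"
    if "u \<in> carrier (tors (int k))" "v \<in> carrier (tors (int k))" "w \<in> carrier (tors (int CARD('m) - int k))" for u v w
    using linking_mult_right[of u "int CARD('m) - int k" v w] that by simp
  fix g h l assume "g \<in> carrier (Top_tor M k)" "h \<in> carrier (Top_tor M k)" "l \<in> carrier (Top_tor M k)"
  then show "sigma_tor M S k (g \<otimes>\<^bsub>Top_tor M k\<^esub> h) l = sigma_tor M S k g l + sigma_tor M S k h l"
    "sigma_tor M S k l (g \<otimes>\<^bsub>Top_tor M k\<^esub> h) = sigma_tor M S k l g + sigma_tor M S k l h"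
    by (cases g; cases h; cases l; simp add: Top_tor_def sigma_tor_def left right)+
qed (auto simp: sigma_tor_def)

lemma linking_inv:
  assumes u: "u \<in> carrier (tors p)" and w: "w \<in> carrier (tors (int CARD('m) - p))"
  shows "linking M S p (inv\<^bsub>tors p\<^esub> u) w = - linking M S p u w"
proof -
  interpret T: comm_group "tors p" by (rule comm_group_torsion_cohomology)
  have "linking M S p (\<one>\<^bsub>tors p\<^esub> \<otimes>\<^bsub>tors p\<^esub> \<one>\<^bsub>tors p\<^esub>) w = linking M S p \<one>\<^bsub>tors p\<^esub> w + linking M S p \<one>\<^bsub>tors p\<^esub> w"
    by (rule linking_mult_left) (use w in simp_all)
  then have "linking M S p \<one>\<^bsub>tors p\<^esub> w = 0" by simp
  moreover have "linking M S p (u \<otimes>\<^bsub>tors p\<^esub> inv\<^bsub>tors p\<^esub> u) w = linking M S p u w + linking M S p (inv\<^bsub>tors p\<^esub> u) w"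
    by (rule linking_mult_left) (use u w in simp_all)
  ultimately show ?thesis using u by (simp add: eq_neg_iff_add_eq_0 add.commute)
qed

text \<open>The groups are written multiplicatively, so the sign in \<open>zeta_tor\<close> is a
  power with exponent 1 or -1.\<close>

lemma linking_sign_power:
  assumes u: "u \<in> carrier (tors p)" and w: "w \<in> carrier (tors (int CARD('m) - p))"
  shows "linking M S p (u [^]\<^bsub>tors p\<^esub> ((- 1) ^ n :: int)) w = alt n (linking M S p u w)"
proof -
  interpret T: comm_group "tors p" by (rule comm_group_torsion_cohomology)
  show ?thesis
    using u linking_inv[OF u w] T.int_pow_neg_int[OF u, of 1] by (cases "even n") (simp_all add: alt_def)
qed

text \<open>The duality exchanges the arguments of each linking number, at the cost of
  \<open>(-1)^(k (m - k))\<close>, and also the two terms of the difference, at the cost of -1. The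
  exponent in \<open>zeta_tor\<close> compensates both signs.\<close>

lemma sigma_tor_zeta:
  assumes k: "k \<le> CARD('m)" and x: "x \<in> carrier (Top_tor M k)" and y: "y \<in> carrier (Top_tor M k)"
  shows "sigma_tor M S (CARD('m) - k) (zeta_tor M k x) (zeta_tor M k y) = sigma_tor M S k x y"
proof -
  obtain t t1 where x': "x = (t, t1)" "t \<in> carrier (tors (int k))" "t1 \<in> carrier (tors (int CARD('m) - int k))"
    using x by (cases x) (simp add: Top_tor_mem)
  obtain u u1 where y': "y = (u, u1)" "u \<in> carrier (tors (int k))" "u1 \<in> carrier (tors (int CARD('m) - int k))"
    using y by (cases y) (simp add: Top_tor_mem)
  have d: "int CARD('m) - int (CARD('m) - k) = int k" using k by (simp add: of_nat_diff)
  show ?thesis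
    unfolding x'(1) y'(1) sigma_tor_def zeta_tor_def prod.case d
      linking_sign_power[OF x'(2) y'(3)] linking_sign_power[OF y'(2) x'(3)]
      linking_commute[OF k y'(2) x'(3)] linking_commute[OF k x'(2) y'(3)]
    by (simp add: alt_Suc)
qed

end

lemma zeta_tor_iso:
  fixes M :: "('a, 'm::{finite,linorder}) spacetime_data"
  assumes k: "k \<le> CARD('m)"
  shows "zeta_tor M k \<in> iso (Top_tor M k) (Top_tor M (CARD('m) - k))"
proof -
  let ?n = "k * (CARD('m) - k) + 1"
  let ?T = "torsion_cohomology (int k) (mtop M)" and ?T1 = "torsion_cohomology (int CARD('m) - int k) (mtop M)"
  interpret T: comm_group ?T by (rule comm_group_torsion_cohomology)
  interpret T1: comm_group ?T1 by (rule comm_group_torsion_cohomology)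
  have top: "Top_tor M k = ?T \<times>\<times> ?T1" "Top_tor M (CARD('m) - k) = ?T1 \<times>\<times> ?T"
    using k by (simp_all add: Top_tor_def of_nat_diff)
  define s where "s t = t [^]\<^bsub>?T\<^esub> ((- 1) ^ ?n :: int)" for t
  have s: "s t = (if even ?n then t else inv\<^bsub>?T\<^esub> t)" if "t \<in> carrier ?T" for t
    using that T.int_pow_neg_int[OF that, of 1] by (cases "even ?n") (simp_all add: s_def)
  have z: "zeta_tor M k = (\<lambda>(t, t1). (t1, s t))" by (simp add: zeta_tor_def s_def)
  have cl: "s t \<in> carrier ?T" if "t \<in> carrier ?T" for t using that by (simp add: s_def)
  have ss: "s (s t) = t" if "t \<in> carrier ?T" for t using s[OF that] s[OF cl[OF that]] that by (auto split: if_splits)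
  show ?thesis
  proof (rule isoI)
    show "zeta_tor M k \<in> hom (Top_tor M k) (Top_tor M (CARD('m) - k))"
      unfolding top z by (rule homI) (auto simp: cl s T.inv_mult)
    \<comment> \<open>The sign squares to one, so the inverse map exchanges the components again and
      applies the same sign.\<close>
    show "bij_betw (zeta_tor M k) (carrier (Top_tor M k)) (carrier (Top_tor M (CARD('m) - k)))"
      unfolding top z by (rule bij_betw_byWitness[where f' = "\<lambda>(t1, t). (s t, t1)"]) (auto simp: cl ss)
  qed
qed

text \<open>The distinction concerns the choice operator in \<open>fundamental_class\<close>. If it
  yields a homology class, a cycle in it instantiates \<open>oriented_slice\<close>; otherwise any
  isomorphism preserves the zero form.\<close>

lemma Top_tor_bicharacter_isomorphism:
  fixes M :: "('a, 'm::{finite,linorder}) spacetime_data"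
  assumes k: "k \<le> CARD('m)"
  shows "bicharacter_isomorphism (Top_tor M k) (sigma_tor M S k)
    (Top_tor M (CARD('m) - k)) (sigma_tor M S (CARD('m) - k)) (zeta_tor M k)"
proof (cases "fundamental_class M S \<in> carrier (homology_group (int CARD('m) - 1) (subtopology (mtop M) S))")
  case True
  have "int CARD('m) - 1 = int (CARD('m) - 1)"
    using zero_less_card_finite[where 'a = 'm] by (simp add: of_nat_diff Suc_leI)
  then obtain z where "z \<in> fundamental_class M S" using homology_class_nonempty True by metis
  then interpret oriented_slice M S z using True by unfold_locales
  show ?thesis
    by (intro bicharacter_isomorphism.intro bicharacter_isomorphism_axioms.intro sigma_tor_bicharacter zeta_tor_iso k sigma_tor_zeta)
next
  case False
  have "alternating_bicharacter (Top_tor M j) (sigma_tor M S j)" for j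
    by (rule alternating_bicharacter.intro[OF comm_group_Top_tor], rule alternating_bicharacter_axioms.intro)
      (simp_all add: sigma_tor_degenerate[OF False])
  then show ?thesis
    by (intro bicharacter_isomorphism.intro bicharacter_isomorphism_axioms.intro zeta_tor_iso k)
      (simp_all add: sigma_tor_degenerate[OF False])
qed

text \<open>Existence and uniqueness in one equivalence, from which the description in
  \<open>omega_tor\<close> evaluates to the canonical trace.\<close>

lemma is_omega_iff:
  fixes M :: "('a, 'm::{finite,linorder}) spacetime_data"
  assumes "alternating_bicharacter (Top_tor M k) (sigma_tor M S k)"
  shows "is_omega M S k \<omega> \<longleftrightarrow> \<omega> = alternating_bicharacter.canonical_state (Top_tor M k) (sigma_tor M S k)"
proof -
  interpret X: alternating_bicharacter "Top_tor M k" "sigma_tor M S k" by fact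
  show ?thesis
  proof
    assume \<omega>: "is_omega M S k \<omega>"
    then have ext: "\<omega> \<in> extensional (carrier (weyl (Top_tor M k) (sigma_tor M S k)))"
      and lin: "linear_functional (weyl (Top_tor M k) (sigma_tor M S k)) \<omega>"
      and cont: "continuous_functional (weyl (Top_tor M k) (sigma_tor M S k)) \<omega>"
      and gen: "\<And>g. g \<in> carrier (Top_tor M k) \<Longrightarrow>
        \<omega> (weyl_gen (Top_tor M k) (sigma_tor M S k) g) = (if g = \<one>\<^bsub>Top_tor M k\<^esub> then 1 else 0)"
      unfolding is_omega_def Let_def by blast+
    show "\<omega> = X.canonical_state"
    proof (rule extensionalityI[OF _ X.canonical_state(1)])
      fix x assume "x \<in> carrier (weyl (Top_tor M k) (sigma_tor M S k))"
      then show "\<omega> x = X.canonical_state x"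
        by (rule X.weyl_functional_eq[OF lin cont X.canonical_state(2,3), rotated]) (simp only: gen X.canonical_state(4))
    qed (rule ext)
  next
    assume "\<omega> = X.canonical_state"
    then show "is_omega M S k \<omega>" unfolding is_omega_def Let_def using X.canonical_state by blast
  qed
qed

theorem proposition4p11:
  fixes M :: "('a, 'm::{finite,linorder}) spacetime_data" and S :: "'a set" and k :: nat
  assumes "spacetime M" and "globally_hyperbolic M"
    and "compact_spacelike_cauchy_surface M S"
    and "k \<le> CARD('m)"
  shows "(\<exists>!\<omega>. is_omega M S k \<omega>) \<and>
    faithful_state (weyl (Top_tor M k) (sigma_tor M S k)) (omega_tor M S k) \<and>
    (\<exists>!\<Phi>. is_weyl_zeta M S k \<Phi>) \<and>
    (\<forall>x \<in> carrier (weyl (Top_tor M k) (sigma_tor M S k)).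
       omega_tor M S (CARD('m) - k) (weyl_zeta M S k x) = omega_tor M S k x)"
proof -
  \<comment> \<open>The isomorphism carries both twisted group algebras, so the two states and the
    map between them come from one instance.\<close>
  interpret Z: bicharacter_isomorphism "Top_tor M k" "sigma_tor M S k"
    "Top_tor M (CARD('m) - k)" "sigma_tor M S (CARD('m) - k)" "zeta_tor M k"
    by (rule Top_tor_bicharacter_isomorphism[OF assms(4)])
  have X: "is_omega M S k \<omega> \<longleftrightarrow> \<omega> = Z.X.canonical_state" for \<omega> by (rule is_omega_iff) unfold_locales
  have Y: "is_omega M S (CARD('m) - k) \<omega> \<longleftrightarrow> \<omega> = Z.Y.canonical_state" for \<omega> by (rule is_omega_iff) unfold_locales
  have P: "is_weyl_zeta M S k \<Phi> \<longleftrightarrow> \<Phi> = Z.weyl_lift" for \<Phi>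
    unfolding is_weyl_zeta_def Let_def using Z.weyl_iso_unique Z.weyl_lift by blast
  have "omega_tor M S k = Z.X.canonical_state" "omega_tor M S (CARD('m) - k) = Z.Y.canonical_state"
    "weyl_zeta M S k = Z.weyl_lift"
    by (simp_all add: omega_tor_def weyl_zeta_def X Y P)
  then show ?thesis by (simp add: X P Z.X.canonical_state_faithful Z.canonical_state_lift)
qed

end
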